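(* Let $r\ge 1$. For $1\le k\le r$ let $\lambda^{(k)}\vdash n$ and let $i_k$ be a part of $\lambda^{(k)}$. Let $\mu\vdash n$ and let $j$ be a part of $\mu$. Then \[ [K_{\mu,j}]\prod_{1\le k\le r}K_{\lambda^{(k)},i_k} = \frac{1}{n!}\sum_{\substack{\rho\vdash n\\ \ell\in\rho}} \frac{\gamma^{\rho,\ell}_{\mu,j}\,d_\rho}{d_{\ell_-(\rho)}^{\,r}}\prod_{1\le k\le r}|\mathcal{C}_{\lambda^{(k)},i_k}|\,\gamma^{\rho,\ell}_{\lambda^{(k)},i_k}. \]
   Context: $\mathfrak{S}_n$ is the symmetric group on $\{1,\dots,n\}$, $\mathbb{C}[\mathfrak{S}_n]$ its group algebra, and $Z_1(n)$ the set of elements commuting with every element of the subgroup $\mathfrak{S}_{n-1}$ fixing $n$. For $\lambda\vdash n$ and a part $i$ of $\lambda$, $\mathcal{C}_{\lambda,i}$ is the set of permutations of cycle type $\lambda$ in which $n$ lies on a cycle of length $i$, and $K_{\lambda,i}$ is the sum of its elements; these (over $\lambda\vdash n$ and distinct parts $i$) form a basis of $Z_1(n)$; $[K_{\mu,j}]g$ is the coefficient of $K_{\mu,j}$ in $g$; sums "$\ell\in\rho$" range over distinct parts. $d_\rho$ is the number of standard Young tableaux of shape $\rho$; $\ell_-(\rho)$ is obtained from $\rho$ by replacing one part $\ell$ by $\ell-1$ (deleting it if $\ell=1$). $e_T$ is Young's seminormal unit of a standard Young tableau $T$; $\mathrm{SYT}_{\rho,\ell}$ is the set of standard Young tableaux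 of shape $\rho$ with $n$ at the end of a row of length $\ell$; $\Gamma^{\rho,\ell}=\sum_{T\in\mathrm{SYT}_{\rho,\ell}}e_T\in Z_1(n)$. Generalized characters: $\gamma^{\rho,\ell}_{\lambda,i}:=\frac{n!}{d_\rho}[K_{\lambda,i}]\Gamma^{\rho,\ell}$. *)

theory Defs
  imports Complex_Main "HOL-Library.Multiset" "HOL-Combinatorics.Permutations"
    "HOL-Combinatorics.Orbits"
begin

section \<open>Partitions and classes of permutations\<close>

definition partitions :: "nat \<Rightarrow> nat multiset set" where
  "partitions n = {lam. 0 \<notin># lam \<and> sum_mset lam = n}"

lemma size_le_sum_mset: "0 \<notin># lam \<Longrightarrow> size lam \<le> sum_mset (lam :: nat multiset)"
  by (induction lam) auto

lemma finite_partitions: "finite (partitions n)"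
proof -
  have "lam \<in> mset ` {xs. set xs \<subseteq> {..n} \<and> length xs \<le> n}" if "lam \<in> partitions n" for lam
  proof -
    obtain xs where xs: "lam = mset xs" by (metis ex_mset)
    have "length xs \<le> n"
      using size_le_sum_mset[of lam] that xs by (simp add: partitions_def)
    moreover have "set xs \<subseteq> {..n}"
      using that xs by (auto simp: partitions_def sum_mset_sum_list intro: member_le_sum_list)
    ultimately show ?thesis using xs by blast
  qed
  then have "partitions n \<subseteq> mset ` {xs. set xs \<subseteq> {..n} \<and> length xs \<le> n}" by blast
  then show ?thesis
    by (rule finite_subset) (intro finite_imageI finite_lists_length_le finite_atMost)
qed

definition lower_part :: "nat \<Rightarrow> nat multiset \<Rightarrow> nat multiset" where
  "lower_part l rho = rho - {#l#} + (if l = 1 then {#} else {#l - 1#})"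

text \<open>One entry per orbit, fixed points included.\<close>

definition cycle_type :: "nat \<Rightarrow> (nat \<Rightarrow> nat) \<Rightarrow> nat multiset" where
  "cycle_type n \<sigma> = image_mset card (mset_set (orbit \<sigma> ` {1..n}))"

definition near_class :: "nat \<Rightarrow> nat multiset \<Rightarrow> nat \<Rightarrow> (nat \<Rightarrow> nat) set" where
  "near_class n lam i =
     {\<sigma>. \<sigma> permutes {1..n} \<and> cycle_type n \<sigma> = lam \<and> card (orbit \<sigma> n) = i}"

section \<open>The group algebra of the symmetric group\<close>

text \<open>
  An element of the complex group algebra of the symmetric group on \<open>{1..n}\<close> is its coefficient
  function, which is zero off the permutations of \<open>{1..n}\<close>. The inclusion of the algebra for
  \<open>n - 1\<close> in the algebra for \<open>n\<close> is then the identity on coefficient functions.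
\<close>

type_synonym galg = "(nat \<Rightarrow> nat) \<Rightarrow> complex"

definition ga_one :: galg where
  "ga_one = (\<lambda>\<sigma>. if \<sigma> = id then 1 else 0)"

definition ga_mult :: "nat \<Rightarrow> galg \<Rightarrow> galg \<Rightarrow> galg" where
  "ga_mult n f g = (\<lambda>\<sigma>. \<Sum>\<pi> | \<pi> permutes {1..n}. f \<pi> * g (inv \<pi> \<circ> \<sigma>))"

definition ga_scale :: "complex \<Rightarrow> galg \<Rightarrow> galg" where
  "ga_scale c f = (\<lambda>\<sigma>. c * f \<sigma>)"

definition ga_prod :: "nat \<Rightarrow> galg list \<Rightarrow> galg" where
  "ga_prod n fs = foldr (ga_mult n) fs ga_one"

definition K :: "nat \<Rightarrow> nat multiset \<Rightarrow> nat \<Rightarrow> galg" where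
  "K n lam i = (\<lambda>\<sigma>. if \<sigma> \<in> near_class n lam i then 1 else 0)"

text \<open>
  The family \<open>a\<close> is the expansion of \<open>g\<close> in the basis of all \<open>K n lam i\<close>; it exists
  exactly when \<open>g\<close> commutes with every permutation of \<open>{1..n}\<close> that fixes \<open>n\<close>, and is then unique.
\<close>

definition K_coeff :: "nat \<Rightarrow> nat multiset \<Rightarrow> nat \<Rightarrow> galg \<Rightarrow> complex" where
  "K_coeff n mu j g =
     (THE a. (\<forall>lam i. \<not> (lam \<in> partitions n \<and> i \<in># lam) \<longrightarrow> a lam i = 0) \<and>
             g = (\<lambda>\<sigma>. \<Sum>lam\<in>partitions n. \<Sum>i\<in>set_mset lam. a lam i * K n lam i \<sigma>)) mu j"

section \<open>Standard Young tableaux and Young's seminormal units\<close>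

text \<open>A tableau is the list of its rows, longest row first; \<open>List.transpose\<close> gives its columns.\<close>

definition SYT :: "nat multiset \<Rightarrow> nat list list set" where
  "SYT rho =
     {T. map length T = rev (sorted_list_of_multiset rho) \<and>
         distinct (concat T) \<and> set (concat T) = {1..sum_mset rho} \<and>
         (\<forall>row\<in>set T. sorted_wrt (<) row) \<and>
         (\<forall>col\<in>set (List.transpose T). sorted_wrt (<) col)}"

definition num_SYT :: "nat multiset \<Rightarrow> nat" where
  "num_SYT rho = card (SYT rho)"

definition SYT_end :: "nat multiset \<Rightarrow> nat \<Rightarrow> nat list list set" where
  "SYT_end rho l =
     {T \<in> SYT rho. \<exists>row\<in>set T. length row = l \<and> row \<noteq> [] \<and> last row = sum_mset rho}"

definition row_sym :: "nat \<Rightarrow> nat list list \<Rightarrow> galg" where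
  "row_sym n T =
     (\<lambda>\<sigma>. if \<sigma> permutes {1..n} \<and> (\<forall>row\<in>set T. \<sigma> ` set row = set row) then 1 else 0)"

definition col_antisym :: "nat \<Rightarrow> nat list list \<Rightarrow> galg" where
  "col_antisym n T =
     (\<lambda>\<sigma>. if \<sigma> permutes {1..n} \<and> (\<forall>col\<in>set (List.transpose T). \<sigma> ` set col = set col)
          then of_int (sign \<sigma>) else 0)"

definition remove_entry :: "nat \<Rightarrow> nat list list \<Rightarrow> nat list list" where
  "remove_entry m T = filter (\<lambda>row. row \<noteq> []) (map (filter (\<lambda>x. x \<noteq> m)) T)"

text \<open>
  Young's recursion: if \<open>T\<close> has shape \<open>\<rho>\<close> and \<open>n\<close> cells, and \<open>T'\<close> is \<open>T\<close> without \<open>n\<close>, then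
  \<open>e\<^sub>T = (d\<^sub>\<rho> / n!) e\<^sub>T\<^sub>' P\<^sub>T N\<^sub>T e\<^sub>T\<^sub>'\<close>, where \<open>n! / d\<^sub>\<rho>\<close> is the product of the hook lengths of \<open>\<rho>\<close>,
  and \<open>e\<^sub>T = 1\<close> for the one-cell tableau. Starting from the empty tableau gives the same elements.
  The first argument of \<open>seminormal\<close> is the number of cells.
\<close>

primrec seminormal :: "nat \<Rightarrow> nat list list \<Rightarrow> galg" where
  "seminormal 0 T = ga_one"
| "seminormal (Suc m) T =
     (let e' = seminormal m (remove_entry (Suc m) T)
      in ga_scale (of_nat (num_SYT (mset (map length T))) / fact (Suc m))
           (ga_prod (Suc m) [e', row_sym (Suc m) T, col_antisym (Suc m) T, e']))"

definition Gam :: "nat \<Rightarrow> nat multiset \<Rightarrow> nat \<Rightarrow> galg" where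
  "Gam n rho l = (\<lambda>\<sigma>. \<Sum>T\<in>SYT_end rho l. seminormal n T \<sigma>)"

definition gen_char :: "nat \<Rightarrow> nat multiset \<Rightarrow> nat \<Rightarrow> nat multiset \<Rightarrow> nat \<Rightarrow> complex" where
  "gen_char n rho l lam i = fact n / of_nat (num_SYT rho) * K_coeff n lam i (Gam n rho l)"

end

theory Submission
  imports Defs "HOL-Library.Poly_Mapping" "Jordan_Normal_Form.Determinant"
begin

text \<open>
  For a standard tableau \<open>T\<close> let \<open>T'\<close> be \<open>T\<close> without its largest entry and \<open>E\<^sub>T = P\<^sub>T N\<^sub>T\<close>. Von Neumann's
  lemma gives \<open>E\<^sub>T x E\<^sub>S = 0\<close> for different shapes and \<open>E\<^sub>T x E\<^sub>T = h tr(x E\<^sub>T) E\<^sub>T\<close>, where \<open>tr\<close> is the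
  coefficient of the identity and \<open>E\<^sub>T\<^sup>2 = h E\<^sub>T\<close>. The part of \<open>E\<^sub>T\<close> supported on the smaller symmetric
  group is \<open>E\<^sub>T\<^sub>'\<close>, so \<open>tr(e\<^sub>T\<^sub>' E\<^sub>T) = 1\<close> by induction, and hence the seminormal units are orthogonal
  idempotents. Together with the permutations relating tableaux of equal shape they extend to
  matrix units. There are \<open>\<Sum> d\<^sub>\<rho>\<^sup>2 = n!\<close> of these, so they form a basis; Fourier inversion then yields
  \<open>h = n! / d\<^sub>\<rho>\<close> and \<open>\<Sum> e\<^sub>T = 1\<close>. Consequently \<open>\<Gamma>\<^sup>\<rho>\<^sup>,\<^sup>\<ell>\<close> is the product of a central idempotent for \<open>n\<close>
  and one for \<open>n - 1\<close>, hence constant on near classes. The \<open>\<Gamma>\<^sup>\<rho>\<^sup>,\<^sup>\<ell>\<close> are orthogonal idempotents indexed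
  by the same finite set as the near classes, so the square matrix of their values is invertible,
  which expresses each \<open>K\<close> through them with coefficients given by traces.
\<close>

section \<open>The group algebra of the finitary symmetric group\<close>

unbundle no m_inv_syntax

text \<open>No representation spaces occur: irreducibility, dimensions and characters are replaced
  by the trace form \<open>tr\<close>. All symmetric groups sit inside one group of finitary
  permutations, so Young's recursion from n - 1 to n needs no embedding maps and \<open>tr\<close>
  is the same functional at every level. The obstacle is the normalisation: the recursion divides by
  n!/d, while a single tableau only yields some nonzero h with E^2 = h E. That h = n!/d becomes
  accessible only after counting pairs of tableaux of equal shape has made the matrix units a basis.
  The same basis property is behind the commutation of \<Gamma> with the smaller group, which the
  recursion itself does not display. The constants of the final formula arise as follows. The
  coefficient of K at an idempotent \<Gamma> is |C| \<Gamma>(C) / tr \<Gamma>, with \<Gamma>(C) the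
  value of \<Gamma> on the class C. Let d' be the number of tableaux of shape l_-(\<rho>). Since tr
  \<Gamma> = d' d / n!, the coefficient is |C| \<gamma> / d'. Each of the r factors contributes one
  1 / d', and the remaining d / n! turns \<gamma> at (\<mu>, j) back into a value of
  \<Gamma>.\<close>

typedef fperm = "{\<sigma> :: nat \<Rightarrow> nat. permutation \<sigma>}" morphisms app Fperm
  using permutation_id by blast

text \<open>Composition is written additively because the convolution product of finitely supported functions
  is defined over additive monoids.\<close>

instantiation fperm :: group_add
begin
definition zero_fperm :: fperm where "0 = Fperm id"
definition plus_fperm :: "fperm \<Rightarrow> fperm \<Rightarrow> fperm" where "\<sigma> + \<tau> = Fperm (app \<sigma> \<circ> app \<tau>)"
definition uminus_fperm :: "fperm \<Rightarrow> fperm" where "- \<sigma> = Fperm (inv (app \<sigma>))"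
definition minus_fperm :: "fperm \<Rightarrow> fperm \<Rightarrow> fperm" where "\<sigma> - \<tau> = \<sigma> + - (\<tau> :: fperm)"

instance
proof
  fix a b c :: fperm
  have p: "permutation (app x)" for x using app by auto
  show "a + b + c = a + (b + c)"
    by (simp add: plus_fperm_def Fperm_inverse permutation_compose p o_assoc)
  show "0 + a = a" "a + 0 = a"
    by (simp_all add: plus_fperm_def zero_fperm_def Fperm_inverse permutation_id app_inverse)
  show "- a + a = 0"
    using permutation_bijective[OF p]
    by (simp add: plus_fperm_def zero_fperm_def uminus_fperm_def Fperm_inverse permutation_inverse p
        bij_is_inj)
  show "a + - b = a - b" by (simp add: minus_fperm_def)
qed
end

lemma permutation_app [simp]: "permutation (app \<sigma>)"
  using app by auto

lemma app_0 [simp]: "app 0 x = x"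
  by (simp add: zero_fperm_def Fperm_inverse permutation_id)

lemma app_add [simp]: "app (\<sigma> + \<tau>) x = app \<sigma> (app \<tau> x)"
  by (simp add: plus_fperm_def Fperm_inverse permutation_compose)

lemma app_uminus: "app (- \<sigma>) = inv (app \<sigma>)"
  by (simp add: uminus_fperm_def Fperm_inverse permutation_inverse)

lemma app_uminus_cancel [simp]: "app (- \<sigma>) (app \<sigma> x) = x" "app \<sigma> (app (- \<sigma>) x) = x"
  by (metis app_add app_0 left_minus, metis app_add app_0 right_minus)

lemma fperm_eqI: "(\<And>x. app \<sigma> x = app \<tau> x) \<Longrightarrow> \<sigma> = \<tau>"
  by (metis app_inject ext)

lemma app_eq_iff [simp]: "app \<sigma> x = app \<sigma> y \<longleftrightarrow> x = y"
  by (metis app_uminus_cancel(1))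

section \<open>The finite symmetric groups as a chain of subgroups\<close>

definition Sym :: "nat \<Rightarrow> fperm set" where
  "Sym n = {\<sigma>. app \<sigma> permutes {1..n}}"

lemma Fperm_Sym: "p permutes {1..n} \<Longrightarrow> Fperm p \<in> Sym n" and
  app_Fperm: "p permutes {1..n} \<Longrightarrow> app (Fperm p) = p"
  using permutation_permutes[of p] by (auto simp: Sym_def Fperm_inverse)

lemma bij_betw_app_Sym: "bij_betw app (Sym n) {p. p permutes {1..n}}"
  by (rule bij_betwI[where g = Fperm]) (auto simp: Sym_def app_inverse app_Fperm Fperm_Sym)

lemma finite_Sym [simp]: "finite (Sym n)"
  using bij_betw_finite[OF bij_betw_app_Sym] finite_permutations[of "{1..n}"] by auto

lemma card_Sym: "card (Sym n) = fact n"
  using bij_betw_same_card[OF bij_betw_app_Sym[of n]] card_permutations[of "{1..n}" n] by auto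

lemma Sym_0 [simp]: "0 \<in> Sym n" 
  and Sym_add: "\<sigma> \<in> Sym n \<Longrightarrow> \<tau> \<in> Sym n \<Longrightarrow> \<sigma> + \<tau> \<in> Sym n"
  and Sym_uminus: "\<sigma> \<in> Sym n \<Longrightarrow> - \<sigma> \<in> Sym n"
  using permutes_compose[of "app \<tau>" "{1..n}" "app \<sigma>"]
  by (auto simp: Sym_def app_uminus permutes_inv plus_fperm_def zero_fperm_def Fperm_inverse
      permutation_id permutation_compose permutes_id)

lemma Sym_uminus_iff [simp]: "- \<sigma> \<in> Sym n \<longleftrightarrow> \<sigma> \<in> Sym n"
  using Sym_uminus[of \<sigma>] Sym_uminus[of "- \<sigma>"] by auto

lemma Sym_mono: "m \<le> n \<Longrightarrow> Sym m \<subseteq> Sym n"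
  using permutes_subset[of _ "{1..m}" "{1..n}"] by (auto simp: Sym_def)

lemma Sym_mem: "\<sigma> \<in> Sym n \<Longrightarrow> app \<sigma> x \<in> {1..n} \<longleftrightarrow> x \<in> {1..n}"
  using permutes_in_image[of "app \<sigma>" "{1..n}" x] by (simp add: Sym_def)

lemma Sym_Suc_iff: "\<sigma> \<in> Sym m \<longleftrightarrow> \<sigma> \<in> Sym (Suc m) \<and> app \<sigma> (Suc m) = Suc m"
proof
  assume "\<sigma> \<in> Sym m"
  then show "\<sigma> \<in> Sym (Suc m) \<and> app \<sigma> (Suc m) = Suc m"
    using Sym_mono[of m "Suc m"] by (auto simp: Sym_def permutes_def)
next
  assume a: "\<sigma> \<in> Sym (Suc m) \<and> app \<sigma> (Suc m) = Suc m"
  have "app \<sigma> permutes {1..m}"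
  proof (rule permutes_superset[of _ "{1..Suc m}"])
    show "app \<sigma> permutes {1..Suc m}" using a by (simp add: Sym_def)
    show "app \<sigma> x = x" if "x \<in> {1..Suc m} - {1..m}" for x
    proof -
      from that have "x = Suc m" by auto
      then show ?thesis using a by simp
    qed
  qed
  then show "\<sigma> \<in> Sym m" by (simp add: Sym_def)
qed

section \<open>Group elements, scalars and the trace\<close>

type_synonym ga = "fperm \<Rightarrow>\<^sub>0 complex"

abbreviation (input) coef :: "ga \<Rightarrow> fperm \<Rightarrow> complex" where "coef \<equiv> Poly_Mapping.lookup"

definition gr :: "fperm \<Rightarrow> ga" where "gr \<sigma> = Poly_Mapping.single \<sigma> 1"

definition sc :: "complex \<Rightarrow> ga" where "sc c = Poly_Mapping.single 0 c"

text \<open>On each \<open>GA n\<close> this is the character of the regular representation divided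
  by n!.\<close>

definition tr :: "ga \<Rightarrow> complex" where "tr x = coef x 0"

lemma gr_0 [simp]: "gr 0 = 1" by (simp add: gr_def)

lemma gr_add: "gr (\<sigma> + \<tau>) = gr \<sigma> * gr \<tau>" by (simp add: gr_def mult_single)

lemma gr_cancel [simp]: "gr (- \<sigma>) * gr \<sigma> = 1" "gr \<sigma> * gr (- \<sigma>) = 1"
  by (simp_all flip: gr_add)

lemma sc_1 [simp]: "sc 1 = 1" and sc_0 [simp]: "sc 0 = 0"
  and sc_mult: "sc (a * b) = sc a * sc b"
  and sc_add: "sc (a + b) = sc a + sc b"
  by (simp_all add: sc_def mult_single single_add)

lemma coef_mult:
  assumes "finite A" "Poly_Mapping.keys x \<subseteq> A"
  shows "coef (x * y) \<sigma> = (\<Sum>\<pi>\<in>A. coef x \<pi> * coef y (- \<pi> + \<sigma>))"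
proof -
  have "coef (x * y) \<sigma> = (\<Sum>l. coef x l * (\<Sum>q. coef y q when \<sigma> = l + q))"
    by (simp add: lookup_mult)
  also have "(\<lambda>l. coef x l * (\<Sum>q. coef y q when \<sigma> = l + q)) = (\<lambda>l. coef x l * coef y (- l + \<sigma>))"
  proof
    fix l
    have "(\<sigma> = l + q) = (- l + \<sigma> = q)" for q
      by (metis add.assoc left_minus right_minus add_0)
    then show "coef x l * (\<Sum>q. coef y q when \<sigma> = l + q) = coef x l * coef y (- l + \<sigma>)"
      by simp
  qed
  also have "Sum_any \<dots> = (\<Sum>\<pi>\<in>A. coef x \<pi> * coef y (- \<pi> + \<sigma>))"
    using assms by (intro Sum_any.expand_superset) (auto simp: in_keys_iff)
  finally show ?thesis .
qed

lemma coef_mult':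
  assumes "finite B" "Poly_Mapping.keys y \<subseteq> B"
  shows "coef (x * y) \<sigma> = (\<Sum>\<kappa>\<in>B. coef x (\<sigma> + - \<kappa>) * coef y \<kappa>)"
proof -
  \<comment> \<open>The index set is enlarged so that it contains the image of B under the
    substitution that turns summation over the first factor into summation over the second.\<close>
  define A where "A = Poly_Mapping.keys x \<union> (\<lambda>\<kappa>. \<sigma> + - \<kappa>) ` B"
  have "coef (x * y) \<sigma> = (\<Sum>\<pi>\<in>A. coef x \<pi> * coef y (- \<pi> + \<sigma>))"
    using assms by (intro coef_mult) (auto simp: A_def)
  also have "\<dots> = (\<Sum>\<pi>\<in>(\<lambda>\<kappa>. \<sigma> + - \<kappa>) ` B. coef x \<pi> * coef y (- \<pi> + \<sigma>))"
  proof (rule sum.mono_neutral_right)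
    show "\<forall>\<pi>\<in>A - (\<lambda>\<kappa>. \<sigma> + - \<kappa>) ` B. coef x \<pi> * coef y (- \<pi> + \<sigma>) = 0"
    proof
      fix \<pi> assume p: "\<pi> \<in> A - (\<lambda>\<kappa>. \<sigma> + - \<kappa>) ` B"
      have "\<pi> = \<sigma> + - (- \<pi> + \<sigma>)" by (simp add: minus_add add.assoc)
      then have "- \<pi> + \<sigma> \<notin> B" using p by (metis DiffE imageI)
      then show "coef x \<pi> * coef y (- \<pi> + \<sigma>) = 0" using assms by (auto simp: in_keys_iff)
    qed
  qed (use assms in \<open>auto simp: A_def\<close>)
  also have "\<dots> = (\<Sum>\<kappa>\<in>B. coef x (\<sigma> + - \<kappa>) * coef y \<kappa>)"
  proof (subst sum.reindex)
    show "inj_on (\<lambda>\<kappa>. \<sigma> + - \<kappa>) B"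
      by (rule inj_onI) (metis add_left_cancel neg_equal_iff_equal)
  qed (simp add: minus_add add.assoc)
  finally show ?thesis .
qed

lemma coef_gr_mult [simp]: "coef (gr \<pi> * x) \<sigma> = coef x (- \<pi> + \<sigma>)"
  by (subst coef_mult[of "{\<pi>}"]) (auto simp: gr_def)

lemma coef_mult_gr [simp]: "coef (x * gr \<pi>) \<sigma> = coef x (\<sigma> + - \<pi>)"
  by (subst coef_mult'[of "{\<pi>}"]) (auto simp: gr_def)

lemma coef_sc_mult [simp]: "coef (sc c * x) \<sigma> = c * coef x \<sigma>"
  by (subst coef_mult[of "{0}"]) (auto simp: sc_def)

lemma sc_commute: "x * sc c = sc c * x"
proof (rule poly_mapping_eqI)
  fix \<sigma>
  have "coef (x * sc c) \<sigma> = (\<Sum>\<kappa>\<in>{0}. coef x (\<sigma> + - \<kappa>) * coef (sc c) \<kappa>)"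
    by (rule coef_mult') (simp_all add: sc_def)
  also have "\<dots> = c * coef x \<sigma>" by (simp add: sc_def)
  finally show "coef (x * sc c) \<sigma> = coef (sc c * x) \<sigma>" by simp
qed

lemma sc_left_commute: "x * (sc c * y) = sc c * (x * y)"
  by (metis mult.assoc sc_commute)

lemma tr_sc_mult [simp]: "tr (sc c * x) = c * tr x" by (simp add: tr_def)

lemma tr_1 [simp]: "tr 1 = 1" by (simp add: tr_def)

lemma tr_0 [simp]: "tr 0 = 0" by (simp add: tr_def)

lemma tr_commute: "tr (x * y) = tr (y * x)"
proof -
  have "tr (x * y) = (\<Sum>\<kappa>\<in>Poly_Mapping.keys y. coef x (- \<kappa>) * coef y \<kappa>)"
    unfolding tr_def by (subst coef_mult'[of "Poly_Mapping.keys y"]) auto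
  also have "\<dots> = tr (y * x)"
    unfolding tr_def by (subst coef_mult[of "Poly_Mapping.keys y"]) (auto simp: mult.commute)
  finally show ?thesis .
qed

lemma sum_gr_keys:
  assumes "finite A" "Poly_Mapping.keys x \<subseteq> A"
  shows "x = (\<Sum>\<sigma>\<in>A. sc (coef x \<sigma>) * gr \<sigma>)"
proof (rule poly_mapping_eqI)
  fix \<tau>
  have "coef (\<Sum>\<sigma>\<in>A. sc (coef x \<sigma>) * gr \<sigma>) \<tau> = (\<Sum>\<sigma>\<in>A. if \<sigma> = \<tau> then coef x \<sigma> else 0)"
    unfolding lookup_sum by (rule sum.cong) (auto simp: gr_def lookup_single)
  also have "\<dots> = coef x \<tau>" using assms by (auto simp: in_keys_iff)
  finally show "coef x \<tau> = coef (\<Sum>\<sigma>\<in>A. sc (coef x \<sigma>) * gr \<sigma>) \<tau>" by simp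
qed

subsection \<open>The involution and its definiteness\<close>

text \<open>The adjoint for the regular representation: conjugate-linear, inverting group
  elements.\<close>

definition star :: "ga \<Rightarrow> ga" where
  "star x = Poly_Mapping.map cnj (Poly_Mapping.map_key uminus x)"

lemma coef_star [simp]: "coef (star x) \<sigma> = cnj (coef x (- \<sigma>))"
  unfolding star_def by (subst Poly_Mapping.map.rep_eq) (simp add: map_key.rep_eq when_def)

lemma star_mult: "star (x * y) = star y * star x"
proof (rule poly_mapping_eqI)
  fix \<sigma>
  have "coef (star y * star x) \<sigma> = (\<Sum>\<pi>\<in>uminus ` Poly_Mapping.keys y. cnj (coef y (- \<pi>)) * cnj (coef x (- (- \<pi> + \<sigma>))))"
  proof (subst coef_mult[of "uminus ` Poly_Mapping.keys y"])
    show "Poly_Mapping.keys (star y) \<subseteq> uminus ` Poly_Mapping.keys y"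
    proof
      fix k assume "k \<in> Poly_Mapping.keys (star y)"
      then have "- k \<in> Poly_Mapping.keys y" by (simp add: in_keys_iff)
      then show "k \<in> uminus ` Poly_Mapping.keys y" by (metis imageI minus_minus)
    qed
  qed simp_all
  also have "\<dots> = (\<Sum>\<kappa>\<in>Poly_Mapping.keys y. cnj (coef x (- \<sigma> + - \<kappa>) * coef y \<kappa>))"
    by (subst sum.reindex) (auto simp: minus_add mult.commute)
  also have "\<dots> = cnj (coef (x * y) (- \<sigma>))"
    by (subst coef_mult'[of "Poly_Mapping.keys y"]) auto
  finally show "coef (star (x * y)) \<sigma> = coef (star y * star x) \<sigma>" by simp
qed

lemma star_star [simp]: "star (star x) = x"
  by (rule poly_mapping_eqI) simp

text \<open>The trace is the sum of the squared moduli of the coefficients. This positivity excludes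
  nilpotent Young symmetrizers in \<open>h_scalar_nonzero\<close>.\<close>

lemma tr_mult_star_eq_0: "tr (x * star x) = 0 \<longleftrightarrow> x = 0"
proof
  assume "tr (x * star x) = 0"
  then have "(\<Sum>\<pi>\<in>Poly_Mapping.keys x. coef x \<pi> * cnj (coef x \<pi>)) = 0"
    unfolding tr_def by (subst (asm) coef_mult[of "Poly_Mapping.keys x"]) auto
  then have "(\<Sum>\<pi>\<in>Poly_Mapping.keys x. complex_of_real ((cmod (coef x \<pi>))\<^sup>2)) = 0"
    by (simp only: complex_norm_square)
  then have "(\<Sum>\<pi>\<in>Poly_Mapping.keys x. (cmod (coef x \<pi>))\<^sup>2) = 0"
    by (metis of_real_eq_0_iff of_real_sum)
  then have "\<forall>\<pi>\<in>Poly_Mapping.keys x. (cmod (coef x \<pi>))\<^sup>2 = 0"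
    by (subst (asm) sum_nonneg_eq_0_iff) auto
  then have "\<forall>\<pi>\<in>Poly_Mapping.keys x. coef x \<pi> = 0" by simp
  then show "x = 0" by (intro poly_mapping_eqI) (metis in_keys_iff lookup_zero)
qed simp

subsection \<open>The group algebras of the finite symmetric groups\<close>

definition GA :: "nat \<Rightarrow> ga set" where
  "GA n = {x. Poly_Mapping.keys x \<subseteq> Sym n}"

lemma GA_coef: "x \<in> GA n \<Longrightarrow> \<sigma> \<notin> Sym n \<Longrightarrow> coef x \<sigma> = 0"
  by (auto simp: GA_def in_keys_iff)

lemma GA_I: "(\<And>\<sigma>. \<sigma> \<notin> Sym n \<Longrightarrow> coef x \<sigma> = 0) \<Longrightarrow> x \<in> GA n"
  by (auto simp: GA_def in_keys_iff)

lemma GA_mult [intro]: "x \<in> GA n \<Longrightarrow> y \<in> GA n \<Longrightarrow> x * y \<in> GA n"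
  unfolding GA_def using keys_mult[of x y] Sym_add by blast

lemma GA_add [intro]: "x \<in> GA n \<Longrightarrow> y \<in> GA n \<Longrightarrow> x + y \<in> GA n"
  unfolding GA_def using keys_add[of x y] by blast

lemma GA_0 [simp]: "0 \<in> GA n" and GA_1 [simp]: "1 \<in> GA n"
  and GA_sc [simp]: "sc c \<in> GA n" and GA_gr: "\<sigma> \<in> Sym n \<Longrightarrow> gr \<sigma> \<in> GA n"
  by (auto simp: GA_def sc_def gr_def)

lemma GA_sum [intro]: "(\<And>a. a \<in> A \<Longrightarrow> f a \<in> GA n) \<Longrightarrow> sum f A \<in> GA n"
  by (induction A rule: infinite_finite_induct) auto

lemma GA_mono: "m \<le> n \<Longrightarrow> GA m \<subseteq> GA n"
  using Sym_mono by (auto simp: GA_def)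

lemma GA_expand: "x \<in> GA n \<Longrightarrow> x = (\<Sum>\<sigma>\<in>Sym n. sc (coef x \<sigma>) * gr \<sigma>)"
  by (rule sum_gr_keys) (auto simp: GA_def)

lemma tr_mult: "x \<in> GA n \<Longrightarrow> tr (x * y) = (\<Sum>\<sigma>\<in>Sym n. coef x \<sigma> * coef y (- \<sigma>))"
  unfolding tr_def by (subst coef_mult[of "Sym n"]) (auto simp: GA_def)

section \<open>Young symmetrizers\<close>

declare add_uminus_conv_diff [simp del]

text \<open>For a row or column index function f this is the row or column group of a tableau. Using
  index functions instead of sets of cells makes relabelling the entries by \<sigma> a composition
  with \<open>app \<sigma>\<close>.\<close>

definition stab :: "nat \<Rightarrow> (nat \<Rightarrow> nat) \<Rightarrow> fperm set" where
  "stab n f = {\<sigma> \<in> Sym n. \<forall>x\<in>{1..n}. f (app \<sigma> x) = f x}"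

lemma stab_Sym: "\<sigma> \<in> stab n f \<Longrightarrow> \<sigma> \<in> Sym n" by (simp add: stab_def)

lemma finite_stab [simp]: "finite (stab n f)"
  by (rule finite_subset[of _ "Sym n"]) (auto simp: stab_def)

lemma stab_app: "\<sigma> \<in> stab n f \<Longrightarrow> x \<in> {1..n} \<Longrightarrow> f (app \<sigma> x) = f x" by (simp add: stab_def)

lemma stab_0 [simp]: "0 \<in> stab n f" by (simp add: stab_def)

lemma stab_add: "\<sigma> \<in> stab n f \<Longrightarrow> \<tau> \<in> stab n f \<Longrightarrow> \<sigma> + \<tau> \<in> stab n f"
  using Sym_add[of \<sigma> n \<tau>] Sym_mem[of \<tau> n] by (auto simp: stab_def)

lemma stab_uminus: "\<sigma> \<in> stab n f \<Longrightarrow> - \<sigma> \<in> stab n f"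
proof -
  assume s: "\<sigma> \<in> stab n f"
  have "f (app (- \<sigma>) x) = f x" if "x \<in> {1..n}" for x
  proof -
    have "app (- \<sigma>) x \<in> {1..n}" using that Sym_mem[OF Sym_uminus[OF stab_Sym[OF s]]] by blast
    from stab_app[OF s this] show ?thesis by simp
  qed
  then show ?thesis using stab_Sym[OF s] by (simp add: stab_def)
qed

lemma stab_cancel_left: "\<sigma> \<in> stab n f \<Longrightarrow> - \<sigma> + \<tau> \<in> stab n f \<longleftrightarrow> \<tau> \<in> stab n f"
  using stab_add[of "- \<sigma>" n f \<tau>] stab_add[of \<sigma> n f "- \<sigma> + \<tau>"] stab_uminus[of \<sigma> n f]
  by (auto simp flip: add.assoc)

lemma stab_cancel_right: "\<sigma> \<in> stab n f \<Longrightarrow> \<tau> + - \<sigma> \<in> stab n f \<longleftrightarrow> \<tau> \<in> stab n f"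
  using stab_add[of \<tau> n f "- \<sigma>"] stab_add[of "\<tau> + - \<sigma>" n f \<sigma>] stab_uminus[of \<sigma> n f]
  by (auto simp: add.assoc)

lemma stab_conj:
  assumes "\<sigma> \<in> Sym n"
  shows "\<sigma> + \<tau> + - \<sigma> \<in> stab n f \<longleftrightarrow> \<tau> \<in> stab n (f \<circ> app \<sigma>)"
proof -
  have S: "\<sigma> + \<tau> + - \<sigma> \<in> Sym n \<longleftrightarrow> \<tau> \<in> Sym n"
  proof
    assume a: "\<sigma> + \<tau> + - \<sigma> \<in> Sym n"
    have "- \<sigma> + (\<sigma> + \<tau> + - \<sigma>) + \<sigma> \<in> Sym n"
      by (rule Sym_add[OF Sym_add[OF Sym_uminus[OF assms] a] assms])
    moreover have "- \<sigma> + (\<sigma> + \<tau> + - \<sigma>) + \<sigma> = \<tau>"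
      by (metis add.assoc add.right_neutral add_0 left_minus)
    ultimately show "\<tau> \<in> Sym n" by simp
  qed (intro Sym_add Sym_uminus assms)
  have "(\<forall>x\<in>{1..n}. f (app \<sigma> (app \<tau> (app (- \<sigma>) x))) = f x) \<longleftrightarrow>
        (\<forall>x\<in>{1..n}. f (app \<sigma> (app \<tau> x)) = f (app \<sigma> x))"
  proof (intro iffI ballI)
    fix x assume a: "\<forall>x\<in>{1..n}. f (app \<sigma> (app \<tau> (app (- \<sigma>) x))) = f x" and x: "x \<in> {1..n}"
    have "app \<sigma> x \<in> {1..n}" using Sym_mem[OF assms] x by blast
    from bspec[OF a this] show "f (app \<sigma> (app \<tau> x)) = f (app \<sigma> x)" by simp
  next
    fix x assume a: "\<forall>x\<in>{1..n}. f (app \<sigma> (app \<tau> x)) = f (app \<sigma> x)" and x: "x \<in> {1..n}"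
    have "app (- \<sigma>) x \<in> {1..n}" using Sym_mem[OF Sym_uminus[OF assms]] x by blast
    from bspec[OF a this] show "f (app \<sigma> (app \<tau> (app (- \<sigma>) x))) = f x" by simp
  qed
  with S show ?thesis by (simp add: stab_def)
qed

lemma stab_Suc: "\<sigma> \<in> Sym m \<Longrightarrow> \<sigma> \<in> stab (Suc m) f \<longleftrightarrow> \<sigma> \<in> stab m f"
  using Sym_Suc_iff[of \<sigma> m] by (auto simp: stab_def le_Suc_eq)

definition fsign :: "fperm \<Rightarrow> complex" where "fsign \<sigma> = of_int (sign (app \<sigma>))"

lemma app_add_fun: "app (\<sigma> + \<tau>) = app \<sigma> \<circ> app \<tau>" by auto

lemma fsign_add: "fsign (\<sigma> + \<tau>) = fsign \<sigma> * fsign \<tau>"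
  by (simp add: fsign_def app_add_fun sign_compose)

lemma fsign_0 [simp]: "fsign 0 = 1"
  by (simp add: fsign_def zero_fperm_def Fperm_inverse permutation_id sign_id)

lemma fsign_uminus [simp]: "fsign (- \<sigma>) = fsign \<sigma>"
  by (simp add: fsign_def app_uminus sign_inverse)

section \<open>Row symmetrizers and column antisymmetrizers\<close>

definition Psym :: "nat \<Rightarrow> (nat \<Rightarrow> nat) \<Rightarrow> ga" where
  "Psym n r = (\<Sum>\<sigma>\<in>stab n r. gr \<sigma>)"

definition Nsym :: "nat \<Rightarrow> (nat \<Rightarrow> nat) \<Rightarrow> ga" where
  "Nsym n c = (\<Sum>\<sigma>\<in>stab n c. sc (fsign \<sigma>) * gr \<sigma>)"

definition Esym :: "nat \<Rightarrow> (nat \<Rightarrow> nat) \<Rightarrow> (nat \<Rightarrow> nat) \<Rightarrow> ga" where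
  "Esym n r c = Psym n r * Nsym n c"

lemma coef_Psym: "coef (Psym n r) \<sigma> = (if \<sigma> \<in> stab n r then 1 else 0)"
  by (simp add: Psym_def lookup_sum gr_def lookup_single when_def)

lemma coef_Nsym: "coef (Nsym n c) \<sigma> = (if \<sigma> \<in> stab n c then fsign \<sigma> else 0)"
  by (simp add: Nsym_def lookup_sum gr_def lookup_single when_def if_distrib cong: if_cong)

lemma GA_Psym [simp]: "Psym n r \<in> GA n" and GA_Nsym [simp]: "Nsym n r \<in> GA n"
  by (auto intro!: GA_I simp: coef_Psym coef_Nsym stab_def)

lemma GA_Esym [simp]: "Esym n r c \<in> GA n" by (auto simp: Esym_def)

lemma Psym_absorb:
  assumes "\<sigma> \<in> stab n r"
  shows "gr \<sigma> * Psym n r = Psym n r" "Psym n r * gr \<sigma> = Psym n r"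
  by (auto intro!: poly_mapping_eqI
      simp: coef_Psym stab_cancel_left[OF assms] stab_cancel_right[OF assms])

lemma Nsym_absorb:
  assumes "\<sigma> \<in> stab n c"
  shows "gr \<sigma> * Nsym n c = sc (fsign \<sigma>) * Nsym n c" "Nsym n c * gr \<sigma> = sc (fsign \<sigma>) * Nsym n c"
  by (auto intro!: poly_mapping_eqI
      simp: coef_Nsym stab_cancel_left[OF assms] stab_cancel_right[OF assms] fsign_add)

lemma Psym_gr: "\<sigma> \<in> Sym n \<Longrightarrow> Psym n r * gr \<sigma> = gr \<sigma> * Psym n (r \<circ> app \<sigma>)"
proof -
  assume s: "\<sigma> \<in> Sym n"
  have *: "\<tau> + - \<sigma> \<in> stab n r \<longleftrightarrow> - \<sigma> + \<tau> \<in> stab n (r \<circ> app \<sigma>)" for \<tau>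
    using stab_conj[OF s, of "- \<sigma> + \<tau>" r] by (simp add: add.assoc[symmetric])
  show ?thesis
    by (rule poly_mapping_eqI) (simp add: coef_Psym *)
qed

lemma Nsym_gr: "\<sigma> \<in> Sym n \<Longrightarrow> Nsym n c * gr \<sigma> = gr \<sigma> * Nsym n (c \<circ> app \<sigma>)"
proof -
  assume s: "\<sigma> \<in> Sym n"
  have *: "\<tau> + - \<sigma> \<in> stab n c \<longleftrightarrow> - \<sigma> + \<tau> \<in> stab n (c \<circ> app \<sigma>)" for \<tau>
    using stab_conj[OF s, of "- \<sigma> + \<tau>" c] by (simp add: add.assoc[symmetric])
  show ?thesis
    by (rule poly_mapping_eqI)
       (simp add: coef_Nsym * fsign_add mult.commute)
qed

lemma Esym_gr: "\<sigma> \<in> Sym n \<Longrightarrow> Esym n r c * gr \<sigma> = gr \<sigma> * Esym n (r \<circ> app \<sigma>) (c \<circ> app \<sigma>)"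
  unfolding Esym_def by (metis Nsym_gr Psym_gr mult.assoc)

text \<open>The transposition of x and y lies in both groups. \<open>Psym\<close> absorbs it
  unchanged, \<open>Nsym\<close> with a sign, so the product equals its own negative.\<close>

lemma Psym_Nsym_zero:
  assumes xy: "x \<in> {1..n}" "y \<in> {1..n}" "x \<noteq> y" "r x = r y" "c x = c y"
  shows "Psym n r * Nsym n c = 0" "Nsym n c * Psym n r = 0"
proof -
  define p where "p = Transposition.transpose x y"
  have p: "p permutes {1..n}" using xy by (simp add: p_def permutes_swap_id)
  define t where "t = Fperm p"
  have app: "app t = p" and S: "t \<in> Sym n" using p by (auto simp: t_def app_Fperm Fperm_Sym)
  have tr: "t \<in> stab n r" "t \<in> stab n c"
    using S xy by (auto simp: stab_def app p_def Transposition.transpose_def)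
  have sg: "fsign t = -1" using xy by (simp add: fsign_def app p_def sign_swap_id)
  have zero: "z = 0" if "z = sc (-1) * z" for z :: ga
  proof (rule poly_mapping_eqI)
    fix \<sigma> have "coef z \<sigma> = - coef z \<sigma>" by (metis that coef_sc_mult mult_minus1)
    then show "coef z \<sigma> = coef 0 \<sigma>" by simp
  qed
  have "Psym n r * Nsym n c = Psym n r * gr t * Nsym n c" by (simp add: Psym_absorb tr)
  also have "\<dots> = sc (-1) * (Psym n r * Nsym n c)"
    by (simp add: mult.assoc Nsym_absorb tr sg sc_left_commute)
  finally show "Psym n r * Nsym n c = 0" by (rule zero)
  have "Nsym n c * Psym n r = Nsym n c * (gr t * Psym n r)" by (simp add: Psym_absorb tr)
  also have "\<dots> = sc (-1) * (Nsym n c * Psym n r)"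
    by (simp add: mult.assoc[symmetric] Nsym_absorb tr sg)
  finally show "Nsym n c * Psym n r = 0" by (rule zero)
qed

subsection \<open>Tableaux as row and column functions\<close>

text \<open>The second condition makes every column top-justified, so that the row indices occurring
  in a column form an initial segment. Standardness is left out because the notion has to survive
  arbitrary relabelling.\<close>

definition tab :: "nat \<Rightarrow> (nat \<Rightarrow> nat) \<Rightarrow> (nat \<Rightarrow> nat) \<Rightarrow> bool" where
  "tab n r c \<longleftrightarrow> inj_on (\<lambda>x. (r x, c x)) {1..n} \<and>
     (\<forall>x\<in>{1..n}. \<forall>i<r x. \<exists>y\<in>{1..n}. r y = i \<and> c y = c x)"

lemma tab_inj: "tab n r c \<Longrightarrow> x \<in> {1..n} \<Longrightarrow> y \<in> {1..n} \<Longrightarrow> r x = r y \<Longrightarrow> c x = c y \<Longrightarrow> x = y"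
  by (rule inj_onD[of "\<lambda>x. (r x, c x)" "{1..n}"]) (simp_all add: tab_def)

lemma down_closed_eq_lessThan:
  fixes A :: "nat set"
  assumes "finite A" "\<And>x i. x \<in> A \<Longrightarrow> i < x \<Longrightarrow> i \<in> A"
  shows "A = {..<card A}"
proof -
  have "A \<subseteq> {..<card A}"
  proof
    fix x assume "x \<in> A"
    then have "{..x} \<subseteq> A" using assms(2) by (auto simp: le_less)
    then have "card {..x} \<le> card A" using assms(1) by (intro card_mono)
    then show "x \<in> {..<card A}" by simp
  qed
  then show ?thesis using card_subset_eq[of "{..<card A}" A] by simp
qed

text \<open>The sorting step behind von Neumann's lemma: sorting every column of one tableau by the row
  indices of the other moves no entry below its row in the other tableau.\<close>

lemma column_sorting:
  assumes t: "tab n r' c'"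
    and good: "\<And>x y. x \<in> {1..n} \<Longrightarrow> y \<in> {1..n} \<Longrightarrow> r x = r y \<Longrightarrow> c' x = c' y \<Longrightarrow> x = y"
  obtains q where "q \<in> stab n c'" "\<And>x. x \<in> {1..n} \<Longrightarrow> r' (app q x) \<le> r x"
proof -
  define C where "C x = {z \<in> {1..n}. c' z = c' x}" for x
  \<comment> \<open>The row to which sorting moves x within its column. By \<open>good\<close> the
    values of r on a column are distinct, so at most r x of them lie below r x, whence rank x \<le>
    r x.\<close>
  define rank where "rank x = card {z \<in> C x. r z < r x}" for x
  have finC [simp]: "finite (C x)" for x by (simp add: C_def)
  have imC: "r' ` C x = {..<card (C x)}" for x
  proof -
    have "r' ` C x = {..<card (r' ` C x)}"
    proof (rule down_closed_eq_lessThan)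
      fix a i assume "a \<in> r' ` C x" "i < a"
      then obtain z where "z \<in> {1..n}" "c' z = c' x" "i < r' z" by (auto simp: C_def)
      then obtain y where "y \<in> {1..n}" "r' y = i" "c' y = c' x"
        using t unfolding tab_def by metis
      then show "i \<in> r' ` C x" by (auto simp: C_def)
    qed simp
    moreover have "card (r' ` C x) = card (C x)"
      by (rule card_image) (auto simp: inj_on_def C_def intro: tab_inj[OF t])
    ultimately show ?thesis by simp
  qed
  have "\<exists>y. y \<in> C x \<and> r' y = rank x" if "x \<in> {1..n}" for x
  proof -
    have "{z \<in> C x. r z < r x} \<subset> C x" using that by (auto simp: C_def)
    then have "rank x < card (C x)" unfolding rank_def by (intro psubset_card_mono) auto
    then have "rank x \<in> r' ` C x" using imC by simp
    then show ?thesis by auto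
  qed
  then obtain g where g: "\<And>x. x \<in> {1..n} \<Longrightarrow> g x \<in> C x \<and> r' (g x) = rank x" by metis
  define p where "p x = (if x \<in> {1..n} then g x else x)" for x
  have rank_less: "rank x < rank y" if "x \<in> {1..n}" "c' x = c' y" "r x < r y" for x y
    unfolding rank_def
    by (rule psubset_card_mono) (use that in \<open>auto simp: C_def\<close>)
  have inj: "inj_on p {1..n}"
  proof (rule inj_onI)
    fix x y assume xy: "x \<in> {1..n}" "y \<in> {1..n}" "p x = p y"
    then have "g x = g y" by (simp add: p_def)
    then have c: "c' x = c' y" and "rank x = rank y" using g[of x] g[of y] xy by (auto simp: C_def)
    then have "r x = r y" using rank_less[of x y] rank_less[of y x] xy by force
    then show "x = y" using good xy c by blast
  qed
  have "p ` {1..n} \<subseteq> {1..n}" using g by (auto simp: p_def C_def)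
  then have "bij_betw p {1..n} {1..n}"
    using inj by (simp add: bij_betw_def endo_inj_surj)
  then have pp: "p permutes {1..n}"
    by (rule bij_imp_permutes) (simp only: p_def if_False)
  show ?thesis
  proof
    show "Fperm p \<in> stab n c'"
      using Fperm_Sym[OF pp] g by (auto simp: stab_def app_Fperm[OF pp] p_def C_def)
    fix x assume x: "x \<in> {1..n}"
    have "rank x = card (r ` {z \<in> C x. r z < r x})"
      unfolding rank_def
      by (rule card_image[symmetric]) (auto simp: inj_on_def C_def intro: good)
    also have "\<dots> \<le> card {..<r x}" by (rule card_mono) auto
    finally show "r' (app (Fperm p) x) \<le> r x"
      using g[OF x] x by (simp add: app_Fperm[OF pp] p_def)
  qed
qed

section \<open>Von Neumann's lemma\<close>

text \<open>If the product survives, no two entries share both a row of the tableau relabelled by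
  \<sigma> and a column of the original one. Column sorting then supplies a column permutation q
  moving no entry below the row that \<sigma> assigns to it.\<close>

lemma double_coset:
  assumes t: "tab n r c" and s: "\<sigma> \<in> Sym n" and nz: "Psym n r * gr \<sigma> * Nsym n c \<noteq> 0"
  obtains p q where "p \<in> stab n r" "q \<in> stab n c" "\<sigma> = p + q"
proof -
  have "Psym n r * gr \<sigma> * Nsym n c = gr \<sigma> * (Psym n (r \<circ> app \<sigma>) * Nsym n c)"
    by (simp add: Psym_gr[OF s] mult.assoc)
  then have nz': "Psym n (r \<circ> app \<sigma>) * Nsym n c \<noteq> 0" using nz by auto
  obtain q where q: "q \<in> stab n c" "\<And>x. x \<in> {1..n} \<Longrightarrow> r (app q x) \<le> r (app \<sigma> x)"
  proof (rule column_sorting[OF t, of "r \<circ> app \<sigma>"])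
    fix x y assume "x \<in> {1..n}" "y \<in> {1..n}" "(r \<circ> app \<sigma>) x = (r \<circ> app \<sigma>) y" "c x = c y"
    then show "x = y" using Psym_Nsym_zero[of x n y "r \<circ> app \<sigma>" c] nz' by blast
  qed auto
  \<comment> \<open>Permutations preserve the total of all row indices, which forces equality in
    every inequality r (q x) \<le> r (\<sigma> x). Hence \<sigma> differs from q by a row
    permutation.\<close>
  have re: "(\<Sum>x\<in>{1..n}. r (app \<tau> x)) = (\<Sum>x\<in>{1..n}. r x)" if "\<tau> \<in> Sym n" for \<tau>
    using sum.permute[of "app \<tau>" "{1..n}" r] that by (simp add: Sym_def comp_def)
  have eq: "r (app q x) = r (app \<sigma> x)" if "x \<in> {1..n}" for x
  proof (rule ccontr)
    assume "r (app q x) \<noteq> r (app \<sigma> x)"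
    then have "(\<Sum>x\<in>{1..n}. r (app q x)) < (\<Sum>x\<in>{1..n}. r (app \<sigma> x))"
      using q(2) that by (intro sum_strict_mono_ex1 ballI bexI[of _ x]) (simp_all add: order.not_eq_order_implies_strict)
    then show False using re[OF s] re[OF stab_Sym[OF q(1)]] by simp
  qed
  show ?thesis
  proof
    have qS: "- q \<in> Sym n" using stab_Sym[OF q(1)] by simp
    show "\<sigma> + - q \<in> stab n r"
      unfolding stab_def
    proof (intro CollectI conjI ballI)
      fix x assume "x \<in> {1..n}"
      then have "app (- q) x \<in> {1..n}" using Sym_mem[OF qS] by blast
      from eq[OF this] show "r (app (\<sigma> + - q) x) = r x" by simp
    qed (rule Sym_add[OF s qS])
    show "\<sigma> = \<sigma> + - q + q" by (simp add: add.assoc)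
  qed (rule q)
qed

text \<open>By linearity it suffices to treat a group element. One of the form p + q, with p in the
  row group and q in the column group, is absorbed from both sides up to the sign of q; any other
  one contributes 0.\<close>

lemma Psym_mult_Nsym:
  assumes t: "tab n r c" and x: "x \<in> GA n"
  shows "\<exists>a. Psym n r * x * Nsym n c = sc a * Esym n r c"
proof -
  have "\<exists>a. Psym n r * gr \<sigma> * Nsym n c = sc a * Esym n r c" if s: "\<sigma> \<in> Sym n" for \<sigma>
  proof (cases "Psym n r * gr \<sigma> * Nsym n c = 0")
    case True then show ?thesis by (intro exI[of _ 0]) simp
  next
    case False
    then obtain p q where pq: "p \<in> stab n r" "q \<in> stab n c" "\<sigma> = p + q"
      using double_coset[OF t s] by metis
    have "Psym n r * gr \<sigma> * Nsym n c = (Psym n r * gr p) * (gr q * Nsym n c)"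
      by (simp add: pq(3) gr_add mult.assoc)
    also have "\<dots> = sc (fsign q) * Esym n r c"
      by (simp add: Psym_absorb pq Nsym_absorb Esym_def sc_left_commute)
    finally show ?thesis by blast
  qed
  then obtain a where a: "\<And>\<sigma>. \<sigma> \<in> Sym n \<Longrightarrow> Psym n r * gr \<sigma> * Nsym n c = sc (a \<sigma>) * Esym n r c"
    by metis
  have sc_sum: "sc (sum f A) = (\<Sum>x\<in>A. sc (f x))" for f :: "fperm \<Rightarrow> complex" and A
    by (induction A rule: infinite_finite_induct) (auto simp: sc_add)
  have "Psym n r * x * Nsym n c = (\<Sum>\<sigma>\<in>Sym n. sc (coef x \<sigma>) * (Psym n r * gr \<sigma> * Nsym n c))"
    by (subst GA_expand[OF x]) (simp add: sum_distrib_left sum_distrib_right sc_left_commute mult.assoc)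
  also have "\<dots> = (\<Sum>\<sigma>\<in>Sym n. sc (coef x \<sigma> * a \<sigma>)) * Esym n r c"
    unfolding sum_distrib_right
    by (intro sum.cong refl) (simp only: a sc_mult mult.assoc[of "sc _" "sc _"])
  finally show ?thesis unfolding sc_sum[symmetric] by blast
qed

lemma shape_dominance:
  assumes t: "tab n r' c'" and x: "x \<in> GA n"
    and nz: "Psym n r * x * Nsym n c' \<noteq> 0 \<or> Nsym n c' * x * Psym n r \<noteq> 0"
  shows "card {y \<in> {1..n}. r y < k} \<le> card {y \<in> {1..n}. r' y < k}"
proof -
  have "\<exists>\<sigma>\<in>Sym n. Psym n (r \<circ> app \<sigma>) * Nsym n c' \<noteq> 0 \<or> Nsym n c' * Psym n (r \<circ> app \<sigma>) \<noteq> 0"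
  proof (rule ccontr)
    assume "\<not> ?thesis"
    then have z: "Psym n (r \<circ> app \<sigma>) * Nsym n c' = 0" "Nsym n c' * Psym n (r \<circ> app \<sigma>) = 0"
      if "\<sigma> \<in> Sym n" for \<sigma> using that by auto
    have "Psym n r * x * Nsym n c' = (\<Sum>\<sigma>\<in>Sym n. sc (coef x \<sigma>) * (Psym n r * gr \<sigma> * Nsym n c'))"
      by (subst GA_expand[OF x]) (simp add: sum_distrib_left sum_distrib_right sc_left_commute mult.assoc)
    also have "\<dots> = 0"
      by (intro sum.neutral ballI) (simp add: Psym_gr mult.assoc z)
    finally have 1: "Psym n r * x * Nsym n c' = 0" .
    have gP: "gr \<sigma> * Psym n r = Psym n (r \<circ> app (- \<sigma>)) * gr \<sigma>" if "\<sigma> \<in> Sym n" for \<sigma>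
    proof -
      have "gr \<sigma> * Psym n r = gr \<sigma> * (Psym n r * gr (- \<sigma>)) * gr \<sigma>" by (simp add: mult.assoc)
      also have "\<dots> = gr \<sigma> * gr (- \<sigma>) * Psym n (r \<circ> app (- \<sigma>)) * gr \<sigma>"
        unfolding Psym_gr[OF Sym_uminus[OF that]] by (simp only: mult.assoc)
      finally show ?thesis by simp
    qed
    have "Nsym n c' * x * Psym n r = (\<Sum>\<sigma>\<in>Sym n. sc (coef x \<sigma>) * (Nsym n c' * (gr \<sigma> * Psym n r)))"
      by (subst GA_expand[OF x]) (simp add: sum_distrib_left sum_distrib_right sc_left_commute mult.assoc)
    also have "\<dots> = 0"
      by (intro sum.neutral ballI) (simp add: gP mult.assoc[symmetric] z)
    finally show False using 1 nz by simp
  qed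
  then obtain \<sigma> where s: "\<sigma> \<in> Sym n"
    and nz': "Psym n (r \<circ> app \<sigma>) * Nsym n c' \<noteq> 0 \<or> Nsym n c' * Psym n (r \<circ> app \<sigma>) \<noteq> 0" by blast
  obtain q where q: "q \<in> stab n c'" "\<And>x. x \<in> {1..n} \<Longrightarrow> r' (app q x) \<le> r (app \<sigma> x)"
  proof (rule column_sorting[OF t, of "r \<circ> app \<sigma>"])
    fix x y assume "x \<in> {1..n}" "y \<in> {1..n}" "(r \<circ> app \<sigma>) x = (r \<circ> app \<sigma>) y" "c' x = c' y"
    then show "x = y" using Psym_Nsym_zero[of x n y "r \<circ> app \<sigma>" c'] nz' by blast
  qed auto
  show ?thesis
  proof (rule card_inj_on_le[of "\<lambda>y. app q (app (- \<sigma>) y)"])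
    show "inj_on (\<lambda>y. app q (app (- \<sigma>) y)) {y \<in> {1..n}. r y < k}" by (auto simp: inj_on_def)
    show "(\<lambda>y. app q (app (- \<sigma>) y)) ` {y \<in> {1..n}. r y < k} \<subseteq> {y \<in> {1..n}. r' y < k}"
    proof clarify
      fix y assume y: "y \<in> {1..n}" "r y < k"
      have m: "app (- \<sigma>) y \<in> {1..n}" using Sym_mem[OF Sym_uminus[OF s]] y by blast
      have "r' (app q (app (- \<sigma>) y)) \<le> r y" using q(2)[OF m] by simp
      moreover have "app q (app (- \<sigma>) y) \<in> {1..n}" using Sym_mem[OF stab_Sym[OF q(1)]] m by blast
      ultimately show "app q (app (- \<sigma>) y) \<in> {1..n} \<and> r' (app q (app (- \<sigma>) y)) < k" using y by auto
    qed
  qed simp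
qed

text \<open>The outer factors \<open>Psym n r\<close> and \<open>Nsym n c'\<close> give dominance
  one way, the inner factors \<open>Nsym n c\<close> and \<open>Psym n r'\<close> the other
  way.\<close>

lemma Esym_orthogonal:
  assumes t: "tab n r c" "tab n r' c'" and x: "x \<in> GA n" and nz: "Esym n r c * x * Esym n r' c' \<noteq> 0"
  shows "card {y \<in> {1..n}. r y = k} = card {y \<in> {1..n}. r' y = k}"
proof -
  have "Esym n r c * x * Esym n r' c' = Psym n r * (Nsym n c * x * Psym n r') * Nsym n c'"
    by (simp add: Esym_def mult.assoc)
  then have nz1: "Psym n r * (Nsym n c * x * Psym n r') * Nsym n c' \<noteq> 0" using nz by simp
  then have nz2: "Nsym n c * x * Psym n r' \<noteq> 0" by auto
  have y: "Nsym n c * x * Psym n r' \<in> GA n" using x by (intro GA_mult) auto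
  have eq: "card {y \<in> {1..n}. r y < k} = card {y \<in> {1..n}. r' y < k}" for k
    using shape_dominance[OF t(2) y, of r k] shape_dominance[OF t(1) x, of r' k] nz1 nz2 by (meson antisym)
  have split: "card {y \<in> {1..n}. f y < Suc k} = card {y \<in> {1..n}. f y < k} + card {y \<in> {1..n}. f y = k}"
    for f :: "nat \<Rightarrow> nat"
    by (subst card_Un_disjoint[symmetric]) (auto intro!: arg_cong[where f = card])
  show ?thesis using eq[of k] eq[of "Suc k"] split[of r] split[of r'] by simp
qed

section \<open>Coefficients of Young symmetrizers and restriction to the smaller group\<close>

lemma coef_Esym: "coef (Esym n r c) \<sigma> = (\<Sum>\<pi>\<in>Sym n. if \<pi> \<in> stab n r \<and> - \<pi> + \<sigma> \<in> stab n c then fsign (- \<pi> + \<sigma>) else 0)"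
proof -
  have "coef (Esym n r c) \<sigma> = (\<Sum>\<pi>\<in>Sym n. coef (Psym n r) \<pi> * coef (Nsym n c) (- \<pi> + \<sigma>))"
    unfolding Esym_def by (rule coef_mult) (use GA_Psym[of n r] in \<open>auto simp: GA_def\<close>)
  also have "\<dots> = (\<Sum>\<pi>\<in>Sym n. if \<pi> \<in> stab n r \<and> - \<pi> + \<sigma> \<in> stab n c then fsign (- \<pi> + \<sigma>) else 0)"
    by (rule sum.cong) (auto simp: coef_Psym coef_Nsym)
  finally show ?thesis .
qed

text \<open>Row group and column group of a tableau meet only in the identity.\<close>

lemma tr_Esym: assumes t: "tab n r c" shows "tr (Esym n r c) = 1"
proof -
  have "tr (Esym n r c) = (\<Sum>\<pi>\<in>Sym n. if \<pi> = 0 then 1 else 0)"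
    unfolding tr_def coef_Esym
  proof (rule sum.cong)
    fix \<pi> assume p: "\<pi> \<in> Sym n"
    have "\<pi> = 0" if "\<pi> \<in> stab n r" "- \<pi> \<in> stab n c"
    proof (rule fperm_eqI)
      fix x
      have "\<pi> \<in> stab n c" using stab_uminus[OF that(2)] by simp
      show "app \<pi> x = app 0 x"
      proof (cases "x \<in> {1..n}")
        case True
        then show ?thesis
          using tab_inj[OF t, of "app \<pi> x" x] stab_app[OF that(1)] stab_app[OF \<open>\<pi> \<in> stab n c\<close>] Sym_mem[OF p]
          by (metis app_0)
      next
        case False
        then show ?thesis using p by (simp add: Sym_def permutes_def)
      qed
    qed
    then show "(if \<pi> \<in> stab n r \<and> - \<pi> + 0 \<in> stab n c then fsign (- \<pi> + 0) else 0) = (if \<pi> = 0 then 1 else 0)"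
      by auto
  qed simp
  then show ?thesis by simp
qed

text \<open>Suppose a row permutation times a column permutation fixes m + 1. The image y of m + 1
  under the column permutation lies in the column of m + 1 and, being its preimage under the row
  permutation, also in its row. So y = m + 1, and both factors already lie in
  \<open>Sym m\<close>.\<close>

lemma coef_Esym_Suc:
  assumes t: "tab (Suc m) r c" and s: "\<sigma> \<in> Sym m"
  shows "coef (Esym (Suc m) r c) \<sigma> = coef (Esym m r c) \<sigma>"
proof -
  have "coef (Esym (Suc m) r c) \<sigma> =
      (\<Sum>\<pi>\<in>Sym m. if \<pi> \<in> stab (Suc m) r \<and> - \<pi> + \<sigma> \<in> stab (Suc m) c then fsign (- \<pi> + \<sigma>) else 0)"
    unfolding coef_Esym
  proof (rule sum.mono_neutral_right)
    show "\<forall>\<pi>\<in>Sym (Suc m) - Sym m.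
       (if \<pi> \<in> stab (Suc m) r \<and> - \<pi> + \<sigma> \<in> stab (Suc m) c then fsign (- \<pi> + \<sigma>) else 0) = 0"
    proof
      fix \<pi> assume p: "\<pi> \<in> Sym (Suc m) - Sym m"
      have "\<pi> \<in> Sym m" if a: "\<pi> \<in> stab (Suc m) r" "- \<pi> + \<sigma> \<in> stab (Suc m) c"
      proof -
        define y where "y = app (- \<pi>) (Suc m)"
        have y: "y \<in> {1..Suc m}" using p Sym_mem[of "- \<pi>" "Suc m" "Suc m"] by (simp add: y_def)
        have "app (- \<pi> + \<sigma>) (Suc m) = y" using s Sym_Suc_iff[of \<sigma> m] by (simp add: y_def)
        then have "c y = c (Suc m)" using stab_app[OF a(2), of "Suc m"] by simp
        moreover have "r y = r (Suc m)" using stab_app[OF stab_uminus[OF a(1)], of "Suc m"] by (simp add: y_def)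
        ultimately have "y = Suc m" using tab_inj[OF t] y by simp
        then have "app \<pi> (Suc m) = Suc m" by (metis app_uminus_cancel(2) y_def)
        then show ?thesis using p Sym_Suc_iff by blast
      qed
      then show "(if \<pi> \<in> stab (Suc m) r \<and> - \<pi> + \<sigma> \<in> stab (Suc m) c then fsign (- \<pi> + \<sigma>) else 0) = 0"
        using p by auto
    qed
  qed (use Sym_mono[of m "Suc m"] in auto)
  also have "\<dots> = coef (Esym m r c) \<sigma>"
    unfolding coef_Esym by (rule sum.cong) (use s in \<open>auto simp: stab_Suc Sym_add Sym_uminus\<close>)
  finally show ?thesis .
qed

lemma tr_mult_Esym_Suc:
  assumes "tab (Suc m) r c" "x \<in> GA m"
  shows "tr (x * Esym (Suc m) r c) = tr (x * Esym m r c)"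
  unfolding tr_mult[OF assms(2)] by (intro sum.cong refl) (simp add: coef_Esym_Suc[OF assms(1)])

text \<open>The h with E^2 = h E, read off as a trace because E itself has trace 1.\<close>

definition h_scalar :: "nat \<Rightarrow> (nat \<Rightarrow> nat) \<Rightarrow> (nat \<Rightarrow> nat) \<Rightarrow> complex" where
  "h_scalar n r c = tr (Esym n r c * Esym n r c)"

lemma Esym_sandwich_ex:
  assumes t: "tab n r c" and x: "x \<in> GA n"
  shows "Esym n r c * x * Esym n r c = sc (tr (Esym n r c * x * Esym n r c)) * Esym n r c"
proof -
  have "Esym n r c * x * Esym n r c = Psym n r * (Nsym n c * x * Psym n r) * Nsym n c"
    by (simp add: Esym_def mult.assoc)
  also obtain a where "\<dots> = sc a * Esym n r c"
    using Psym_mult_Nsym[OF t GA_mult[OF GA_mult[OF GA_Nsym x] GA_Psym]] by blast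
  finally have *: "Esym n r c * x * Esym n r c = sc a * Esym n r c" .
  then have "tr (Esym n r c * x * Esym n r c) = a" by (simp add: tr_Esym[OF t])
  then show ?thesis by (simp only: *)
qed

lemma Esym_square: "tab n r c \<Longrightarrow> Esym n r c * Esym n r c = sc (h_scalar n r c) * Esym n r c"
  using Esym_sandwich_ex[of n r c 1] by (simp add: h_scalar_def)

lemma Esym_sandwich:
  assumes t: "tab n r c" and x: "x \<in> GA n"
  shows "Esym n r c * x * Esym n r c = sc (h_scalar n r c * tr (x * Esym n r c)) * Esym n r c"
proof -
  have "tr (Esym n r c * x * Esym n r c) = tr (x * (Esym n r c * Esym n r c))"
    by (metis mult.assoc tr_commute)
  also have "\<dots> = h_scalar n r c * tr (x * Esym n r c)"
    by (simp add: Esym_square[OF t] sc_left_commute)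
  finally show ?thesis using Esym_sandwich_ex[OF t x] by simp
qed

text \<open>For h = 0 the sandwich formula kills E * star E * E, so the self-adjoint element E *
  star E has square 0. Definiteness applied twice gives E = 0, against trace 1.\<close>

lemma h_scalar_nonzero:
  assumes t: "tab n r c" shows "h_scalar n r c \<noteq> 0"
proof
  assume h: "h_scalar n r c = 0"
  let ?E = "Esym n r c"
  have "star ?E \<in> GA n" by (rule GA_I) (simp add: GA_coef[OF GA_Esym])
  then have "?E * star ?E * ?E = 0" using Esym_sandwich[OF t] h by simp
  then have "(?E * star ?E) * star (?E * star ?E) = 0"
    by (simp add: star_mult mult.assoc[symmetric])
  then have "?E * star ?E = 0" using tr_mult_star_eq_0[of "?E * star ?E"] by simp
  then have "?E = 0" using tr_mult_star_eq_0[of ?E] by simp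
  then show False using tr_Esym[OF t] by simp
qed

lemma h_scalar_conj:
  assumes s: "\<sigma> \<in> Sym n"
  shows "h_scalar n (r \<circ> app \<sigma>) (c \<circ> app \<sigma>) = h_scalar n r c"
proof -
  have E: "Esym n (r \<circ> app \<sigma>) (c \<circ> app \<sigma>) = gr (- \<sigma>) * Esym n r c * gr \<sigma>"
  proof -
    have "gr (- \<sigma>) * (Esym n r c * gr \<sigma>) = (gr (- \<sigma>) * gr \<sigma>) * Esym n (r \<circ> app \<sigma>) (c \<circ> app \<sigma>)"
      using Esym_gr[OF s] by (simp only: mult.assoc)
    then show ?thesis by (simp add: mult.assoc)
  qed
  have "gr (- \<sigma>) * Esym n r c * gr \<sigma> * (gr (- \<sigma>) * Esym n r c * gr \<sigma>)
      = gr (- \<sigma>) * Esym n r c * (gr \<sigma> * gr (- \<sigma>)) * Esym n r c * gr \<sigma>"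
    by (simp only: mult.assoc)
  then have "h_scalar n (r \<circ> app \<sigma>) (c \<circ> app \<sigma>) = tr (gr (- \<sigma>) * (Esym n r c * Esym n r c * gr \<sigma>))"
    unfolding h_scalar_def E by (simp add: mult.assoc)
  also have "\<dots> = tr (Esym n r c * Esym n r c * (gr \<sigma> * gr (- \<sigma>)))"
    by (subst tr_commute) (simp only: mult.assoc)
  finally show ?thesis by (simp add: h_scalar_def)
qed

section \<open>Standard tableaux as words\<close>

text \<open>A standard tableau with \<open>n\<close> cells is encoded by the word of length \<open>n\<close> whose \<open>x\<close>-th letter is the
  row of the entry \<open>x\<close>, rows being counted from 0. Letters are list positions, so entry \<open>x\<close> sits at
  index \<open>x - 1\<close>. The standard condition is that every prefix has weakly decreasing letter counts.\<close>

definition valid :: "nat list \<Rightarrow> bool" where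
  "valid w \<longleftrightarrow> (\<forall>m i. count_list (take m w) (Suc i) \<le> count_list (take m w) i)"

definition wrow :: "nat list \<Rightarrow> nat \<Rightarrow> nat" where "wrow w x = w ! (x - 1)"

text \<open>Entries arrive in increasing order at the ends of rows, so the column of x is the number
  of earlier entries in its row.\<close>

definition wcol :: "nat list \<Rightarrow> nat \<Rightarrow> nat" where
  "wcol w x = count_list (take (x - 1) w) (w ! (x - 1))"

lemma count_list_take_Suc:
  "k < length w \<Longrightarrow> count_list (take (Suc k) w) i = count_list (take k w) i + (if w ! k = i then 1 else 0)"
  by (simp add: take_Suc_conv_app_nth)

lemma valid_take [simp]: "valid w \<Longrightarrow> valid (take n w)"
  unfolding valid_def by (auto simp: min_def)

lemma valid_Nil [simp]: "valid []" by (simp add: valid_def)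

lemma valid_antimono:
  assumes "valid w" "i \<le> j" shows "count_list (take m w) j \<le> count_list (take m w) i"
  by (rule lift_Suc_antimono_le[of "count_list (take m w)"]) (use assms in \<open>auto simp: valid_def\<close>)

lemma valid_antimono': "valid w \<Longrightarrow> i \<le> j \<Longrightarrow> count_list w j \<le> count_list w i"
  using valid_antimono[of w i j "length w"] by simp

lemma valid_snoc_iff:
  "valid (w @ [i]) \<longleftrightarrow> valid w \<and> (i = 0 \<or> count_list w i < count_list w (i - 1))"
proof
  assume v: "valid (w @ [i])"
  have "valid w" using valid_take[OF v, of "length w"] by simp
  moreover have "count_list w i < count_list w (i - 1)" if "i \<noteq> 0"
    using valid_antimono'[OF v, of "i - 1" i] that by (auto split: if_splits)
  ultimately show "valid w \<and> (i = 0 \<or> count_list w i < count_list w (i - 1))" by auto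
next
  assume a: "valid w \<and> (i = 0 \<or> count_list w i < count_list w (i - 1))"
  show "valid (w @ [i])"
    unfolding valid_def
  proof (intro allI)
    fix m k
    show "count_list (take m (w @ [i])) (Suc k) \<le> count_list (take m (w @ [i])) k"
    proof (cases "m \<le> length w")
      case True then show ?thesis using a by (simp add: valid_def)
    next
      case False
      then have "take m (w @ [i]) = w @ [i]" by simp
      moreover have "count_list w (Suc k) \<le> count_list w k"
        using a valid_antimono'[of w k "Suc k"] by simp
      ultimately show ?thesis using a by auto
    qed
  qed
qed

text \<open>Along prefixes the count of i grows by at most one per letter, so it passes from j to j
  + 1 somewhere.\<close>

lemma ex_position:
  assumes "m \<le> length w" "j < count_list (take m w) i"
  shows "\<exists>k<m. w ! k = i \<and> count_list (take k w) i = j"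
  using assms
proof (induction m)
  case (Suc m)
  show ?case
  proof (cases "j < count_list (take m w) i")
    case True then show ?thesis using Suc by (auto intro: less_SucI)
  next
    case False
    then have "w ! m = i \<and> count_list (take m w) i = j"
      using Suc.prems by (auto simp: count_list_take_Suc split: if_splits)
    then show ?thesis by blast
  qed
qed simp

lemma count_list_take_mono: "k \<le> m \<Longrightarrow> m \<le> length w \<Longrightarrow> count_list (take k w) i \<le> count_list (take m w) i"
  by (induction m rule: dec_induct) (auto simp: count_list_take_Suc)

lemma inj_on_positions:
  assumes "n \<le> length w"
  shows "inj_on (\<lambda>x. (wrow w x, wcol w x)) {1..n}"
proof -
  have *: "wcol w x < wcol w y" if "x \<in> {1..n}" "y \<in> {1..n}" "x < y" "wrow w x = wrow w y" for x y
  proof -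
    have "wcol w x < count_list (take (Suc (x - 1)) w) (w ! (x - 1))"
      using that assms by (subst count_list_take_Suc) (auto simp: wcol_def)
    also have "\<dots> \<le> wcol w y"
      unfolding wcol_def using that assms
      by (simp add: wrow_def) (rule count_list_take_mono, auto)
    finally show ?thesis .
  qed
  show ?thesis
  proof (rule inj_onI)
    fix x y assume a: "x \<in> {1..n}" "y \<in> {1..n}" "(wrow w x, wcol w x) = (wrow w y, wcol w y)"
    show "x = y" using *[of x y] *[of y x] a by (metis less_irrefl linorder_neqE_nat prod.inject)
  qed
qed

text \<open>When x is placed, each row above it has at least as many cells as the row of x, so the
  cells above x in its column are already filled.\<close>

lemma tab_word:
  assumes v: "valid w" and n: "n \<le> length w"
  shows "tab n (wrow w) (wcol w)"
  unfolding tab_def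
proof (intro conjI ballI allI impI)
  show "inj_on (\<lambda>x. (wrow w x, wcol w x)) {1..n}" by (rule inj_on_positions[OF n])
  fix x i assume x: "x \<in> {1..n}" and i: "i < wrow w x"
  have "count_list (take x w) (wrow w x) = Suc (wcol w x)"
  proof -
    have "x - 1 < length w" "Suc (x - 1) = x" using x n by auto
    then show ?thesis
      using count_list_take_Suc[of "x - 1" w "wrow w x"] by (simp add: wrow_def wcol_def)
  qed
  then have "wcol w x < count_list (take x w) i"
    using valid_antimono[OF v, of i "wrow w x" x] i by simp
  then obtain k where k: "k < x" "w ! k = i" "count_list (take k w) i = wcol w x"
    using ex_position[of x w "wcol w x" i] x n by auto
  then show "\<exists>y\<in>{1..n}. wrow w y = i \<and> wcol w y = wcol w x"
    using x by (intro bexI[of _ "Suc k"]) (auto simp: wrow_def, simp add: wcol_def)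
qed

lemma card_row:
  assumes "n \<le> length w" shows "card {y \<in> {1..n}. wrow w y = k} = count_list (take n w) k"
  using assms
proof (induction n)
  case (Suc n)
  have "{y \<in> {1..Suc n}. wrow w y = k} =
      {y \<in> {1..n}. wrow w y = k} \<union> (if w ! n = k then {Suc n} else {})"
    by (auto simp: wrow_def le_Suc_eq)
  then show ?case using Suc by (simp add: count_list_take_Suc)
qed simp

lemma positions_image:
  "(\<lambda>x. (wrow w x, wcol w x)) ` {1..length w} = {(i, j). j < count_list w i}"
proof (intro equalityI subsetI)
  fix p assume "p \<in> (\<lambda>x. (wrow w x, wcol w x)) ` {1..length w}"
  then obtain x where x: "x \<in> {1..length w}" "p = (wrow w x, wcol w x)" by auto
  have "wcol w x < count_list (take (Suc (x - 1)) w) (w ! (x - 1))"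
    using x by (subst count_list_take_Suc) (auto simp: wcol_def)
  also have "\<dots> \<le> count_list (take (length w) w) (w ! (x - 1))"
    by (rule count_list_take_mono) (use x in auto)
  finally show "p \<in> {(i, j). j < count_list w i}" using x by (simp add: wrow_def)
next
  fix p assume "p \<in> {(i, j). j < count_list w i}"
  then obtain i j where p: "p = (i, j)" "j < count_list w i" by auto
  then obtain k where "k < length w" "w ! k = i" "count_list (take k w) i = j"
    using ex_position[of "length w" w j i] by auto
  then show "p \<in> (\<lambda>x. (wrow w x, wcol w x)) ` {1..length w}"
    by (intro image_eqI[of _ _ "Suc k"]) (auto simp: p wrow_def wcol_def)
qed

text \<open>The number of cells is separate from the word: the tableau restricted to the entries up
  to n is treated with the same word, which stays fixed in recursions on n.\<close>

abbreviation E_word :: "nat \<Rightarrow> nat list \<Rightarrow> ga" where "E_word n w \<equiv> Esym n (wrow w) (wcol w)"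

abbreviation h_word :: "nat \<Rightarrow> nat list \<Rightarrow> complex" where "h_word n w \<equiv> h_scalar n (wrow w) (wcol w)"

lemma stab_cong: "(\<And>x. x \<in> {1..n} \<Longrightarrow> f x = g x) \<Longrightarrow> stab n f = stab n g"
proof -
  assume fg: "\<And>x. x \<in> {1..n} \<Longrightarrow> f x = g x"
  have "f (app \<sigma> x) = f x \<longleftrightarrow> g (app \<sigma> x) = g x" if "\<sigma> \<in> Sym n" "x \<in> {1..n}" for \<sigma> x
  proof -
    have "app \<sigma> x \<in> {1..n}" using Sym_mem[OF that(1)] that(2) by blast
    then show ?thesis using fg that(2) by metis
  qed
  then show ?thesis unfolding stab_def by (intro Collect_cong conj_cong refl ball_cong)
qed

lemma Esym_cong:
  assumes "\<And>x. x \<in> {1..n} \<Longrightarrow> r x = r' x" "\<And>x. x \<in> {1..n} \<Longrightarrow> c x = c' x"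
  shows "Esym n r c = Esym n r' c'"
  using stab_cong[of n r r'] stab_cong[of n c c'] assms by (simp add: Esym_def Psym_def Nsym_def)

lemma word_cong:
  assumes "take n w = take n v" "x \<in> {1..n}"
  shows "wrow w x = wrow v x" "wcol w x = wcol v x"
proof -
  have l: "x - 1 < n" using assms(2) by auto
  have "take n w ! (x - 1) = take n v ! (x - 1)" by (simp only: assms(1))
  then have "w ! (x - 1) = v ! (x - 1)" by (simp only: nth_take[OF l])
  moreover have "take (x - 1) (take n w) = take (x - 1) (take n v)" by (simp only: assms(1))
  then have "take (x - 1) w = take (x - 1) v" using l by (simp only: take_take min_absorb1 less_imp_le)
  ultimately show "wrow w x = wrow v x" "wcol w x = wcol v x" by (simp_all add: wrow_def wcol_def)
qed

lemma E_word_cong: "take n w = take n v \<Longrightarrow> E_word n w = E_word n v"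
  by (rule Esym_cong) (simp_all only: word_cong[of n w v])

lemma h_word_cong: "take n w = take n v \<Longrightarrow> h_word n w = h_word n v"
  unfolding h_scalar_def by (metis E_word_cong)

section \<open>Seminormal units\<close>

text \<open>Young's recursion normalised by the scalar \<open>h\<close> with \<open>E\<^sup>2 = h E\<close> instead of \<open>n! / d\<close>;
  that the two agree is \<open>h_word_eq\<close> below.\<close>

primrec su :: "nat \<Rightarrow> nat list \<Rightarrow> ga" where
  "su 0 w = 1"
| "su (Suc m) w = sc (1 / h_word (Suc m) w) * (su m w * E_word (Suc m) w * su m w)"

lemma su_cong: "take n w = take n v \<Longrightarrow> su n w = su n v"
proof (induction n)
  case (Suc n)
  have "take n w = take n v" using arg_cong[OF Suc.prems, of "take n"] by simp
  then show ?case using Suc E_word_cong[OF Suc.prems] h_word_cong[OF Suc.prems] by simp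
qed simp

lemma sc_divide_cancel: "h \<noteq> 0 \<Longrightarrow> sc (1 / h) * (sc h * y) = y"
  by (simp add: mult.assoc[symmetric] sc_mult[symmetric])

lemma GA_su [simp]: "su n w \<in> GA n"
proof (induction n)
  case (Suc n)
  then have "su n w \<in> GA (Suc n)" using GA_mono[of n "Suc n"] by auto
  then show ?case by (auto intro!: GA_mult)
qed simp

lemma GA_su_le: "m \<le> n \<Longrightarrow> su m w \<in> GA n"
  using GA_mono[of m n] GA_su[of m w] by blast

lemma E_word_orthogonal:
  assumes "valid w" "valid v" "n \<le> length w" "n \<le> length v" "x \<in> GA n"
    and "count_list (take n w) \<noteq> count_list (take n v)"
  shows "E_word n w * x * E_word n v = 0"
proof (rule ccontr)
  assume nz: "E_word n w * x * E_word n v \<noteq> 0"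
  have "count_list (take n w) k = count_list (take n v) k" for k
    using Esym_orthogonal[OF tab_word[OF assms(1,3)] tab_word[OF assms(2,4)] assms(5) nz, of k]
    by (simp only: card_row[OF assms(3)] card_row[OF assms(4)])
  then show False using assms(6) by blast
qed

text \<open>In the sandwich formula the factor tr (e' E) reduces to the level m by
  \<open>tr_mult_Esym_Suc\<close>. Its value there is a hypothesis, because the identity is used
  inside the induction that establishes it.\<close>

lemma E_word_su_E_word:
  assumes "valid w" "Suc m \<le> length w" "tr (su m w * E_word m w) = 1"
  shows "E_word (Suc m) w * su m w * E_word (Suc m) w = sc (h_word (Suc m) w) * E_word (Suc m) w"
proof -
  have t: "tab (Suc m) (wrow w) (wcol w)" by (rule tab_word) (use assms in auto)
  show ?thesis using Esym_sandwich[OF t GA_su_le[of m "Suc m"]] tr_mult_Esym_Suc[OF t GA_su] assms by simp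
qed

text \<open>Both claims share one induction, since orthogonality at m + 1 uses the sandwich identity
  and thereby the trace claim at m. Different prefixes already give 0 at level m. Equal prefixes
  with different last letters have different shapes, so E x E vanishes.\<close>

lemma su_properties:
  shows "valid w \<Longrightarrow> n \<le> length w \<Longrightarrow> tr (su n w * E_word n w) = 1"
    and "valid w \<Longrightarrow> valid v \<Longrightarrow> n \<le> length w \<Longrightarrow> n \<le> length v \<Longrightarrow>
      su n w * su n v = (if take n w = take n v then su n w else 0)"
proof (induction n arbitrary: w v)
  case 0
  {
    case 1 then show ?case using tr_Esym[OF tab_word[of w 0]] by simp
  next
    case 2 show ?case by simp
  }
next
  case (Suc m)
  have sand: "E_word (Suc m) w * su m w * E_word (Suc m) w = sc (h_word (Suc m) w) * E_word (Suc m) w"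
    if "valid w" "Suc m \<le> length w" for w
    by (rule E_word_su_E_word) (use that Suc.IH(1) in auto)
  {
    case 1
    let ?E = "E_word (Suc m) w" and ?e = "su m w" and ?h = "h_word (Suc m) w"
    have t: "tab (Suc m) (wrow w) (wcol w)" by (rule tab_word) (use 1 in auto)
    have h: "?h \<noteq> 0" by (rule h_scalar_nonzero[OF t])
    have "su (Suc m) w * ?E = sc (1 / ?h) * (?e * (?E * ?e * ?E))"
      by (simp add: mult.assoc)
    also have "\<dots> = ?e * ?E"
      unfolding sand[OF 1] sc_left_commute[of "su m w"] by (rule sc_divide_cancel[OF h])
    finally show ?case using tr_mult_Esym_Suc[OF t GA_su, of w] Suc.IH(1)[of w] 1 by simp
  next
    case 2
    let ?E = "\<lambda>w. E_word (Suc m) w" and ?e = "\<lambda>w. su m w" and ?h = "\<lambda>w. h_word (Suc m) w"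
    have prod: "su (Suc m) w * su (Suc m) v =
        sc (1 / ?h w) * (sc (1 / ?h v) * (?e w * ?E w * (?e w * ?e v) * ?E v * ?e v))"
      by (simp add: mult.assoc sc_left_commute[of "su m w"] sc_left_commute[of "E_word (Suc m) w"])
    have IH: "?e w * ?e v = (if take m w = take m v then ?e w else 0)"
      using Suc.IH(2)[of w v] 2 by auto
    show ?case
    proof (cases "take m w = take m v")
      case False
      then have "take (Suc m) w \<noteq> take (Suc m) v"
        by (metis take_take min.absorb1 le_SucI order_refl)
      then show ?thesis using prod IH False by simp
    next
      case True
      then have ev: "?e v = ?e w" using su_cong by metis
      show ?thesis
      proof (cases "take (Suc m) w = take (Suc m) v")
        case eq: True
        then have E: "?E v = ?E w" "?h v = ?h w" using E_word_cong h_word_cong by metis+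
        have h: "?h w \<noteq> 0" using h_scalar_nonzero[OF tab_word[of w "Suc m"]] 2 by auto
        have "su (Suc m) w * su (Suc m) v =
          sc (1 / ?h w) * (sc (1 / ?h w) * (?e w * (?E w * ?e w * ?E w) * ?e w))"
          unfolding prod IH unfolding E ev using True by (simp add: mult.assoc)
        also have "\<dots> = sc (1 / ?h w) * (?e w * ?E w * ?e w)"
        proof -
          have "?e w * (sc (?h w) * ?E w) * ?e w = sc (?h w) * (?e w * ?E w * ?e w)"
            by (simp add: mult.assoc sc_left_commute[of "su m w"])
          then show ?thesis by (simp add: sand 2 sc_divide_cancel[OF h])
        qed
        finally show ?thesis using eq by simp
      next
        case ne: False
        have len: "m < length w" "m < length v" using 2 by auto
        then have "w ! m \<noteq> v ! m" using True ne by (auto simp: take_Suc_conv_app_nth)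
        then have "count_list (take (Suc m) w) (w ! m) \<noteq> count_list (take (Suc m) v) (w ! m)"
          using True len by (auto simp: count_list_take_Suc)
        then have "count_list (take (Suc m) w) \<noteq> count_list (take (Suc m) v)" by metis
        then have "?E w * ?e w * ?E v = 0"
          using 2 GA_su_le[of m "Suc m" w] by (intro E_word_orthogonal) auto
        then have "?e w * (?E w * ?e w * ?E v) * ?e v = 0" by simp
        then have "su (Suc m) w * su (Suc m) v = 0"
          unfolding prod IH using True by (simp add: mult.assoc)
        then show ?thesis using ne by simp
      qed
    qed
  }
qed

lemmas tr_su_E_word = su_properties(1) and su_mult_su = su_properties(2)

lemma E_word_su_Ew':
  "valid w \<Longrightarrow> Suc m \<le> length w \<Longrightarrow>
    E_word (Suc m) w * su m w * E_word (Suc m) w = sc (h_word (Suc m) w) * E_word (Suc m) w"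
  by (rule E_word_su_E_word) (auto intro: tr_su_E_word)

lemma h_word_nonzero: "valid w \<Longrightarrow> n \<le> length w \<Longrightarrow> h_word n w \<noteq> 0"
  by (rule h_scalar_nonzero[OF tab_word])

text \<open>By cyclicity and idempotence tr (e' E e') = tr (e' E), which is 1 by restriction to
  level m.\<close>

lemma tr_su:
  assumes "valid w" "n \<le> length w" shows "tr (su n w) = 1 / h_word n w"
proof (cases n)
  case 0
  have s: "stab 0 f = {0}" for f
    by (auto simp: stab_def Sym_def intro!: fperm_eqI)
  have "E_word 0 w = 1" by (simp add: Esym_def Psym_def Nsym_def s)
  then show ?thesis using 0 by (simp add: h_scalar_def)
next
  case (Suc m)
  let ?e = "su m w" and ?E = "E_word n w"
  have ee: "?e * ?e = ?e" using su_mult_su[of w w m] assms Suc by simp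
  have "tr (?e * ?E * ?e) = tr (?e * ?e * ?E)" by (metis mult.assoc tr_commute)
  also have "\<dots> = tr (?e * E_word m w)"
    using tr_mult_Esym_Suc[OF tab_word[of w "Suc m"] GA_su, of w] assms Suc ee by simp
  also have "\<dots> = 1" using tr_su_E_word[of w m] assms Suc by simp
  finally show ?thesis using Suc by simp
qed

section \<open>Counting standard tableaux\<close>

definition Words :: "nat \<Rightarrow> nat list set" where "Words n = {w. valid w \<and> length w = n}"

definition words_of_shape :: "(nat \<Rightarrow> nat) \<Rightarrow> nat list set" where "words_of_shape s = {w. valid w \<and> count_list w = s}"

definition num_words :: "(nat \<Rightarrow> nat) \<Rightarrow> nat" where "num_words s = card (words_of_shape s)"

definition addable :: "(nat \<Rightarrow> nat) \<Rightarrow> nat set" where "addable s = {i. i = 0 \<or> s i < s (i - 1)}"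

definition removable :: "(nat \<Rightarrow> nat) \<Rightarrow> nat set" where "removable s = {i. s (Suc i) < s i}"

abbreviation (input) up :: "(nat \<Rightarrow> nat) \<Rightarrow> nat \<Rightarrow> nat \<Rightarrow> nat" where "up s i \<equiv> s(i := Suc (s i))"

abbreviation (input) down :: "(nat \<Rightarrow> nat) \<Rightarrow> nat \<Rightarrow> nat \<Rightarrow> nat" where "down s i \<equiv> s(i := s i - 1)"

lemma count_list_snoc: "count_list (w @ [i]) = up (count_list w) i"
  by auto

lemma valid_snoc: "valid (w @ [i]) \<longleftrightarrow> valid w \<and> i \<in> addable (count_list w)"
  by (simp add: valid_snoc_iff addable_def)

lemma Words_0: "Words 0 = {[]}" by (auto simp: Words_def)

lemma Words_Suc: "Words (Suc n) = (\<lambda>(w, i). w @ [i]) ` (SIGMA w:Words n. addable (count_list w))"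
proof (intro equalityI subsetI)
  fix w assume "w \<in> Words (Suc n)"
  then have v: "valid w" and l: "length w = Suc n" by (auto simp: Words_def)
  then have w: "w = butlast w @ [last w]" by (metis append_butlast_last_id length_0_conv nat.distinct(1))
  then have "valid (butlast w) \<and> last w \<in> addable (count_list (butlast w))" using v valid_snoc by metis
  then show "w \<in> (\<lambda>(w, i). w @ [i]) ` (SIGMA w:Words n. addable (count_list w))"
    using w l by (intro image_eqI[of _ _ "(butlast w, last w)"]) (auto simp: Words_def)
qed (auto simp: Words_def valid_snoc)

lemma valid_letter_less: 
  assumes "valid w" "i \<in> addable (count_list w)" shows "i \<le> length w"
proof -
  have "{..<i} \<subseteq> set w"
  proof
    fix j assume j: "j \<in> {..<i}"
    then have "0 < count_list w (i - 1)" using assms(2) by (auto simp: addable_def)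
    also have "\<dots> \<le> count_list w j" using valid_antimono'[OF assms(1), of j "i - 1"] j by auto
    finally show "j \<in> set w" by (metis count_list_0_iff less_irrefl)
  qed
  then have "card {..<i} \<le> card (set w)" by (intro card_mono) auto
  also have "\<dots> \<le> length w" by (rule card_length)
  finally show ?thesis by simp
qed

lemma finite_addable: "valid w \<Longrightarrow> finite (addable (count_list w))"
  using finite_subset[of "addable (count_list w)" "{..length w}"] valid_letter_less by blast

lemma finite_Words [simp]: "finite (Words n)"
proof (induction n)
  case (Suc n)
  then show ?case unfolding Words_Suc
    by (intro finite_imageI finite_SigmaI) (auto simp: Words_def finite_addable)
qed (simp add: Words_0)

lemma count_list_eq_length:
  assumes "count_list v = count_list w" shows "length v = length w"
proof -
  have "mset v = mset w" by (rule multiset_eqI) (simp add: assms count_mset)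
  then show ?thesis by (rule mset_eq_length)
qed

lemma words_of_shape_count_list: "words_of_shape (count_list w) = {v \<in> Words (length w). count_list v = count_list w}"
  by (auto simp: words_of_shape_def Words_def dest: count_list_eq_length)

lemma finite_words_of_shape: "w \<in> Words n \<Longrightarrow> finite (words_of_shape (count_list w))"
  by (simp add: words_of_shape_count_list)

lemma num_words_pos: "w \<in> Words n \<Longrightarrow> 0 < num_words (count_list w)"
proof -
  assume w: "w \<in> Words n"
  then have "w \<in> words_of_shape (count_list w)" by (simp add: words_of_shape_def Words_def)
  then show ?thesis unfolding num_words_def using finite_words_of_shape[OF w] by (auto simp: card_gt_0_iff)
qed

text \<open>A corner in row k opens a place in row k + 1, and row 0 can always grow. This is the
  surplus of one addable cell.\<close>

lemma addable_eq: 
  "addable s = insert 0 (Suc ` removable s)"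
proof (intro equalityI subsetI)
  fix i assume "i \<in> addable s" then show "i \<in> insert 0 (Suc ` removable s)"
    by (cases i) (auto simp: addable_def removable_def)
qed (auto simp: addable_def removable_def)

lemma card_addable: "finite (removable s) \<Longrightarrow> card (addable s) = Suc (card (removable s))"
  by (simp add: addable_eq card_image)

lemma finite_removable: "valid w \<Longrightarrow> finite (removable (count_list w))"
  using finite_addable[of w] by (auto simp: addable_eq dest: finite_imageD)

lemma words_of_shape_rec:
  assumes w: "valid w" "w \<noteq> []"
  shows "words_of_shape (count_list w) = (\<Union>j\<in>removable (count_list w). (\<lambda>u. u @ [j]) ` words_of_shape (down (count_list w) j))"
    (is "?L = ?R")
proof (intro equalityI subsetI)
  fix v assume "v \<in> ?L"
  then have v: "valid v" "count_list v = count_list w" by (auto simp: words_of_shape_def)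
  then have "v \<noteq> []" using count_list_eq_length[OF v(2)] w by auto
  then obtain u j where uj: "v = u @ [j]" by (metis append_butlast_last_id)
  have s: "count_list w = up (count_list u) j" using v(2) uj count_list_snoc by metis
  have vu: "valid u" using v uj valid_snoc by simp
  have "count_list u (Suc j) \<le> count_list u j" using valid_antimono'[OF vu, of j "Suc j"] by simp
  then have "j \<in> removable (count_list w)" by (simp add: s removable_def)
  moreover have "u \<in> words_of_shape (down (count_list w) j)" using vu by (simp add: words_of_shape_def s)
  ultimately show "v \<in> ?R" using uj by blast
next
  fix v assume "v \<in> ?R"
  then obtain j u where j: "j \<in> removable (count_list w)" and v: "v = u @ [j]" and u: "valid u"
    and c: "count_list u = down (count_list w) j" by (auto simp: words_of_shape_def)
  have "count_list w (Suc j) < count_list w j" using j by (simp add: removable_def)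
  then have cv: "count_list v = count_list w" by (auto simp: v count_list_snoc c)
  have "j \<in> addable (count_list u)"
    using valid_antimono'[OF w(1), of "j - 1" j] \<open>count_list w (Suc j) < count_list w j\<close>
    by (cases j) (auto simp: addable_def c)
  then show "v \<in> ?L" using cv u by (simp add: words_of_shape_def v valid_snoc)
qed

lemma num_words_rec:
  assumes w: "valid w" "w \<noteq> []"
  shows "num_words (count_list w) = (\<Sum>j\<in>removable (count_list w). num_words (down (count_list w) j))"
proof -
  have fin: "finite (words_of_shape (count_list w))" using finite_words_of_shape[of w "length w"] w by (simp add: Words_def)
  have "num_words (count_list w) = (\<Sum>j\<in>removable (count_list w). card ((\<lambda>u. u @ [j]) ` words_of_shape (down (count_list w) j)))"
    unfolding num_words_def words_of_shape_rec[OF w]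
  proof (rule card_UN_disjoint)
    show "finite (removable (count_list w))" by (rule finite_removable[OF w(1)])
    show "\<forall>i\<in>removable (count_list w). finite ((\<lambda>u. u @ [i]) ` words_of_shape ((count_list w)(i := count_list w i - 1)))"
      using fin unfolding words_of_shape_rec[OF w] by (auto elim!: finite_subset[rotated])
  qed auto
  then show ?thesis unfolding num_words_def by (simp add: card_image inj_on_def)
qed

text \<open>If the last letter k differs from j, the corner in row j was removable before the last
  step. Deleting it there and appending k again gives the required word.\<close>

lemma down_reachable:
  assumes "w \<in> Words (Suc n)" "j \<in> removable (count_list w)"
  shows "\<exists>u\<in>Words n. count_list u = down (count_list w) j"
  using assms
proof (induction n arbitrary: w j)
  case 0
  then obtain i where i: "w = [i]" by (auto simp: Words_def length_Suc_conv)
  then have "j = i" using 0 by (auto simp: removable_def split: if_splits)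
  then show ?case by (intro bexI[of _ "[]"]) (auto simp: i Words_def)
next
  case (Suc n)
  obtain u k where u: "u \<in> Words (Suc n)" "k \<in> addable (count_list u)" and w: "w = u @ [k]"
    using Suc.prems(1) unfolding Words_Suc[of "Suc n"] by auto
  have s: "count_list w = up (count_list u) k" by (auto simp: w)
  show ?case
  proof (cases "j = k")
    case True
    then show ?thesis using u(1) by (intro bexI[of _ u]) (auto simp: s)
  next
    case False
    have "j \<in> removable (count_list u)"
      using Suc.prems(2) False by (auto simp: s removable_def split: if_splits)
    then obtain t where t: "t \<in> Words n" "count_list t = down (count_list u) j"
      using Suc.IH u by blast
    have "k \<in> addable (count_list t)"
      using u(2) Suc.prems(2) False by (auto simp: t s addable_def removable_def split: if_splits)
    then have "t @ [k] \<in> Words (Suc n)" using t by (auto simp: Words_def valid_snoc)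
    moreover have "count_list (t @ [k]) = down (count_list w) j"
      using False by (auto simp: count_list_snoc t s)
    ultimately show ?thesis by blast
  qed
qed

text \<open>The commutation relation of adding and removing a cell: off the diagonal the two operations
  commute, and there is one more addable than removable cell.\<close>

lemma sum_num_words_up:
  assumes "w \<in> Words n"
  shows "(\<Sum>i\<in>addable (count_list w). num_words (up (count_list w) i)) = Suc n * num_words (count_list w)"
  using assms
proof (induction n arbitrary: w)
  case 0
  then have w: "w = []" by (simp add: Words_0)
  have a: "addable (count_list []) = {0}" by (auto simp: addable_def)
  have v: "valid [0]" using valid_snoc_iff[of "[]" 0] by simp
  have r: "removable (count_list [0]) = {0}" by (auto simp: removable_def split: if_splits)
  have "num_words (count_list [0]) = num_words (down (count_list [0]) 0)"
    using num_words_rec[OF v] r by simp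
  also have "down (count_list [0]) 0 = count_list []" by auto
  finally have d: "num_words (count_list [0]) = num_words (count_list [])" .
  have "(\<Sum>i\<in>addable (count_list w). num_words (up (count_list w) i)) = num_words (up (count_list []) 0)"
    unfolding w a by (subst sum.insert) auto
  also have "up (count_list []) 0 = count_list [0]" by auto
  finally show ?case unfolding d w by (simp only: mult_Suc mult_0 add_0_right)
next
  case (Suc n)
  let ?s = "count_list w"
  have v: "valid w" "w \<noteq> []" using Suc.prems by (auto simp: Words_def)
  define A where "A = {(i, j). i \<noteq> j \<and> i \<in> addable ?s \<and> j \<in> removable (up ?s i)}"
  \<comment> \<open>Adding in row i and removing in row j \<noteq> i interact only for i = j + 1,
    where both orders amount to s (j + 1) + 1 < s j.\<close>
  have A': "A = {(i, j). i \<noteq> j \<and> j \<in> removable ?s \<and> i \<in> addable (down ?s j)}"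
    unfolding A_def
  proof (intro Collect_cong, clarify)
    fix i j :: nat
    show "(i \<noteq> j \<and> i \<in> addable ?s \<and> j \<in> removable (up ?s i)) =
          (i \<noteq> j \<and> j \<in> removable ?s \<and> i \<in> addable (down ?s j))"
    proof (cases i)
      case 0 then show ?thesis by (auto simp: addable_def removable_def)
    next
      case (Suc k)
      then show ?thesis by (cases "k = j") (auto simp: addable_def removable_def)
    qed
  qed
  have fa: "finite (addable ?s)" and fr: "finite (removable ?s)"
    using v finite_addable finite_removable by auto
  have upw: "\<exists>u\<in>Words (Suc (Suc n)). count_list u = up ?s i" if "i \<in> addable ?s" for i
    using that Suc.prems by (intro bexI[of _ "w @ [i]"]) (auto simp: Words_def valid_snoc)
  have fru: "finite (removable (up ?s i))" if "i \<in> addable ?s" for i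
    using upw[OF that] finite_removable unfolding Words_def by (metis mem_Collect_eq)
  have 1: "num_words (up ?s i) = num_words ?s + (\<Sum>j\<in>removable (up ?s i) - {i}. num_words (down (up ?s i) j))"
    if i: "i \<in> addable ?s" for i
  proof -
    obtain u where u: "u \<in> Words (Suc (Suc n))" "count_list u = up ?s i" using upw[OF i] by blast
    have "i \<in> removable (up ?s i)" using valid_antimono'[OF v(1), of i "Suc i"] by (simp add: removable_def)
    have "num_words (up ?s i) = (\<Sum>j\<in>removable (up ?s i). num_words (down (up ?s i) j))"
    proof -
      have "valid u" "u \<noteq> []" using u(1) by (auto simp: Words_def)
      from num_words_rec[OF this] show ?thesis unfolding u(2) .
    qed
    also have "\<dots> = num_words (down (up ?s i) i) + (\<Sum>j\<in>removable (up ?s i) - {i}. num_words (down (up ?s i) j))"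
      by (rule sum.remove) (use fru i \<open>i \<in> removable (up ?s i)\<close> in auto)
    finally show ?thesis by simp
  qed
  have 2: "Suc n * num_words (down ?s j) = num_words ?s + (\<Sum>i\<in>addable (down ?s j) - {j}. num_words (up (down ?s j) i))"
    if j: "j \<in> removable ?s" for j
  proof -
    obtain u where u: "u \<in> Words n" "count_list u = down ?s j" using down_reachable[OF Suc.prems j] by blast
    have pos: "?s (Suc j) < ?s j" using j by (simp add: removable_def)
    have ja: "j \<in> addable (down ?s j)"
      using valid_antimono'[OF v(1), of "j - 1" j] pos by (cases j) (auto simp: addable_def)
    have fin: "finite (addable (down ?s j))" using finite_addable[of u] u by (auto simp: Words_def)
    have "Suc n * num_words (down ?s j) = (\<Sum>i\<in>addable (down ?s j). num_words (up (down ?s j) i))"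
      using Suc.IH[OF u(1), unfolded u(2)] by (rule sym)
    also have "\<dots> = num_words (up (down ?s j) j) + (\<Sum>i\<in>addable (down ?s j) - {j}. num_words (up (down ?s j) i))"
      by (rule sum.remove) (use fin ja in auto)
    also have "up (down ?s j) j = ?s" using pos by auto
    finally show ?thesis .
  qed
  have "(\<Sum>i\<in>addable ?s. num_words (up ?s i)) =
      card (addable ?s) * num_words ?s + (\<Sum>i\<in>addable ?s. \<Sum>j\<in>removable (up ?s i) - {i}. num_words (down (up ?s i) j))"
    by (simp add: 1 sum.distrib)
  also have "(\<Sum>i\<in>addable ?s. \<Sum>j\<in>removable (up ?s i) - {i}. num_words (down (up ?s i) j)) =
      (\<Sum>(i, j)\<in>A. num_words (down (up ?s i) j))"
    by (subst sum.Sigma) (auto simp: fa fru A_def intro!: sum.cong)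
  also have "\<dots> = (\<Sum>(j, i)\<in>(SIGMA j:removable ?s. addable (down ?s j) - {j}). num_words (up (down ?s j) i))"
    unfolding A'
  proof (rule sum.reindex_bij_witness[where i = "\<lambda>(j, i). (i, j)" and j = "\<lambda>(i, j). (j, i)"], goal_cases)
    case (5 a)
    then show ?case by (auto simp: fun_upd_twist)
  qed auto
  also have "\<dots> = (\<Sum>j\<in>removable ?s. \<Sum>i\<in>addable (down ?s j) - {j}. num_words (up (down ?s j) i))"
  proof (rule sum.Sigma[symmetric])
    show "\<forall>j\<in>removable ?s. finite (addable (down ?s j) - {j})"
      using down_reachable[OF Suc.prems] finite_addable by (metis (mono_tags, lifting) Words_def finite_Diff mem_Collect_eq)
  qed (rule fr)
  finally have S: "(\<Sum>i\<in>addable ?s. num_words (up ?s i)) =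
      Suc (card (removable ?s)) * num_words ?s + (\<Sum>j\<in>removable ?s. \<Sum>i\<in>addable (down ?s j) - {j}. num_words (up (down ?s j) i))"
    unfolding card_addable[OF fr] .
  have "Suc n * num_words ?s = (\<Sum>j\<in>removable ?s. Suc n * num_words (down ?s j))"
    unfolding num_words_rec[OF v] by (rule sum_distrib_left)
  also have "\<dots> = (\<Sum>j\<in>removable ?s. num_words ?s + (\<Sum>i\<in>addable (down ?s j) - {j}. num_words (up (down ?s j) i)))"
    by (rule sum.cong[OF refl 2])
  also have "\<dots> = card (removable ?s) * num_words ?s + (\<Sum>j\<in>removable ?s. \<Sum>i\<in>addable (down ?s j) - {j}. num_words (up (down ?s j) i))"
    by (simp only: sum.distrib sum_constant of_nat_id)
  finally show ?case unfolding S mult_Suc by (simp only: add.assoc)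
qed

section \<open>The sum of squares of tableau numbers\<close>

definition Pairs :: "nat \<Rightarrow> (nat list \<times> nat list) set" where
  "Pairs n = (SIGMA w:Words n. words_of_shape (count_list w))"

lemma finite_Pairs: "finite (Pairs n)"
  unfolding Pairs_def by (rule finite_SigmaI) (auto simp: finite_words_of_shape)

text \<open>The sum of d^2 over shapes is the sum of d over words. Appending a letter in all
  possible ways multiplies it by n + 1 according to \<open>sum_num_words_up\<close>.\<close>

lemma card_Pairs: "card (Pairs n) = fact n"
proof (induction n)
  case 0
  have "words_of_shape (count_list []) = {[]}" by (simp add: words_of_shape_count_list Words_0) auto
  then show ?case by (simp add: Pairs_def Words_0)
next
  case (Suc n)
  have c: "card (Pairs n) = (\<Sum>w\<in>Words n. num_words (count_list w))" for n
    unfolding Pairs_def num_words_def by (rule card_SigmaI) (auto simp: finite_words_of_shape)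
  have "card (Pairs (Suc n)) = (\<Sum>(w, i)\<in>(SIGMA w:Words n. addable (count_list w)). num_words (count_list (w @ [i])))"
    unfolding c Words_Suc by (subst sum.reindex) (auto simp: inj_on_def case_prod_unfold)
  also have "\<dots> = (\<Sum>w\<in>Words n. \<Sum>i\<in>addable (count_list w). num_words (up (count_list w) i))"
    unfolding count_list_snoc by (rule sum.Sigma[symmetric]) (simp, auto simp: Words_def finite_addable)
  also have "\<dots> = (\<Sum>w\<in>Words n. Suc n * num_words (count_list w))"
    by (rule sum.cong) (simp_all only: sum_num_words_up)
  also have "\<dots> = Suc n * card (Pairs n)" by (simp add: c sum_distrib_left)
  finally show ?case using Suc by simp
qed

section \<open>Matrix units and completeness\<close>

text \<open>Enumerating both index sets turns the families into square matrices, where a one-sided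
  inverse is two-sided. It is applied to matrix units against permutations, and to the \<Gamma>
  against near classes.\<close>

lemma square_inverse_commute:
  fixes f :: "'a \<Rightarrow> 'b \<Rightarrow> complex" and g :: "'b \<Rightarrow> 'a \<Rightarrow> complex"
  assumes fin: "finite I" "finite J" and card: "card I = card J"
    and inv: "\<And>i i'. i \<in> I \<Longrightarrow> i' \<in> I \<Longrightarrow> (\<Sum>j\<in>J. f i j * g j i') = (if i = i' then 1 else 0)"
    and j: "j \<in> J" "j' \<in> J"
  shows "(\<Sum>i\<in>I. g j i * f i j') = (if j = j' then 1 else 0)"
proof -
  define N where "N = card I"
  obtain a where a: "bij_betw a {0..<N} I" using ex_bij_betw_nat_finite[OF fin(1)] N_def by blast
  obtain b where b: "bij_betw b {0..<N} J" using ex_bij_betw_nat_finite[OF fin(2)] N_def card by auto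
  define A where "A = mat N N (\<lambda>(p, q). f (a p) (b q))"
  define B where "B = mat N N (\<lambda>(q, p). g (b q) (a p))"
  have "A * B = 1\<^sub>m N"
  proof (rule eq_matI)
    fix p p' assume "p < dim_row (1\<^sub>m N :: complex mat)" "p' < dim_col (1\<^sub>m N :: complex mat)"
    then have p: "p < N" "p' < N" by auto
    then have "(A * B) $$ (p, p') = (\<Sum>q\<in>{0..<N}. f (a p) (b q) * g (b q) (a p'))"
      by (simp add: A_def B_def scalar_prod_def)
    also have "\<dots> = (\<Sum>j\<in>J. f (a p) j * g j (a p'))" by (rule sum.reindex_bij_betw[OF b])
    also have "\<dots> = (if a p = a p' then 1 else 0)"
      using p bij_betwE[OF a] by (intro inv) auto
    also have "\<dots> = 1\<^sub>m N $$ (p, p')"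
      using p inj_on_eq_iff[OF bij_betw_imp_inj_on[OF a], of p p'] by simp
    finally show "(A * B) $$ (p, p') = 1\<^sub>m N $$ (p, p')" .
  qed (auto simp: A_def B_def)
  then have BA: "B * A = 1\<^sub>m N"
    by (rule mat_mult_left_right_inverse[rotated 2]) (auto simp: A_def B_def)
  have "j \<in> b ` {0..<N}" "j' \<in> b ` {0..<N}" using j bij_betw_imp_surj_on[OF b] by auto
  then obtain q q' where q: "q < N" "q' < N" "b q = j" "b q' = j'" by auto
  have "(\<Sum>i\<in>I. g j i * f i j') = (\<Sum>p\<in>{0..<N}. g (b q) (a p) * f (a p) (b q'))"
    unfolding q using sum.reindex_bij_betw[OF a, of "\<lambda>i. g j i * f i j'"] by simp
  also have "\<dots> = (B * A) $$ (q, q')" using q by (simp add: A_def B_def scalar_prod_def)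
  also have "\<dots> = (if q = q' then 1 else 0)" using q by (simp add: BA)
  also have "\<dots> = (if j = j' then 1 else 0)"
    using q inj_on_eq_iff[OF bij_betw_imp_inj_on[OF b], of q q'] by simp
  finally show ?thesis .
qed

section \<open>Permutations between tableaux of equal shape\<close>

definition wpos :: "nat list \<Rightarrow> nat \<Rightarrow> nat \<times> nat" where "wpos w x = (wrow w x, wcol w x)"

text \<open>Carries the entry of v in each cell to the entry of w in the same cell.\<close>

definition tperm :: "nat list \<Rightarrow> nat list \<Rightarrow> fperm" where
  "tperm w v = Fperm (\<lambda>x. if x \<in> {1..length w} then inv_into {1..length w} (wpos w) (wpos v x) else x)"

lemma bij_betw_wpos: "bij_betw (wpos w) {1..length w} {(i, j). j < count_list w i}"
  using inj_on_positions[of "length w" w] positions_image[of w]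
  by (simp add: bij_betw_def wpos_def[abs_def])

lemma
  assumes "count_list w = count_list v"
  shows tperm_Sym: "tperm w v \<in> Sym (length w)"
    and wpos_tperm: "x \<in> {1..length w} \<Longrightarrow> wpos w (app (tperm w v) x) = wpos v x"
proof -
  let ?n = "length w"
  have l: "length v = ?n" using count_list_eq_length[OF assms] by simp
  let ?g = "\<lambda>x. inv_into {1..?n} (wpos w) (wpos v x)"
  let ?p = "\<lambda>x. if x \<in> {1..?n} then ?g x else x"
  have bv: "bij_betw (wpos v) {1..?n} {(i, j). j < count_list w i}"
    using bij_betw_wpos[of v] l assms by simp
  have "bij_betw (inv_into {1..?n} (wpos w) \<circ> wpos v) {1..?n} {1..?n}"
    by (rule bij_betw_trans[OF bv bij_betw_inv_into[OF bij_betw_wpos]])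
  then have "bij_betw ?p {1..?n} {1..?n}"
    by (subst bij_betw_cong[of _ _ "inv_into {1..?n} (wpos w) \<circ> wpos v"]) auto
  then have p: "?p permutes {1..?n}" by (rule bij_imp_permutes) (simp only: if_False)
  show "tperm w v \<in> Sym ?n" unfolding tperm_def by (rule Fperm_Sym[OF p])
  assume x: "x \<in> {1..?n}"
  have "app (tperm w v) x = ?g x" unfolding tperm_def app_Fperm[OF p] if_P[OF x] by (rule refl)
  moreover have "wpos v x \<in> wpos w ` {1..?n}"
    unfolding bij_betw_imp_surj_on[OF bij_betw_wpos[of w]] using bij_betw_apply[OF bv x] .
  ultimately show "wpos w (app (tperm w v) x) = wpos v x" by (simp only: f_inv_into_f)
qed

lemma wpos_unique:
  assumes "\<sigma> \<in> Sym (length w)" "\<tau> \<in> Sym (length w)"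
    and eq: "\<And>x. x \<in> {1..length w} \<Longrightarrow> wpos w (app \<sigma> x) = wpos w (app \<tau> x)"
  shows "\<sigma> = \<tau>"
proof (rule fperm_eqI)
  fix x
  show "app \<sigma> x = app \<tau> x"
  proof (cases "x \<in> {1..length w}")
    case True
    then have "app \<sigma> x \<in> {1..length w}" "app \<tau> x \<in> {1..length w}"
      using Sym_mem[OF assms(1)] Sym_mem[OF assms(2)] by blast+
    then show ?thesis
      using inj_onD[OF bij_betw_imp_inj_on[OF bij_betw_wpos[of w]] eq[OF True]] by blast
  next
    case False
    then show ?thesis using assms(1,2) by (simp add: Sym_def permutes_def)
  qed
qed

lemma tperm_refl: "tperm w w = 0"
  by (rule wpos_unique[of _ w]) (auto simp: tperm_Sym wpos_tperm)

lemma tperm_trans: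
  assumes "count_list w = count_list v" "count_list v = count_list u"
  shows "tperm w v + tperm v u = tperm w u"
proof -
  have l: "length v = length w" using count_list_eq_length[OF assms(1)] by simp
  have S: "tperm v u \<in> Sym (length w)" using tperm_Sym[OF assms(2)] l by simp
  show ?thesis
  proof (rule wpos_unique[of _ w])
    show "tperm w v + tperm v u \<in> Sym (length w)"
      by (rule Sym_add[OF tperm_Sym[OF assms(1)] S])
    show "tperm w u \<in> Sym (length w)" by (rule tperm_Sym) (simp add: assms)
    fix x assume x: "x \<in> {1..length w}"
    then have "app (tperm v u) x \<in> {1..length w}" using Sym_mem[OF S] by blast
    then have "wpos w (app (tperm w v + tperm v u) x) = wpos v (app (tperm v u) x)"
      using wpos_tperm[OF assms(1)] by simp
    also have "\<dots> = wpos u x" using wpos_tperm[OF assms(2)] x l by simp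
    also have "\<dots> = wpos w (app (tperm w u) x)" using wpos_tperm[of w u] assms x by simp
    finally show "wpos w (app (tperm w v + tperm v u) x) = wpos w (app (tperm w u) x)" .
  qed
qed

lemma E_word_tperm:
  assumes "count_list w = count_list v" "n = length w"
  shows "E_word n w * gr (tperm w v) = gr (tperm w v) * E_word n v" "h_word n w = h_word n v"
proof -
  have S: "tperm w v \<in> Sym n" using tperm_Sym assms by simp
  have eq: "(wrow w \<circ> app (tperm w v)) x = wrow v x" "(wcol w \<circ> app (tperm w v)) x = wcol v x"
    if "x \<in> {1..n}" for x
    using wpos_tperm[OF assms(1), of x] that assms(2) by (simp_all add: wpos_def)
  have E: "Esym n (wrow w \<circ> app (tperm w v)) (wcol w \<circ> app (tperm w v)) = E_word n v"
    by (rule Esym_cong) (use eq in auto)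
  show "E_word n w * gr (tperm w v) = gr (tperm w v) * E_word n v" using Esym_gr[OF S] E by simp
  show "h_word n w = h_word n v" using h_scalar_conj[OF S, of "wrow w" "wcol w"] E by (simp add: h_scalar_def)
qed

section \<open>Matrix units\<close>

text \<open>Since \<open>tperm w v\<close> intertwines E_w and E_v, its place between E_w and the
  unit of the shortened v makes a product of two such elements collapse to a sandwich between E_v
  and the next symmetrizer.\<close>

definition munit :: "nat \<Rightarrow> nat list \<Rightarrow> nat list \<Rightarrow> ga" where
  "munit m w v = sc (1 / h_word (Suc m) w) * (su m w * (E_word (Suc m) w * (gr (tperm w v) * su m v)))"

lemma munit_refl: "munit m w w = su (Suc m) w"
  by (simp add: munit_def tperm_refl mult.assoc)

lemma munit_GA:
  assumes "length w = Suc m" "count_list w = count_list v"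
  shows "munit m w v \<in> GA (Suc m)"
  unfolding munit_def using tperm_Sym[OF assms(2)] assms
  by (intro GA_mult) (auto simp: GA_su_le intro: GA_gr)

text \<open>Moving the transport to the left exposes E_v e_v' e_u' E_u. For v = u the sandwich
  identity gives h E_v. Otherwise either the prefixes differ and e_v' e_u' = 0, or the shapes differ
  and the outer factors annihilate.\<close>

lemma munit_mult:
  assumes w: "w \<in> Words (Suc m)" "v \<in> Words (Suc m)" "count_list w = count_list v"
    and u: "u \<in> Words (Suc m)" "x \<in> Words (Suc m)" "count_list u = count_list x"
  shows "munit m w v * munit m u x = (if v = u then munit m w x else 0)"
proof -
  let ?n = "Suc m"
  note W = w(1,2) u(1,2)
  have V: "valid w" "valid v" "valid u" "valid x" and L: "length w = ?n" "length v = ?n" "length u = ?n" "length x = ?n"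
    using W by (auto simp: Words_def)
  let ?s = "gr (tperm w v)" and ?t = "gr (tperm u x)"
  have prod: "munit m w v * munit m u x =
      sc (1 / h_word ?n w) * (sc (1 / h_word ?n u) *
        (su m w * (?s * (E_word ?n v * (su m v * su m u) * E_word ?n u) * ?t * su m x)))"
  proof -
    have "munit m w v * munit m u x =
      sc (1 / h_word ?n w) * (sc (1 / h_word ?n u) * (su m w * ((E_word ?n w * ?s) * (su m v * su m u) * E_word ?n u * ?t * su m x)))"
      unfolding munit_def
      by (simp add: mult.assoc sc_left_commute[of "su m _"] sc_left_commute[of "E_word _ _"] sc_left_commute[of "gr _"])
    then show ?thesis using E_word_tperm(1)[OF w(3), of ?n] L by (simp add: mult.assoc)
  qed
  have mm: "su m v * su m u = (if take m v = take m u then su m v else 0)"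
    using su_mult_su[of v u m] V L by simp
  show ?thesis
  proof (cases "v = u")
    case True
    have h: "h_word ?n u \<noteq> 0" using h_word_nonzero[of u ?n] V L by simp
    have "su m w * (?s * (sc (h_word ?n u) * E_word ?n u) * ?t * su m x) =
        sc (h_word ?n u) * (su m w * ((?s * E_word ?n u) * (?t * su m x)))"
      by (simp add: mult.assoc sc_left_commute[of "su m _"] sc_left_commute[of "gr _"])
    also have "?s * E_word ?n u = E_word ?n w * ?s" using E_word_tperm(1)[OF w(3), of ?n] L True by simp
    also have "E_word ?n w * ?s * (?t * su m x) = E_word ?n w * (gr (tperm w x) * su m x)"
      using tperm_trans[of w v x] w(3) u(3) True by (simp add: mult.assoc[symmetric] gr_add[symmetric])
         (simp add: mult.assoc gr_add[symmetric])
    finally have "munit m w v * munit m u x = sc (1 / h_word ?n w) * (sc (1 / h_word ?n u) * (sc (h_word ?n u) * (su m w * (E_word ?n w * (gr (tperm w x) * su m x)))))"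
      unfolding prod mm using True E_word_su_Ew'[of u m] V L by simp
    then show ?thesis using True by (simp add: sc_divide_cancel[OF h] munit_def)
  next
    case False
    have "E_word ?n v * (su m v * su m u) * E_word ?n u = 0"
    proof (cases "take m v = take m u")
      case t: True
      have "v = take m v @ [v ! m]" "u = take m u @ [u ! m]"
        using L by (metis take_Suc_conv_app_nth lessI order_refl take_all)+
      then have "v ! m \<noteq> u ! m" using False t by metis
      then have "count_list (take ?n v) (v ! m) \<noteq> count_list (take ?n u) (v ! m)"
      proof -
        have l: "m < length v" "m < length u" using L by auto
        show ?thesis
          unfolding count_list_take_Suc[OF l(1)] count_list_take_Suc[OF l(2)] t
          using \<open>v ! m \<noteq> u ! m\<close> by simp
      qed
      then have "count_list (take ?n v) \<noteq> count_list (take ?n u)" by metis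
      then show ?thesis unfolding mm using t V L GA_su_le[of m ?n v] by (simp add: E_word_orthogonal)
    next
      case f: False
      then show ?thesis by (simp add: mm)
    qed
    then show ?thesis unfolding prod using False by simp
  qed
qed

text \<open>Off the diagonal, multiplying by the diagonal unit of w on the left changes nothing and
  on the right gives 0; the trace does not see the difference.\<close>

lemma tr_munit:
  assumes "w \<in> Words (Suc m)" "v \<in> Words (Suc m)" "count_list w = count_list v"
  shows "tr (munit m w v) = (if w = v then 1 / h_word (Suc m) w else 0)"
proof (cases "w = v")
  case True
  then show ?thesis using tr_su[of w "Suc m"] assms by (simp add: munit_refl Words_def)
next
  case False
  have "munit m w v = munit m w w * munit m w v" using munit_mult[of w m w w v] assms by simp
  then have "tr (munit m w v) = tr (munit m w v * munit m w w)" by (metis tr_commute)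
  also have "\<dots> = 0" using munit_mult[of w m v w w] assms False by simp
  finally show ?thesis using False by simp
qed

lemma Pairs_iff: "(w, v) \<in> Pairs n \<longleftrightarrow> w \<in> Words n \<and> v \<in> Words n \<and> count_list w = count_list v"
  by (auto simp: Pairs_def words_of_shape_def Words_def dest: count_list_eq_length)

text \<open>The \<open>n!\<close> matrix units are orthogonal up to scalars for the trace form, so they form a basis;
  dualising gives the Fourier inversion formula.\<close>

lemma fourier_inversion:
  assumes "\<sigma> \<in> Sym (Suc m)" "\<tau> \<in> Sym (Suc m)"
  shows "(\<Sum>(w, v)\<in>Pairs (Suc m). h_word (Suc m) w * coef (munit m v w) (- \<sigma>) * coef (munit m w v) \<tau>) =
    (if \<sigma> = \<tau> then 1 else 0)"
proof -
  let ?n = "Suc m"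
  define f where "f = (\<lambda>(w, v) \<sigma>. coef (munit m w v) \<sigma>)"
  \<comment> \<open>The trace form pairs the unit (w, v) with its transpose (v, w) to 1 / h. So h
    times the transpose, read at inverse permutations, is the dual family.\<close>
  define g where "g = (\<lambda>\<sigma> (w, v). h_word ?n w * coef (munit m v w) (- \<sigma>))"
  have orth: "(\<Sum>\<sigma>\<in>Sym ?n. f a \<sigma> * g \<sigma> b) = (if a = b then 1 else 0)" if ab: "a \<in> Pairs ?n" "b \<in> Pairs ?n" for a b
  proof -
    obtain w v w' v' where ab': "a = (w, v)" "b = (w', v')" by fastforce
    have P: "w \<in> Words ?n" "v \<in> Words ?n" "count_list w = count_list v"
      "w' \<in> Words ?n" "v' \<in> Words ?n" "count_list w' = count_list v'"
      using ab by (auto simp: ab' Pairs_iff)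
    have "(\<Sum>\<sigma>\<in>Sym ?n. f a \<sigma> * g \<sigma> b) = h_word ?n w' * tr (munit m w v * munit m v' w')"
      using munit_GA[of w m v] P
      by (subst tr_mult[of _ ?n]) (auto simp: f_def g_def ab' Words_def sum_distrib_left mult_ac)
    also have "\<dots> = h_word ?n w' * tr (if v = v' then munit m w w' else 0)"
      by (simp only: munit_mult[OF P(1-3) P(5,4) P(6)[symmetric]])
    also have "\<dots> = (if a = b then 1 else 0)"
      using tr_munit[of w m w'] P h_word_nonzero[of w' ?n] by (auto simp: ab' Words_def)
    finally show ?thesis .
  qed
  have "(\<Sum>a\<in>Pairs ?n. g \<sigma> a * f a \<tau>) = (if \<sigma> = \<tau> then 1 else 0)"
    using square_inverse_commute[OF finite_Pairs finite_Sym _ orth assms] by (simp only: card_Pairs card_Sym)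
  then show ?thesis by (simp add: f_def g_def case_prod_unfold)
qed

text \<open>Writing the diagonal unit of v as (v, w) times (w, v) for each w of its shape accounts
  for the factor d. By Fourier inversion the coefficient at \<rho> becomes the number of \<sigma>
  with \<sigma> = \<sigma> + \<rho>, which is n! at the identity and 0 elsewhere.\<close>

lemma sum_su_scaled:
  "(\<Sum>v\<in>Words (Suc m). sc (of_nat (num_words (count_list v)) * h_word (Suc m) v) * su (Suc m) v) = sc (fact (Suc m))"
    (is "?X = _")
proof -
  let ?n = "Suc m"
  have "?X = (\<Sum>(v, w)\<in>Pairs ?n. sc (h_word ?n v) * su ?n v)"
  proof -
    have "(\<Sum>(v, w)\<in>Pairs ?n. sc (h_word ?n v) * su ?n v) = (\<Sum>v\<in>Words ?n. \<Sum>w\<in>words_of_shape (count_list v). sc (h_word ?n v) * su ?n v)"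
      unfolding Pairs_def by (rule sum.Sigma[symmetric]) (auto simp: finite_words_of_shape)
    also have "\<dots> = ?X"
    proof (rule sum.cong)
      fix v assume "v \<in> Words ?n"
      have "of_nat k * (sc a * y) = sc (of_nat k * a) * y" for k a y
        by (induction k) (auto simp: sc_add distrib_right)
      then show "(\<Sum>w\<in>words_of_shape (count_list v). sc (h_word ?n v) * su ?n v) = sc (of_nat (num_words (count_list v)) * h_word ?n v) * su ?n v"
        by (simp add: num_words_def)
    qed simp
    finally show ?thesis by simp
  qed
  also have "\<dots> = sc (fact ?n)"
  proof (rule poly_mapping_eqI)
    fix \<rho>
    show "coef (\<Sum>(v, w)\<in>Pairs ?n. sc (h_word ?n v) * su ?n v) \<rho> = coef (sc (fact ?n)) \<rho>"
    proof (cases "\<rho> \<in> Sym ?n")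
      case False
      have "(\<Sum>(v, w)\<in>Pairs ?n. sc (h_word ?n v) * su ?n v) \<in> GA ?n"
        by (rule GA_sum) (auto simp del: su.simps)
      then show ?thesis using GA_coef[OF _ False] GA_sc[of "fact ?n" ?n] by simp
    next
      case True
      have su: "coef (su ?n v) \<rho> = (\<Sum>\<sigma>\<in>Sym ?n. coef (munit m v w) (- \<sigma>) * coef (munit m w v) (\<sigma> + \<rho>))"
        if "(v, w) \<in> Pairs ?n" for v w
      proof -
        have P: "v \<in> Words ?n" "w \<in> Words ?n" "count_list v = count_list w" using that by (auto simp: Pairs_iff)
        have "coef (su ?n v) \<rho> = coef (munit m v w * munit m w v) \<rho>"
          by (simp only: munit_mult[OF P P(2,1) P(3)[symmetric]] munit_refl simp_thms if_True)
        also have "\<dots> = (\<Sum>\<sigma>\<in>Sym ?n. coef (munit m v w) \<sigma> * coef (munit m w v) (- \<sigma> + \<rho>))"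
          using munit_GA[OF _ P(3), of m] P(1) by (intro coef_mult) (auto simp: GA_def Words_def)
        also have "\<dots> = (\<Sum>\<sigma>\<in>Sym ?n. coef (munit m v w) (- \<sigma>) * coef (munit m w v) (\<sigma> + \<rho>))"
          by (rule sum.reindex_bij_witness[where i = uminus and j = uminus]) auto
        finally show ?thesis .
      qed
      have sw: "(v, w) \<in> Pairs ?n \<longleftrightarrow> (w, v) \<in> Pairs ?n" for v w by (auto simp: Pairs_iff)
      have "coef (\<Sum>(v, w)\<in>Pairs ?n. sc (h_word ?n v) * su ?n v) \<rho> =
          (\<Sum>(v, w)\<in>Pairs ?n. h_word ?n v * coef (su ?n v) \<rho>)"
        by (simp add: lookup_sum case_prod_unfold del: su.simps)
      also have "\<dots> = (\<Sum>(v, w)\<in>Pairs ?n. \<Sum>\<sigma>\<in>Sym ?n. h_word ?n w * coef (munit m v w) (- \<sigma>) * coef (munit m w v) (\<sigma> + \<rho>))"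
      proof (rule sum.cong, simp, clarify)
        fix v w assume p: "(v, w) \<in> Pairs ?n"
        have "h_word ?n v = h_word ?n w"
          using p E_word_tperm(2)[of v w ?n] by (auto simp: Pairs_iff Words_def)
        then show "h_word ?n v * coef (su ?n v) \<rho> = (\<Sum>\<sigma>\<in>Sym ?n. h_word ?n w * coef (munit m v w) (- \<sigma>) * coef (munit m w v) (\<sigma> + \<rho>))"
          unfolding su[OF p] by (simp add: sum_distrib_left mult.assoc)
      qed
      also have "\<dots> = (\<Sum>\<sigma>\<in>Sym ?n. \<Sum>(v, w)\<in>Pairs ?n. h_word ?n w * coef (munit m v w) (- \<sigma>) * coef (munit m w v) (\<sigma> + \<rho>))"
        by (subst sum.swap) (simp add: case_prod_unfold)
      also have "\<dots> = (\<Sum>\<sigma>\<in>Sym ?n. \<Sum>(w, v)\<in>Pairs ?n. h_word ?n w * coef (munit m v w) (- \<sigma>) * coef (munit m w v) (\<sigma> + \<rho>))"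
        by (intro sum.cong refl sum.reindex_bij_witness[where i = prod.swap and j = prod.swap]) (auto simp: sw)
      also have "\<dots> = (\<Sum>\<sigma>\<in>Sym ?n. if \<sigma> = \<sigma> + \<rho> then 1 else 0)"
        by (intro sum.cong refl fourier_inversion Sym_add True) auto
      also have "\<dots> = coef (sc (fact ?n)) \<rho>"
      proof -
        have "(\<sigma> = \<sigma> + \<rho>) = (\<rho> = 0)" for \<sigma> by (metis add.right_neutral add_left_cancel)
        then show ?thesis by (simp add: sc_def lookup_single when_def card_Sym del: fact_Suc)
      qed
      finally show ?thesis .
    qed
  qed
  finally show ?thesis .
qed

lemma su_orth:
  "w \<in> Words n \<Longrightarrow> v \<in> Words n \<Longrightarrow> su n w * su n v = (if w = v then su n w else 0)"
  using su_mult_su[of w v n] by (simp add: Words_def)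

text \<open>Multiplying \<open>sum_su_scaled\<close> by one unit leaves n! e = d h e by
  orthogonality, and e has nonzero trace.\<close>

lemma h_word_eq:
  assumes w: "w \<in> Words n" shows "h_word n w = fact n / of_nat (num_words (count_list w))"
proof (cases n)
  case 0
  then have w: "w = []" using w by (simp add: Words_0)
  have "words_of_shape (count_list []) = {[]}" by (simp add: words_of_shape_count_list Words_0) auto
  then have "num_words (count_list []) = 1" unfolding num_words_def by simp
  moreover have "h_word 0 [] = 1" using tr_su[of "[]" 0] by simp
  ultimately show ?thesis unfolding 0 w by (simp only: fact_0 of_nat_1 div_by_1)
next
  case (Suc m)
  let ?c = "\<lambda>v. of_nat (num_words (count_list v)) * h_word n v"
  have nz: "tr (su n w) \<noteq> 0" using tr_su[of w n] h_word_nonzero[of w n] w by (simp add: Words_def)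
  have "sc (fact n) * su n w = (\<Sum>v\<in>Words n. sc (?c v) * su n v) * su n w"
    using sum_su_scaled[of m] Suc by simp
  also have "\<dots> = (\<Sum>v\<in>Words n. if v = w then sc (?c w) * su n w else 0)"
    unfolding sum_distrib_right by (rule sum.cong) (use w in \<open>auto simp: mult.assoc su_orth\<close>)
  also have "\<dots> = sc (?c w) * su n w" using w by simp
  finally have "fact n * tr (su n w) = ?c w * tr (su n w)" by (metis tr_sc_mult)
  then show ?thesis using nz num_words_pos[OF w] by (simp add: field_simps)
qed

lemma sum_su: "(\<Sum>w\<in>Words n. su n w) = 1"
proof (cases n)
  case 0 then show ?thesis by (simp add: Words_0)
next
  case (Suc m)
  have "(\<Sum>w\<in>Words n. sc (fact n) * su n w) = sc (fact n)"
  proof -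
    have "(\<Sum>w\<in>Words n. sc (fact n) * su n w) = (\<Sum>v\<in>Words n. sc (of_nat (num_words (count_list v)) * h_word n v) * su n v)"
      by (rule sum.cong) (auto simp: h_word_eq dest!: num_words_pos)
    then show ?thesis using sum_su_scaled[of m] Suc by simp
  qed
  then have "sc (1 / fact n) * (sc (fact n) * (\<Sum>w\<in>Words n. su n w)) = sc (1 / fact n) * (sc (fact n) * 1)"
    by (simp add: sum_distrib_left)
  then show ?thesis by (subst (asm) (1 2) sc_divide_cancel) auto
qed

lemma su_shape_orth:
  assumes w: "w \<in> Words n" "v \<in> Words n" "count_list w \<noteq> count_list v" and x: "x \<in> GA n"
  shows "su n w * x * su n v = 0"
proof (cases n)
  case 0 then show ?thesis using w by (simp add: Words_0)
next
  case (Suc m)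
  have y: "su m w * x * su m v \<in> GA n" using Suc x by (intro GA_mult) (auto simp: GA_su_le)
  have "E_word n w * (su m w * x * su m v) * E_word n v = 0"
    using w by (intro E_word_orthogonal y) (auto simp: Words_def)
  then have "sc (1 / h_word n w) * (sc (1 / h_word n v) * (su m w * (E_word n w * (su m w * x * su m v) * E_word n v) * su m v)) = 0"
    by simp
  moreover have "su n w * x * su n v = sc (1 / h_word n w) * (sc (1 / h_word n v) * (su m w * (E_word n w * (su m w * x * su m v) * E_word n v) * su m v))"
    by (simp add: Suc mult.assoc sc_left_commute[of "su m _"] sc_left_commute[of "E_word _ _"] sc_left_commute[of x])
  ultimately show ?thesis by simp
qed

section \<open>Central idempotents of shapes\<close>

definition shape_idem :: "nat \<Rightarrow> (nat \<Rightarrow> nat) \<Rightarrow> ga" where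
  "shape_idem n s = (\<Sum>w | w \<in> Words n \<and> count_list w = s. su n w)"

text \<open>By completeness 1 = z + y, with y the units of all other shapes. As z x y = y x z = 0,
  both z x and x z equal z x z.\<close>

lemma shape_idem_central:
  assumes x: "x \<in> GA n" shows "shape_idem n s * x = x * shape_idem n s"
proof -
  let ?A = "{w. w \<in> Words n \<and> count_list w = s}" and ?B = "{w. w \<in> Words n \<and> count_list w \<noteq> s}"
  define y where "y = (\<Sum>w\<in>?B. su n w)"
  have "(\<Sum>w\<in>?A \<union> ?B. su n w) = shape_idem n s + y"
    unfolding shape_idem_def y_def by (rule sum.union_disjoint) auto
  moreover have "?A \<union> ?B = Words n" by auto
  ultimately have one: "shape_idem n s + y = 1" by (simp add: sum_su)
  have zy: "shape_idem n s * x * y = 0" "y * x * shape_idem n s = 0"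
    unfolding shape_idem_def y_def sum_distrib_left sum_distrib_right
    by (intro sum.neutral ballI; use su_shape_orth[OF _ _ _ x] in auto)+
  have "shape_idem n s * x = shape_idem n s * x * (shape_idem n s + y)" by (simp only: one mult_1_right)
  also have "\<dots> = (shape_idem n s + y) * x * shape_idem n s"
    by (simp add: distrib_left distrib_right zy)
  also have "\<dots> = x * shape_idem n s" by (simp only: one mult_1_left)
  finally show ?thesis .
qed

section \<open>Near classes as conjugacy classes\<close>

lemma image_mset_eq_bij_betw:
  assumes "finite A" "finite B" "image_mset f (mset_set A) = image_mset g (mset_set B)"
  shows "\<exists>\<phi>. bij_betw \<phi> A B \<and> (\<forall>a\<in>A. g (\<phi> a) = f a)"
  using assms
proof (induction A arbitrary: B rule: finite_induct)
  case empty
  then have "B = {}" by (auto simp: mset_set_empty_iff)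
  then show ?case by (auto simp: bij_betw_def)
next
  case (insert a A)
  have "f a \<in># image_mset g (mset_set B)" unfolding insert.prems(2)[symmetric] using insert.hyps by simp
  then obtain b where b: "b \<in> B" "g b = f a" using insert.prems by auto
  have "mset_set B = add_mset b (mset_set (B - {b}))"
    using b insert.prems by (simp add: mset_set.remove)
  then have "image_mset f (mset_set A) = image_mset g (mset_set (B - {b}))"
    using insert b by simp
  then obtain \<phi> where \<phi>: "bij_betw \<phi> A (B - {b})" "\<forall>a\<in>A. g (\<phi> a) = f a"
    using insert.IH[of "B - {b}"] insert.prems by auto
  have "bij_betw (\<phi>(a := b)) (insert a A) (insert b (B - {b}))"
    using \<phi>(1) insert.hyps by (intro bij_betw_combine[where A = "{a}" and B = "{b}", simplified] bij_betw_cong[THEN iffD1, OF _ \<phi>(1)]) (auto simp: bij_betw_def)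
  then have "bij_betw (\<phi>(a := b)) (insert a A) B" using b by (simp add: insert_absorb)
  moreover have "\<forall>x\<in>insert a A. g ((\<phi>(a := b)) x) = f x" using \<phi> b insert by auto
  ultimately show ?case by blast
qed

lemma funpow_eq_iff_orbit:
  assumes "permutation f"
  shows "(f ^^ k) x = (f ^^ l) x \<longleftrightarrow> k mod card (orbit f x) = l mod card (orbit f x)"
proof -
  let ?d = "funpow_dist1 f x x"
  have x: "x \<in> orbit f x" by (rule permutation_self_in_orbit[OF assms])
  have inj: "inj_on (\<lambda>n. (f ^^ n) x) {0..<?d}" by (rule inj_on_funpow_dist1[OF x])
  have d: "card (orbit f x) = ?d"
    unfolding orbit_conv_funpow_dist1[OF x] by (subst card_image[OF inj]) simp
  have "(f ^^ k) x = (f ^^ (k mod ?d)) x" for k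
    using funpow_mod_eq[OF funpow_dist1_prop[OF x], of k] by simp
  then have "(f ^^ k) x = (f ^^ l) x \<longleftrightarrow> (f ^^ (k mod ?d)) x = (f ^^ (l mod ?d)) x" by metis
  also have "\<dots> \<longleftrightarrow> k mod ?d = l mod ?d" using inj_on_eq_iff[OF inj, of "k mod ?d" "l mod ?d"] by simp
  finally show ?thesis unfolding d .
qed

lemma permutes_imp_permutation: "\<sigma> permutes {1..n::nat} \<Longrightarrow> permutation \<sigma>"
  using permutation_permutes by blast

lemma orbit_eq: "permutation f \<Longrightarrow> y \<in> orbit f x \<Longrightarrow> orbit f y = orbit f x"
  by (rule orbit_cyclic_eq3[OF cyclic_on_orbit'])

text \<open>Cycles are matched by length, the cycle of n with the cycle of n. After choosing base
  points, the k-th iterate of a base point is sent to the k-th iterate of the corresponding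
  one.\<close>

lemma near_class_conj:
  assumes s: "\<sigma> \<in> near_class n lam i" and t: "\<tau> \<in> near_class n lam i" and n: "1 \<le> n"
  obtains \<pi> where "\<pi> permutes {1..n}" "\<pi> n = n" "\<And>x. \<tau> (\<pi> x) = \<pi> (\<sigma> x)"
proof -
  have sp: "\<sigma> permutes {1..n}" and tp: "\<tau> permutes {1..n}"
    and ct: "cycle_type n \<sigma> = cycle_type n \<tau>" and ci: "card (orbit \<sigma> n) = card (orbit \<tau> n)"
    using s t by (auto simp: near_class_def)
  have sP: "permutation \<sigma>" and tP: "permutation \<tau>" using sp tp permutes_imp_permutation by auto
  let ?O = "orbit \<sigma> ` {1..n}" and ?O' = "orbit \<tau> ` {1..n}"
  have on: "orbit \<sigma> n \<in> ?O" "orbit \<tau> n \<in> ?O'" using n by auto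
  \<comment> \<open>The cycle through n has equal length on both sides, so it can be taken out of
    both multisets before the remaining cycles are matched.\<close>
  have rm: "image_mset card (mset_set S) = add_mset (card a) (image_mset card (mset_set (S - {a})))"
    if "finite S" "a \<in> S" for S and a :: "nat set"
    by (subst mset_set.remove[OF that]) simp
  have "image_mset card (mset_set (?O - {orbit \<sigma> n})) = image_mset card (mset_set (?O' - {orbit \<tau> n}))"
    using ct rm[OF _ on(1)] rm[OF _ on(2)] ci unfolding cycle_type_def by simp
  then obtain \<phi>0 where \<phi>0: "bij_betw \<phi>0 (?O - {orbit \<sigma> n}) (?O' - {orbit \<tau> n})"
    "\<forall>a\<in>?O - {orbit \<sigma> n}. card (\<phi>0 a) = card a"
    using image_mset_eq_bij_betw[of "?O - {orbit \<sigma> n}" "?O' - {orbit \<tau> n}" card card] by auto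
  define \<phi> where "\<phi> a = (if a = orbit \<sigma> n then orbit \<tau> n else \<phi>0 a)" for a
  have \<phi>_in: "\<phi> a \<in> ?O'" and \<phi>_card: "card (\<phi> a) = card a" if "a \<in> ?O" for a
    using that \<phi>0 ci on by (auto simp: \<phi>_def dest: bij_betwE)
  have \<phi>_inj: "a = b" if "a \<in> ?O" "b \<in> ?O" "\<phi> a = \<phi> b" for a b
  proof -
    have ne: "\<phi>0 c \<noteq> orbit \<tau> n" if "c \<in> ?O" "c \<noteq> orbit \<sigma> n" for c
      using that bij_betwE[OF \<phi>0(1)] by blast
    show ?thesis
      using that ne[of a] ne[of b] inj_onD[OF bij_betw_imp_inj_on[OF \<phi>0(1)], of a b]
      by (auto simp: \<phi>_def split: if_splits)
  qed
  \<comment> \<open>Taking n as base point of its own cycle, on both sides, is what makes \<pi> fix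
    n.\<close>
  define rep where "rep a = (if n \<in> a then n else SOME x. x \<in> a)" for a :: "nat set"
  have rep: "rep a \<in> a" if "a \<noteq> {}" for a using that by (auto simp: rep_def some_in_eq)
  define b where "b x = rep (orbit \<sigma> x)" for x
  define b' where "b' x = rep (\<phi> (orbit \<sigma> x))" for x
  have b_orb: "orbit \<sigma> (b x) = orbit \<sigma> x" for x
    unfolding b_def by (rule orbit_eq[OF sP rep]) (rule orbit_nonempty)
  have b'_orb: "orbit \<tau> (b' x) = \<phi> (orbit \<sigma> x)" "b' x \<in> {1..n}" if x: "x \<in> {1..n}" for x
  proof -
    obtain y where y: "y \<in> {1..n}" "\<phi> (orbit \<sigma> x) = orbit \<tau> y" using \<phi>_in[of "orbit \<sigma> x"] x by auto
    have m: "b' x \<in> orbit \<tau> y" unfolding b'_def y by (rule rep) (rule orbit_nonempty)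
    then show "orbit \<tau> (b' x) = \<phi> (orbit \<sigma> x)" using orbit_eq[OF tP m] y by simp
    show "b' x \<in> {1..n}" using m permutes_orbit_subset[OF tp y(1)] by blast
  qed
  have "\<exists>k. (\<sigma> ^^ k) (b x) = x" for x
  proof -
    have "x \<in> orbit \<sigma> (b x)" using b_orb permutation_self_in_orbit[OF sP] by metis
    then show ?thesis unfolding orbit_altdef by (smt (verit) mem_Collect_eq)
  qed
  then obtain k where k: "\<And>x. (\<sigma> ^^ k x) (b x) = x" by metis
  define \<pi> where "\<pi> x = (if x \<in> {1..n} then (\<tau> ^^ k x) (b' x) else x)" for x
  have pow_in: "(\<tau> ^^ m) y \<in> {1..n}" if "y \<in> {1..n}" for m y
    using that by (induction m) (use permutes_in_image[OF tp] in auto)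
  \<comment> \<open>Iterates agree precisely modulo the common cycle length, so the construction
    does not depend on the chosen exponents.\<close>
  have transfer: "(\<sigma> ^^ p) (b x) = (\<sigma> ^^ q) (b x) \<longleftrightarrow> (\<tau> ^^ p) (b' x) = (\<tau> ^^ q) (b' x)" if "x \<in> {1..n}" for p q x
    using funpow_eq_iff_orbit[OF sP, of p "b x" q] funpow_eq_iff_orbit[OF tP, of p "b' x" q]
      b_orb[of x] b'_orb(1)[OF that] \<phi>_card[of "orbit \<sigma> x"] that by simp
  have orb_step: "orbit \<sigma> (\<sigma> x) = orbit \<sigma> x" for x by (rule permutation_orbit_step[OF sP])
  have comm: "\<tau> (\<pi> x) = \<pi> (\<sigma> x)" for x
  proof (cases "x \<in> {1..n}")
    case True
    then have sx: "\<sigma> x \<in> {1..n}" using permutes_in_image[OF sp] by blast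
    have bb: "b (\<sigma> x) = b x" "b' (\<sigma> x) = b' x" by (simp_all add: b_def b'_def orb_step)
    have "(\<sigma> ^^ Suc (k x)) (b x) = (\<sigma> ^^ k (\<sigma> x)) (b x)" using k[of x] k[of "\<sigma> x"] bb by simp
    then have "(\<tau> ^^ Suc (k x)) (b' x) = (\<tau> ^^ k (\<sigma> x)) (b' x)" using transfer[OF True] by blast
    then show ?thesis using True sx bb unfolding \<pi>_def by simp
  next
    case False
    have "\<sigma> x = x" "\<tau> x = x" using permutes_not_in[OF sp False] permutes_not_in[OF tp False] by auto
    then show ?thesis unfolding \<pi>_def using False by auto
  qed
  have nn: "\<pi> n = n"
  proof -
    have n': "n \<in> {1..n}" using n by auto
    have b: "b n = n" "b' n = n"
      using permutation_self_in_orbit[OF sP, of n] permutation_self_in_orbit[OF tP, of n]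
      by (auto simp: b_def b'_def rep_def \<phi>_def)
    have "(\<sigma> ^^ k n) (b n) = (\<sigma> ^^ 0) (b n)" using k[of n] b by simp
    then have "(\<tau> ^^ k n) (b' n) = (\<tau> ^^ 0) (b' n)" using transfer[OF n'] by blast
    then show ?thesis using b n' unfolding \<pi>_def by simp
  qed
  have inj: "inj_on \<pi> {1..n}"
  proof (rule inj_onI)
    fix x y assume xy: "x \<in> {1..n}" "y \<in> {1..n}" "\<pi> x = \<pi> y"
    have orb: "orbit \<tau> (\<pi> x) = \<phi> (orbit \<sigma> x)" if "x \<in> {1..n}" for x
    proof -
      have "\<pi> x \<in> orbit \<tau> (b' x)"
        using that funpow_in_orbit[OF permutation_self_in_orbit[OF tP]] by (simp add: \<pi>_def)
      then show ?thesis using orbit_eq[OF tP] b'_orb(1)[OF that] by metis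
    qed
    have "\<phi> (orbit \<sigma> x) = \<phi> (orbit \<sigma> y)" using orb[of x] orb[of y] xy by simp
    then have e: "orbit \<sigma> x = orbit \<sigma> y" using \<phi>_inj xy by blast
    then have bb: "b x = b y" "b' x = b' y" by (simp_all add: b_def b'_def)
    have "(\<tau> ^^ k x) (b' x) = (\<tau> ^^ k y) (b' x)"
      using xy(3) unfolding \<pi>_def if_P[OF xy(1)] if_P[OF xy(2)] bb .
    then have "(\<sigma> ^^ k x) (b x) = (\<sigma> ^^ k y) (b x)" using transfer[OF xy(1)] by blast
    then show "x = y" using k[of x] k[of y] unfolding bb by (simp only:)
  qed
  have "\<pi> ` {1..n} \<subseteq> {1..n}" using pow_in b'_orb(2) by (auto simp: \<pi>_def)
  then have "bij_betw \<pi> {1..n} {1..n}" using inj by (simp add: bij_betw_def endo_inj_surj)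
  then have "\<pi> permutes {1..n}" by (rule bij_imp_permutes) (simp only: \<pi>_def if_False)
  then show ?thesis using that nn comm by blast
qed

lemma cycle_type_partition:
  assumes s: "\<sigma> permutes {1..n}"
  shows "cycle_type n \<sigma> \<in> partitions n"
proof -
  have P: "permutation \<sigma>" by (rule permutes_imp_permutation[OF s])
  let ?O = "orbit \<sigma> ` {1..n}"
  have fin: "finite (orbit \<sigma> x)" for x by (rule finite_orbit[OF permutation_self_in_orbit[OF P]])
  have "pairwise disjnt ?O"
  proof (rule pairwiseI)
    fix a b assume "a \<in> ?O" "b \<in> ?O" "a \<noteq> b"
    then obtain x y where xy: "a = orbit \<sigma> x" "b = orbit \<sigma> y" by auto
    show "disjnt a b"
    proof (rule ccontr)
      assume "\<not> disjnt a b"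
      then obtain z where "z \<in> a" "z \<in> b" by (auto simp: disjnt_def)
      then have "a = b" using orbit_eq[OF P, of z x] orbit_eq[OF P, of z y] xy by simp
      then show False using \<open>a \<noteq> b\<close> by simp
    qed
  qed
  then have "card (\<Union>?O) = sum card ?O" by (rule card_Union_disjoint) (use fin in auto)
  moreover have "\<Union>?O = {1..n}"
  proof
    show "\<Union>?O \<subseteq> {1..n}" using permutes_orbit_subset[OF s] by blast
    show "{1..n} \<subseteq> \<Union>?O" using permutation_self_in_orbit[OF P] by blast
  qed
  ultimately have "sum card ?O = n" by simp
  then have "sum_mset (cycle_type n \<sigma>) = n" unfolding cycle_type_def by (simp add: sum_unfold_sum_mset)
  moreover have "0 \<notin># cycle_type n \<sigma>"
    using fin orbit_nonempty[of \<sigma>] by (auto simp: cycle_type_def)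
  ultimately show ?thesis by (simp add: partitions_def)
qed

lemma card_orbit_in_cycle_type: "1 \<le> n \<Longrightarrow> card (orbit \<sigma> n) \<in># cycle_type n \<sigma>"
  by (auto simp: cycle_type_def)

text \<open>A permutation and its inverse have the same orbits. The trace form pairs values at
  inverses, and this keeps them in one class.\<close>

lemma near_class_inv:
  assumes "\<sigma> \<in> near_class n lam i" shows "inv \<sigma> \<in> near_class n lam i"
proof -
  have s: "\<sigma> permutes {1..n}" using assms by (simp add: near_class_def)
  have "orbit (inv \<sigma>) = orbit \<sigma>" using orbit_inv_eq[OF permutes_imp_permutation[OF s]] by blast
  then show ?thesis using assms permutes_inv[OF s] by (simp add: near_class_def cycle_type_def)
qed

section \<open>Words and standard Young tableaux\<close>

definition part :: "nat list \<Rightarrow> nat multiset" where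
  "part w = image_mset (count_list w) (mset_set (set w))"

section \<open>Rows and columns of the tableau of a word\<close>

definition row_list :: "nat list \<Rightarrow> nat \<Rightarrow> nat list" where
  "row_list w i = filter (\<lambda>x. wrow w x = i) [1..<Suc (length w)]"

definition rows_of :: "nat list \<Rightarrow> nat list list" where
  "rows_of w = map (row_list w) [0..<card (set w)]"

lemma set_row_list: "set (row_list w i) = {x \<in> {1..length w}. wrow w x = i}"
  by (auto simp: row_list_def)

lemma sorted_row_list: "sorted_wrt (<) (row_list w i)"
  unfolding row_list_def by (intro sorted_wrt_filter sorted_wrt_upt)

lemma distinct_row_list: "distinct (row_list w i)"
  unfolding row_list_def by simp

lemma length_row_list: "length (row_list w i) = count_list w i"
  using card_row[of "length w" w i] distinct_card[OF distinct_row_list[of w i]]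
  by (simp add: set_row_list)

lemma set_valid:
  assumes "valid w" shows "set w = {..<card (set w)}"
proof (rule down_closed_eq_lessThan)
  fix x i assume "x \<in> set w" "i < x"
  then have "0 < count_list w x" using count_list_0_iff[of w x] by simp
  also have "\<dots> \<le> count_list w i" using valid_antimono'[OF assms, of i x] \<open>i < x\<close> by simp
  finally show "i \<in> set w" using count_list_0_iff[of w i] by simp
qed simp

lemma set_valid_iff: "valid w \<Longrightarrow> i \<in> set w \<longleftrightarrow> i < card (set w)"
  using set_valid by blast

lemma count_pos_iff: "valid w \<Longrightarrow> 0 < count_list w i \<longleftrightarrow> i < card (set w)"
  using count_list_0_iff[of w i] set_valid_iff[of w i] by auto

lemma map_length_rows_of: "map length (rows_of w) = map (count_list w) [0..<card (set w)]"
  by (simp add: rows_of_def length_row_list)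

lemma mset_length_rows_of:
  assumes "valid w" shows "mset (map length (rows_of w)) = part w"
proof -
  have "mset_set (set w) = mset [0..<card (set w)]"
    by (subst set_valid[OF assms]) (simp add: lessThan_atLeast0)
  then show ?thesis by (simp add: map_length_rows_of part_def)
qed

lemma map_length_rows_of_sorted:
  assumes "valid w" shows "map length (rows_of w) = rev (sorted_list_of_multiset (part w))"
proof -
  have "sorted (rev (map length (rows_of w)))"
    unfolding map_length_rows_of
    by (auto simp: sorted_iff_nth_mono rev_nth intro!: valid_antimono'[OF assms])
  moreover have "mset (rev (map length (rows_of w))) = part w" using mset_length_rows_of[OF assms] by simp
  ultimately have "rev (map length (rows_of w)) = sorted_list_of_multiset (part w)"
    by (metis sorted_list_of_multiset_mset sorted_sort_id)
  then show ?thesis by (metis rev_rev_ident)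
qed

text \<open>The letter counts of a valid word are weakly decreasing, so sorting the parts recovers
  them. This translates between shapes as count functions and shapes as multisets.\<close>

lemma part_eq_iff:
  assumes "valid w" "valid v" shows "part w = part v \<longleftrightarrow> count_list w = count_list v"
proof
  assume p: "part w = part v"
  have m: "map (count_list w) [0..<card (set w)] = map (count_list v) [0..<card (set v)]"
    using map_length_rows_of_sorted[OF assms(1)] map_length_rows_of_sorted[OF assms(2)] p
    by (simp add: map_length_rows_of)
  then have c: "card (set w) = card (set v)" by (metis length_map length_upt diff_zero)
  show "count_list w = count_list v"
  proof
    fix i
    show "count_list w i = count_list v i"
    proof (cases "i < card (set w)")
      case True
      then have "map (count_list w) [0..<card (set w)] ! i = count_list w i"
        "map (count_list v) [0..<card (set v)] ! i = count_list v i" using c by auto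
      then show ?thesis using m by simp
    next
      case False
      then show ?thesis using count_pos_iff[OF assms(1), of i] count_pos_iff[OF assms(2), of i] c by simp
    qed
  qed
next
  assume c: "count_list w = count_list v"
  have "set w = set v" using c count_list_0_iff by (metis (no_types) subsetI subset_antisym)
  then show "part w = part v" using c by (simp add: part_def)
qed

lemma sum_part: "sum_mset (part w) = length w"
proof -
  have "sum_mset (part w) = (\<Sum>x\<in>set w. count_list w x)" by (simp add: part_def sum_unfold_sum_mset)
  then show ?thesis by (simp add: sum_count_set)
qed

lemma part_partition: "w \<in> Words n \<Longrightarrow> part w \<in> partitions n"
  by (auto simp: partitions_def sum_part Words_def, auto simp: part_def count_list_0_iff)

lemma row_list_snoc: "row_list (w @ [a]) i = row_list w i @ (if a = i then [Suc (length w)] else [])"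
proof -
  have "filter (\<lambda>x. wrow (w @ [a]) x = i) [1..<Suc (length w)] = filter (\<lambda>x. wrow w x = i) [1..<Suc (length w)]"
    by (rule filter_cong) (auto simp: wrow_def nth_append)
  then show ?thesis by (auto simp: row_list_def) (auto simp: wrow_def nth_append)
qed

lemma wcol_row_list: "j < count_list w i \<Longrightarrow> wcol w (row_list w i ! j) = j"
proof (induction w rule: rev_induct)
  case (snoc a w)
  have same: "wcol (w @ [a]) x = wcol w x" if "x \<in> {1..length w}" for x
    using that by (auto simp: wcol_def nth_append)
  show ?case
  proof (cases "j < count_list w i")
    case True
    then have "row_list (w @ [a]) i ! j = row_list w i ! j"
      by (simp add: row_list_snoc nth_append length_row_list)
    moreover have "row_list w i ! j \<in> {1..length w}"
      using nth_mem[of j "row_list w i"] True by (simp add: length_row_list set_row_list)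
    ultimately show ?thesis using same snoc.IH[OF True] by simp
  next
    case False
    then have "a = i" "j = count_list w i" using snoc.prems by (auto split: if_splits)
    then have "row_list (w @ [a]) i ! j = Suc (length w)"
      by (simp add: row_list_snoc nth_append length_row_list)
    then show ?thesis using \<open>a = i\<close> \<open>j = count_list w i\<close> by (simp add: wcol_def)
  qed
qed simp

lemma row_list_nth:
  assumes "j < count_list w i"
  shows "row_list w i ! j \<in> {1..length w}" "wrow w (row_list w i ! j) = i" "wcol w (row_list w i ! j) = j"
  using nth_mem[of j "row_list w i"] assms wcol_row_list[OF assms]
  by (auto simp: length_row_list set_row_list)

lemma row_list_nth_eq:
  assumes "x \<in> {1..length w}"
  shows "wcol w x < count_list w (wrow w x)" "row_list w (wrow w x) ! wcol w x = x"
proof -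
  have "(wrow w x, wcol w x) \<in> {(i, j). j < count_list w i}"
    unfolding positions_image[symmetric] using assms by (rule imageI)
  then show lt: "wcol w x < count_list w (wrow w x)" by simp
  show "row_list w (wrow w x) ! wcol w x = x"
    using inj_onD[OF inj_on_positions[of "length w" w], of "row_list w (wrow w x) ! wcol w x" x]
      row_list_nth[OF lt] assms by simp
qed

text \<open>When the cell (i', j) is filled, the prefix condition makes row i longer than j, so (i,
  j) was filled before.\<close>

lemma row_list_column_less:
  assumes v: "valid w" and i: "i < i'" and j: "j < count_list w i'"
  shows "row_list w i ! j < row_list w i' ! j"
proof -
  define y where "y = row_list w i' ! j"
  have y: "y \<in> {1..length w}" "wrow w y = i'" "wcol w y = j" using row_list_nth[OF j] by (auto simp: y_def)
  have ly: "y - 1 < length w" "Suc (y - 1) = y" using y by auto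
  have "count_list (take y w) i' = Suc j"
    using count_list_take_Suc[OF ly(1), of i'] y ly by (simp add: wrow_def wcol_def)
  then have "j < count_list (take y w) i" using valid_antimono[OF v, of i i' y] i by simp
  then obtain k where k: "k < y" "w ! k = i" "count_list (take k w) i = j"
    using ex_position[of y w j i] y by auto
  have "k \<noteq> y - 1" using k y i by (auto simp: wrow_def)
  then have ky: "Suc k < y" using k by auto
  have "wrow w (Suc k) = i" "wcol w (Suc k) = j" "Suc k \<in> {1..length w}"
    using k ky y by (auto simp: wrow_def wcol_def)
  then have "row_list w i ! j = Suc k" using row_list_nth_eq(2)[of "Suc k" w] by simp
  then show ?thesis using ky y_def by simp
qed

lemma rows_of_nth: "i < card (set w) \<Longrightarrow> rows_of w ! i = row_list w i"
  by (simp add: rows_of_def)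

lemma length_rows_of [simp]: "length (rows_of w) = card (set w)" by (simp add: rows_of_def)

lemma set_column:
  assumes v: "valid w" and j: "j < length (List.transpose (rows_of w))"
  shows "set (List.transpose (rows_of w) ! j) = {x \<in> {1..length w}. wcol w x = j}"
proof -
  have "set (List.transpose (rows_of w) ! j) = {row_list w i ! j | i. i < card (set w) \<and> j < count_list w i}"
    unfolding nth_transpose[OF j] by (auto simp: rows_of_def length_row_list)
  also have "\<dots> = {x \<in> {1..length w}. wcol w x = j}"
  proof (intro equalityI subsetI)
    fix x assume "x \<in> {x \<in> {1..length w}. wcol w x = j}"
    then have x: "x \<in> {1..length w}" "wcol w x = j" by auto
    note e = row_list_nth_eq[OF x(1)]
    then have "wrow w x < card (set w)" using count_pos_iff[OF v, of "wrow w x"] by simp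
    then show "x \<in> {row_list w i ! j | i. i < card (set w) \<and> j < count_list w i}"
      using e x by (intro CollectI exI[of _ "wrow w x"]) auto
  next
    fix x assume "x \<in> {row_list w i ! j | i. i < card (set w) \<and> j < count_list w i}"
    then obtain i where "x = row_list w i ! j" "j < count_list w i" by blast
    then show "x \<in> {x \<in> {1..length w}. wcol w x = j}" using row_list_nth[of j w i] by simp
  qed
  finally show ?thesis .
qed

lemma column_index_less:
  assumes v: "valid w" and x: "x \<in> {1..length w}"
  shows "wcol w x < length (List.transpose (rows_of w))"
proof -
  have ge: "r \<in> set rs \<Longrightarrow> length r \<le> foldr (\<lambda>xs. max (length xs)) rs 0" for r :: "nat list" and rs
    by (induction rs) auto
  have lt: "wcol w x < count_list w (wrow w x)" by (rule row_list_nth_eq(1)[OF x])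
  then have "wrow w x < card (set w)" using count_pos_iff[OF v, of "wrow w x"] by simp
  then have "row_list w (wrow w x) \<in> set (rows_of w)" by (auto simp: rows_of_def)
  from ge[OF this] show ?thesis using lt unfolding length_transpose length_row_list by simp
qed

lemma rows_of_SYT:
  assumes w: "w \<in> Words n" shows "rows_of w \<in> SYT (part w)"
proof -
  have v: "valid w" and l: "length w = n" using w by (auto simp: Words_def)
  have set: "set (concat (rows_of w)) = {1..n}"
  proof -
    have "wrow w x < card (set w)" if "x \<in> {1..n}" for x
    proof -
      have "w ! (x - 1) \<in> set w" using that l by (intro nth_mem) auto
      then show ?thesis using set_valid_iff[OF v] by (simp add: wrow_def)
    qed
    then show ?thesis by (auto simp: rows_of_def set_row_list l)
  qed
  \<comment> \<open>The row lengths add up to n and the entries exhaust {1..n}, so none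
    repeats.\<close>
  have dist: "distinct (concat (rows_of w))"
  proof (rule card_distinct)
    have "length (concat (rows_of w)) = sum_mset (mset (map length (rows_of w)))"
      by (simp only: length_concat sum_mset_sum_list)
    also have "\<dots> = n" using l by (simp only: mset_length_rows_of[OF v] sum_part)
    finally show "card (set (concat (rows_of w))) = length (concat (rows_of w))" unfolding set by simp
  qed
  have cols: "sorted_wrt (<) col" if col: "col \<in> set (List.transpose (rows_of w))" for col
  proof -
    obtain j where j: "j < length (List.transpose (rows_of w))" "col = List.transpose (rows_of w) ! j"
      using col by (auto simp: in_set_conv_nth)
    let ?F = "filter (\<lambda>r. j < length r) (rows_of w)"
    have col_eq: "col = map (\<lambda>r. r ! j) ?F" using j nth_transpose by simp
    have F: "?F = map (row_list w) (filter (\<lambda>i. j < count_list w i) [0..<card (set w)])"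
      by (simp add: rows_of_def filter_map comp_def length_row_list)
    have "sorted_wrt (<) (filter (\<lambda>i. j < count_list w i) [0..<card (set w)])"
      by (intro sorted_wrt_filter) simp
    then show ?thesis
      unfolding col_eq F
      by (auto simp: sorted_wrt_map elim!: sorted_wrt_mono_rel[rotated] intro: row_list_column_less[OF v])
  qed
  have rows: "\<forall>row\<in>set (rows_of w). sorted_wrt (<) row" by (auto simp: rows_of_def sorted_row_list)
  show ?thesis
    unfolding SYT_def using map_length_rows_of_sorted[OF v] set dist cols rows by (simp add: sum_part l)
qed

lemma rows_of_inj:
  assumes w: "w \<in> Words n" "v \<in> Words n" and e: "rows_of w = rows_of v" shows "w = v"
proof (rule nth_equalityI)
  have l: "length w = n" "length v = n" and V: "valid w" "valid v" using w by (auto simp: Words_def)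
  show "length w = length v" using l by simp
  have c: "card (set w) = card (set v)" using arg_cong[OF e, of length] by simp
  fix x assume x: "x < length w"
  have "w ! x < card (set w)" using nth_mem[OF x] set_valid_iff[OF V(1)] by blast
  then have r: "row_list w (w ! x) = row_list v (w ! x)" using arg_cong[OF e, of "\<lambda>r. r ! (w ! x)"] c
    by (simp add: rows_of_nth)
  have "Suc x \<in> set (row_list w (w ! x))" using x by (auto simp: set_row_list wrow_def)
  then show "w ! x = v ! x" unfolding r by (auto simp: set_row_list wrow_def)
qed

text \<open>The word lists the row of each entry. Its prefix condition at m compares the numbers of
  entries \<le> m in adjacent rows, and increasing columns embed the lower row's cells into those of
  the upper row.\<close>

lemma rows_of_surj:
  assumes T: "T \<in> SYT rho" and rho: "rho \<in> partitions n"
  shows "\<exists>w\<in>Words n. part w = rho \<and> rows_of w = T"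
proof -
  have n: "sum_mset rho = n" and z: "0 \<notin># rho" using rho by (auto simp: partitions_def)
  have len: "map length T = rev (sorted_list_of_multiset rho)" and dist: "distinct (concat T)"
    and set: "set (concat T) = {1..n}" and rows: "\<And>row. row \<in> set T \<Longrightarrow> sorted_wrt (<) row"
    and cols: "\<And>col. col \<in> set (List.transpose T) \<Longrightarrow> sorted_wrt (<) col"
    using T n by (auto simp: SYT_def)
  have mset: "mset (map length T) = rho" unfolding len by simp
  have ne: "T ! i \<noteq> []" if "i < length T" for i
  proof
    assume "T ! i = []"
    then have "0 \<in> set (map length T)" using that by (force simp: in_set_conv_nth)
    then show False using z mset by (metis set_mset_mset)
  qed
  have sorted_len: "sorted (rev (map length T))" unfolding len by simp
  have len_le: "length (T ! b) \<le> length (T ! a)" if "a \<le> b" "b < length T" for a b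
    using that sorted_rev_nth_mono[OF sorted_len, of a b] by simp
  have disj: "i = i'" if "i < length T" "i' < length T" "x \<in> set (T ! i)" "x \<in> set (T ! i')" for i i' x
  proof (rule ccontr)
    assume "i \<noteq> i'"
    have "distinct (concat T) \<Longrightarrow> a < b \<Longrightarrow> b < length T \<Longrightarrow> set (T ! a) \<inter> set (T ! b) = {}" for a b
    proof (induction T arbitrary: a b)
      case (Cons r T)
      then show ?case
      proof (cases a)
        case 0
        then obtain b' where "b = Suc b'" using Cons.prems by (cases b) auto
        then show ?thesis using Cons.prems 0 by (fastforce dest: nth_mem)
      next
        case (Suc a')
        then obtain b' where "b = Suc b'" using Cons.prems by (cases b) auto
        then show ?thesis using Cons Suc by simp
      qed
    qed simp
    from this[OF dist, of i i'] this[OF dist, of i' i] show False using that \<open>i \<noteq> i'\<close> by (metis disjoint_iff linorder_neqE_nat)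
  qed
  have ex: "\<exists>i. i < length T \<and> x \<in> set (T ! i)" if x: "x \<in> {1..n}" for x
  proof -
    have "x \<in> set (concat T)" using x set by simp
    then obtain r where "r \<in> set T" "x \<in> set r" by auto
    then show ?thesis by (metis in_set_conv_nth)
  qed
  then obtain idx where idx: "\<And>x. x \<in> {1..n} \<Longrightarrow> idx x < length T \<and> x \<in> set (T ! idx x)" by metis
  have idx_eq: "idx x = i" if "x \<in> {1..n}" "i < length T" "x \<in> set (T ! i)" for x i
    using disj[of "idx x" i x] idx that by blast
  have sub: "set (T ! i) \<subseteq> {1..n}" if "i < length T" for i
    using set nth_mem[OF that] by (auto simp del: atLeastAtMost_iff)
  define w where "w = map idx [1..<Suc n]"
  have lw: "length w = n" by (simp add: w_def)
  have wr: "wrow w x = idx x" if "x \<in> {1..n}" for x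
    using that by (auto simp: w_def wrow_def simp del: upt_Suc)
  have setw: "set w = {..<length T}"
  proof (intro equalityI subsetI)
    fix i assume "i \<in> {..<length T}"
    then have i: "i < length T" by simp
    obtain x where x: "x \<in> set (T ! i)" using ne[OF i] by (cases "T ! i") auto
    then have x': "x \<in> {1..n}" using sub[OF i] by blast
    then have "idx x = i" using idx_eq i x by blast
    then show "i \<in> set w" using x' by (auto simp: w_def simp del: upt_Suc)
  qed (use idx in \<open>auto simp: w_def simp del: upt_Suc\<close>)
  have row: "row_list w i = T ! i" if i: "i < length T" for i
  proof -
    have "set (row_list w i) = set (T ! i)"
      unfolding set_row_list lw
    proof (intro equalityI subsetI)
      fix x assume "x \<in> {x \<in> {1..n}. wrow w x = i}"
      then have "x \<in> {1..n}" "wrow w x = i" by blast+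
      then show "x \<in> set (T ! i)" using wr[of x] idx[of x] by metis
    next
      fix x assume x: "x \<in> set (T ! i)"
      then have x': "x \<in> {1..n}" using sub[OF i] by blast
      then have "wrow w x = i" using wr[OF x'] idx_eq[OF x' i x] by simp
      then show "x \<in> {x \<in> {1..n}. wrow w x = i}" using x' by blast
    qed
    moreover have "sorted (row_list w i)" "sorted (T ! i)" "distinct (T ! i)"
      using sorted_row_list[of w i] rows[OF nth_mem[OF i]] by (auto simp: strict_sorted_iff)
    ultimately show ?thesis using distinct_row_list[of w i] by (intro sorted_distinct_set_unique) auto
  qed
  have rT: "rows_of w = T"
    by (rule nth_equalityI) (simp_all add: setw rows_of_nth row)
  have col_less: "T ! i ! j < T ! Suc i ! j" if "Suc i < length T" "j < length (T ! Suc i)" for i j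
  proof -
    let ?F = "filter (\<lambda>r. j < length r) T"
    have ge: "r \<in> set rs \<Longrightarrow> length r \<le> foldr (\<lambda>xs. max (length xs)) rs 0" for r :: "nat list" and rs
      by (induction rs) auto
    have j: "j < length (List.transpose T)"
      using ge[OF nth_mem[OF that(1)]] that(2) unfolding length_transpose by simp
    \<comment> \<open>Rows 0 to i + 1 all reach column j, so this column has at least i + 2 entries.
      Since row lengths decrease, dropping short rows in the transpose leaves its entry i in row
      i.\<close>
    have "{..Suc i} \<subseteq> {k. k < length T \<and> j < length (T ! k)}"
    proof
      fix k assume "k \<in> {..Suc i}"
      then show "k \<in> {k. k < length T \<and> j < length (T ! k)}" using that len_le[of k "Suc i"] by simp
    qed
    then have "card {..Suc i} \<le> length ?F"
      unfolding length_filter_conv_card by (intro card_mono) auto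
    then have in_F: "Suc i < length ?F" by simp
    have "sorted_wrt (<) (List.transpose T ! j)" using cols j by simp
    moreover have "length (List.transpose T ! j) = length ?F" by (simp add: nth_transpose[OF j])
    ultimately have "List.transpose T ! j ! i < List.transpose T ! j ! Suc i"
      using in_F by (simp add: sorted_wrt_iff_nth_less)
    then show ?thesis using nth_nth_transpose_sorted[OF sorted_len j] in_F by simp
  qed
  have "valid w" 
    unfolding valid_def
  proof (intro allI)
    fix m i
    have cnt: "count_list (take m w) i = card {j. j < length (T ! i) \<and> T ! i ! j \<le> m}" if i: "i < length T" for i
    proof -
      have "count_list (take m w) i = count_list (take (min m n) w) i" using lw by (simp add: min_def)
      also have "\<dots> = card {y \<in> {1..min m n}. wrow w y = i}" by (rule card_row[symmetric]) (simp add: lw)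
      also have "{y \<in> {1..min m n}. wrow w y = i} = {y \<in> set (T ! i). y \<le> m}"
        unfolding row[OF i, symmetric] set_row_list lw by auto
      also have "\<dots> = (\<lambda>j. T ! i ! j) ` {j. j < length (T ! i) \<and> T ! i ! j \<le> m}"
        by (auto simp: in_set_conv_nth)
      also have "card \<dots> = card {j. j < length (T ! i) \<and> T ! i ! j \<le> m}"
        using distinct_row_list[of w i] unfolding row[OF i]
        by (intro card_image) (auto simp: inj_on_def nth_eq_iff_index_eq)
      finally show ?thesis .
    qed
    show "count_list (take m w) (Suc i) \<le> count_list (take m w) i"
    proof (cases "Suc i < length T")
      case True
      have "{j. j < length (T ! Suc i) \<and> T ! Suc i ! j \<le> m} \<subseteq> {j. j < length (T ! i) \<and> T ! i ! j \<le> m}"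
        using col_less[OF True] len_le[of i "Suc i"] True by fastforce
      then show ?thesis using cnt[OF True] cnt[of i] True by (auto intro!: card_mono)
    next
      case False
      then have "Suc i \<notin> set (take m w)" using setw set_take_subset[of m w] by auto
      then show ?thesis by (simp add: count_list_0_iff)
    qed
  qed
  then have "w \<in> Words n" using lw by (simp add: Words_def)
  moreover have "part w = rho" using mset_length_rows_of[OF \<open>valid w\<close>] mset unfolding rT by simp
  ultimately show ?thesis using rT by blast
qed

section \<open>Adding and removing the largest entry\<close>

lemma part_snoc:
  "part (u @ [i]) =
    part u - (if count_list u i = 0 then {#} else {#count_list u i#}) + {#Suc (count_list u i)#}"
proof -
  let ?R = "image_mset (count_list u) (mset_set (set u - {i}))"
  have s: "set (u @ [i]) = insert i (set u - {i})" by auto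
  have "part (u @ [i]) = add_mset (Suc (count_list u i)) (image_mset (count_list (u @ [i])) (mset_set (set u - {i})))"
    unfolding part_def s by (subst mset_set.insert) simp_all
  also have "image_mset (count_list (u @ [i])) (mset_set (set u - {i})) = ?R"
    by (rule image_mset_cong) auto
  finally have 1: "part (u @ [i]) = add_mset (Suc (count_list u i)) ?R" .
  show ?thesis
  proof (cases "i \<in> set u")
    case True
    then have "set u = insert i (set u - {i})" by auto
    then have "part u = add_mset (count_list u i) ?R"
      unfolding part_def by (metis (no_types, lifting) finite_Diff finite_set image_mset_add_mset
          mset_set.insert_remove Diff_insert_absorb Diff_idemp)
    moreover have "count_list u i \<noteq> 0" using True by (simp add: count_list_0_iff)
    ultimately show ?thesis using 1 by simp
  next
    case False
    then show ?thesis using 1 by (simp add: part_def)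
  qed
qed

lemma count_in_part: "count_list u i \<noteq> 0 \<Longrightarrow> count_list u i \<in># part u"
  by (auto simp: part_def count_list_0_iff)

lemma lower_part_snoc: "lower_part (Suc (count_list u i)) (part (u @ [i])) = part u"
  using count_in_part[of u i] by (auto simp: lower_part_def part_snoc)

lemma lower_part_partition:
  assumes "rho \<in> partitions (Suc m)" "l \<in># rho" shows "lower_part l rho \<in> partitions m"
proof -
  have l: "l > 0" using assms by (cases l) (auto simp: partitions_def)
  obtain R where R: "rho = add_mset l R" using assms(2) by (metis mset_add)
  then show ?thesis using assms l by (auto simp: partitions_def lower_part_def)
qed

lemma part_snoc_lower_part:
  assumes "l \<in># rho" "l > 0" "part u = lower_part l rho" "count_list u i = l - 1"
  shows "part (u @ [i]) = rho"
proof -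
  obtain R where R: "rho = add_mset l R" using assms(1) by (metis mset_add)
  show ?thesis using assms by (auto simp: part_snoc lower_part_def R)
qed

text \<open>The topmost row with p cells is addable, because the row above it is strictly longer.
  For p = 0 this is the first empty row.\<close>

lemma ex_addable:
  assumes u: "valid u" and p: "p = 0 \<or> p \<in># part u"
  shows "\<exists>i\<in>addable (count_list u). count_list u i = p"
proof -
  have "\<exists>i. count_list u i = p"
  proof (cases "p = 0")
    case True
    then show ?thesis using count_pos_iff[OF u, of "card (set u)"] by (intro exI[of _ "card (set u)"]) simp
  next
    case False
    then show ?thesis using p by (auto simp: part_def)
  qed
  then obtain i where i: "count_list u i = p" "\<And>k. k < i \<Longrightarrow> count_list u k \<noteq> p"
    using exists_least_iff[of "\<lambda>i. count_list u i = p"] by auto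
  have "i \<in> addable (count_list u)"
  proof (cases i)
    case (Suc k)
    then show ?thesis using i(1) i(2)[of k] valid_antimono'[OF u, of k i] by (simp add: addable_def)
  qed (simp add: addable_def)
  then show ?thesis using i by blast
qed

lemma addable_unique:
  assumes u: "valid u" and i: "i \<in> addable (count_list u)" "i' \<in> addable (count_list u)"
    and c: "count_list u i = count_list u i'"
  shows "i = i'"
proof -
  have *: False if "i' \<in> addable (count_list u)" "count_list u i = count_list u i'" "i < i'" for i i'
  proof -
    have "i \<le> i' - 1" using that by simp
    from valid_antimono'[OF u this] show False using that by (auto simp: addable_def)
  qed
  show ?thesis using *[of i' i] *[of i i'] i c by (metis linorder_neqE_nat)
qed

text \<open>The last letter is the row of the largest entry, which sits at the end of that row; the
  total count of the letter is the row length.\<close>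

definition words_ending :: "nat \<Rightarrow> nat multiset \<Rightarrow> nat \<Rightarrow> nat list set" where
  "words_ending n rho l = {w \<in> Words n. part w = rho \<and> count_list w (last w) = l}"

lemma words_ending_Suc_iff:
  "u @ [i] \<in> words_ending (Suc m) rho l \<longleftrightarrow>
     u \<in> Words m \<and> i \<in> addable (count_list u) \<and> part (u @ [i]) = rho \<and> Suc (count_list u i) = l"
  by (auto simp: words_ending_def Words_def valid_snoc)

lemma words_ending_snocE:
  assumes "w \<in> words_ending (Suc m) rho l"
  obtains u i where "w = u @ [i]"
proof -
  have "w \<noteq> []" using assms by (auto simp: words_ending_def Words_def)
  then have "w = butlast w @ [last w]" by simp
  then show ?thesis by (rule that)
qed

text \<open>The largest entry can be put back in only one way: among rows with l - 1 cells only the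
  top one is addable. This branching rule is the source of the tableau number of the lowered
  shape.\<close>

lemma bij_betw_butlast_words_ending:
  assumes rho: "rho \<in> partitions (Suc m)" "l \<in># rho"
  shows "bij_betw butlast (words_ending (Suc m) rho l) {u \<in> Words m. part u = lower_part l rho}"
proof -
  have l: "l > 0" using rho by (cases l) (auto simp: partitions_def)
  have into: "butlast w \<in> {u \<in> Words m. part u = lower_part l rho}" if w: "w \<in> words_ending (Suc m) rho l" for w
  proof -
    obtain u i where e: "w = u @ [i]" using words_ending_snocE[OF w] .
    then show ?thesis using w lower_part_snoc[of u i] by (auto simp: words_ending_Suc_iff)
  qed
  have inj: "w = w'" if w: "w \<in> words_ending (Suc m) rho l" "w' \<in> words_ending (Suc m) rho l" and b: "butlast w = butlast w'" for w w'
  proof -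
    obtain u i where e: "w = u @ [i]" using words_ending_snocE[OF w(1)] .
    obtain u' i' where e': "w' = u' @ [i']" using words_ending_snocE[OF w(2)] .
    have "u = u'" using b e e' by simp
    moreover have "i = i'"
      using w e e' \<open>u = u'\<close> addable_unique[of u i i'] by (auto simp: words_ending_Suc_iff Words_def)
    ultimately show ?thesis using e e' by simp
  qed
  have surj: "u \<in> butlast ` words_ending (Suc m) rho l" if u: "u \<in> Words m" "part u = lower_part l rho" for u
  proof -
    have "l - 1 = 0 \<or> l - 1 \<in># part u" unfolding u lower_part_def by auto
    then obtain i where i: "i \<in> addable (count_list u)" "count_list u i = l - 1"
      using ex_addable[of u "l - 1"] u by (auto simp: Words_def)
    then have "u @ [i] \<in> words_ending (Suc m) rho l"
      using part_snoc_lower_part[OF rho(2) l u(2) i(2)] u l by (simp add: words_ending_Suc_iff)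
    then show ?thesis by (intro image_eqI[of _ _ "u @ [i]"]) simp_all
  qed
  show ?thesis unfolding bij_betw_def
    using into inj surj by (intro conjI inj_onI equalityI subsetI) auto
qed

lemma ex_word: "rho \<in> partitions n \<Longrightarrow> \<exists>w\<in>Words n. part w = rho"
proof (induction n arbitrary: rho)
  case 0
  then have "rho = {#}" by (cases rho) (auto simp: partitions_def)
  then show ?case by (intro bexI[of _ "[]"]) (auto simp: Words_0 part_def)
next
  case (Suc m)
  have "rho \<noteq> {#}" using Suc.prems by (auto simp: partitions_def)
  then obtain l where l: "l \<in># rho" by auto
  obtain u where "u \<in> Words m" "part u = lower_part l rho"
    using Suc.IH[OF lower_part_partition[OF Suc.prems l]] by blast
  then have "u \<in> butlast ` words_ending (Suc m) rho l"
    using bij_betw_imp_surj_on[OF bij_betw_butlast_words_ending[OF Suc.prems l]] by blast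
  then show ?case by (auto simp: words_ending_def)
qed

section \<open>Standard Young tableaux counted by words\<close>

lemma bij_betw_rows_of:
  assumes "rho \<in> partitions n"
  shows "bij_betw rows_of {w \<in> Words n. part w = rho} (SYT rho)"
  unfolding bij_betw_def
proof (intro conjI inj_onI equalityI subsetI)
  fix w v assume "w \<in> {w \<in> Words n. part w = rho}" "v \<in> {w \<in> Words n. part w = rho}" "rows_of w = rows_of v"
  then show "w = v" using rows_of_inj[of w n v] by simp
next
  fix T assume "T \<in> rows_of ` {w \<in> Words n. part w = rho}"
  then show "T \<in> SYT rho" using rows_of_SYT by blast
next
  fix T assume "T \<in> SYT rho"
  then show "T \<in> rows_of ` {w \<in> Words n. part w = rho}" using rows_of_surj[OF _ assms] by blast
qed

lemma num_SYT_eq_card: "rho \<in> partitions n \<Longrightarrow> num_SYT rho = card {w \<in> Words n. part w = rho}"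
  unfolding num_SYT_def using bij_betw_same_card[OF bij_betw_rows_of] by metis

lemma num_SYT_part: "w \<in> Words n \<Longrightarrow> num_SYT (part w) = num_words (count_list w)"
proof -
  assume w: "w \<in> Words n"
  have "{v \<in> Words n. part v = part w} = words_of_shape (count_list w)"
    using w part_eq_iff by (auto simp: words_of_shape_count_list Words_def)
  then show ?thesis using num_SYT_eq_card[OF part_partition[OF w]] by (simp add: num_words_def)
qed

lemma num_SYT_pos: "rho \<in> partitions n \<Longrightarrow> 0 < num_SYT rho"
  using ex_word[of rho n] num_SYT_part num_words_pos by metis

lemma card_words_ending: "rho \<in> partitions (Suc m) \<Longrightarrow> l \<in># rho \<Longrightarrow> card (words_ending (Suc m) rho l) = num_SYT (lower_part l rho)"
  using bij_betw_same_card[OF bij_betw_butlast_words_ending] num_SYT_eq_card[OF lower_part_partition] by metis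

lemma rows_of_SYT_end_iff:
  assumes w: "w \<in> Words (Suc m)"
  shows "rows_of w \<in> SYT_end (part w) l \<longleftrightarrow> count_list w (last w) = l"
proof -
  have v: "valid w" and len: "length w = Suc m" using w by (auto simp: Words_def)
  obtain u i where e: "w = u @ [i]" using len by (metis append_butlast_last_id length_0_conv nat.distinct(1))
  have row: "row_list w i = row_list u i @ [Suc m]" using len unfolding e row_list_snoc by simp
  have ic: "i < card (set w)" using count_pos_iff[OF v, of i] by (simp add: e)
  have other: "k = i" if "row_list w k \<noteq> []" "last (row_list w k) = Suc m" for k
  proof -
    have "Suc m \<in> set (row_list w k)" using that last_in_set by metis
    then show ?thesis using len by (simp add: set_row_list wrow_def e nth_append)
  qed
  have "(\<exists>row\<in>set (rows_of w). length row = l \<and> row \<noteq> [] \<and> last row = Suc m) \<longleftrightarrow> count_list w i = l"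
  proof
    assume "\<exists>row\<in>set (rows_of w). length row = l \<and> row \<noteq> [] \<and> last row = Suc m"
    then obtain k where "length (row_list w k) = l" "row_list w k \<noteq> []" "last (row_list w k) = Suc m"
      by (auto simp: rows_of_def)
    then show "count_list w i = l" using other[of k] length_row_list by metis
  next
    assume "count_list w i = l"
    moreover have "row_list w i \<in> set (rows_of w)" using ic by (simp add: rows_of_def)
    ultimately show "\<exists>row\<in>set (rows_of w). length row = l \<and> row \<noteq> [] \<and> last row = Suc m"
      using length_row_list[of w i] row by (intro bexI[of _ "row_list w i"]) simp_all
  qed
  then show ?thesis using rows_of_SYT[OF w] by (simp add: SYT_end_def sum_part len) (simp add: e)
qed

lemma bij_betw_rows_of_words_ending:
  assumes "rho \<in> partitions (Suc m)"
  shows "bij_betw rows_of (words_ending (Suc m) rho l) (SYT_end rho l)"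
proof (rule bij_betw_subset[OF bij_betw_rows_of[OF assms]])
  show "words_ending (Suc m) rho l \<subseteq> {w \<in> Words (Suc m). part w = rho}" by (auto simp: words_ending_def)
  show "rows_of ` words_ending (Suc m) rho l = SYT_end rho l"
  proof (intro equalityI subsetI)
    fix T assume "T \<in> rows_of ` words_ending (Suc m) rho l"
    then show "T \<in> SYT_end rho l" using rows_of_SYT_end_iff by (auto simp: words_ending_def)
  next
    fix T assume T: "T \<in> SYT_end rho l"
    then have "T \<in> SYT rho" by (simp add: SYT_end_def)
    then obtain w where w: "w \<in> Words (Suc m)" "part w = rho" "rows_of w = T" using rows_of_surj[OF _ assms] by blast
    then have "w \<in> words_ending (Suc m) rho l" using T rows_of_SYT_end_iff[OF w(1), of l] by (simp add: words_ending_def)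
    then show "T \<in> rows_of ` words_ending (Suc m) rho l" using w by blast
  qed
qed

lemma remove_entry_rows_of:
  assumes w: "u @ [i] \<in> Words (Suc m)"
  shows "remove_entry (Suc m) (rows_of (u @ [i])) = rows_of u"
proof -
  have v: "valid u" "valid (u @ [i])" and len: "length u = m" using w by (auto simp: Words_def valid_snoc)
  have f: "filter (\<lambda>x. x \<noteq> Suc m) (row_list (u @ [i]) k) = row_list u k" for k
  proof -
    have "filter (\<lambda>x. x \<noteq> Suc m) (row_list u k) = row_list u k"
      by (rule filter_True) (auto simp: set_row_list len)
    then show ?thesis by (simp add: row_list_snoc len)
  qed
  let ?k = "card (set u)" and ?k' = "card (set (u @ [i]))"
  have "?k \<le> ?k'" by (rule card_mono) auto
  \<comment> \<open>The second piece is non-empty only if the last letter opened a new row; removing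
    the entry empties that row and the filter discards it.\<close>
  then have upt: "[0..<?k'] = [0..<?k] @ [?k..<?k']" by (metis le0 upt_add_eq_append le_add_diff_inverse)
  have nonempty: "row_list u k \<noteq> [] \<longleftrightarrow> k < ?k" for k
    using count_pos_iff[OF v(1), of k] length_row_list[of u k] by auto
  have "remove_entry (Suc m) (rows_of (u @ [i])) = filter (\<lambda>row. row \<noteq> []) (map (row_list u) [0..<?k'])"
    unfolding remove_entry_def rows_of_def by (simp add: f comp_def)
  also have "\<dots> = map (row_list u) (filter (\<lambda>k. k < ?k) [0..<?k'])"
    by (simp add: filter_map comp_def nonempty)
  also have "filter (\<lambda>k. k < ?k) [0..<?k'] = [0..<?k]"
    unfolding upt by (simp add: filter_empty_conv)
  finally show ?thesis by (simp add: rows_of_def)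
qed

section \<open>Transfer to coefficient functions\<close>

text \<open>\<open>Fperm\<close> is meaningful on permutations only, hence the default 0, which
  agrees with the convention for coefficient functions.\<close>

definition to_galg :: "ga \<Rightarrow> galg" where
  "to_galg x = (\<lambda>\<sigma>. if permutation \<sigma> then coef x (Fperm \<sigma>) else 0)"

lemma permutation_inv_comp_iff:
  assumes "permutation \<pi>" shows "permutation (inv \<pi> \<circ> \<sigma>) \<longleftrightarrow> permutation \<sigma>"
proof
  assume "permutation (inv \<pi> \<circ> \<sigma>)"
  then have "permutation (\<pi> \<circ> (inv \<pi> \<circ> \<sigma>))" by (rule permutation_compose[OF assms])
  moreover have "\<pi> \<circ> (inv \<pi> \<circ> \<sigma>) = \<sigma>"
    using permutation_bijective[OF assms] by (auto simp: fun_eq_iff surj_f_inv_f bij_is_surj)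
  ultimately show "permutation \<sigma>" by simp
qed (simp add: permutation_compose permutation_inverse assms)

lemma Fperm_inv_comp:
  assumes "permutation \<pi>" "permutation \<sigma>"
  shows "Fperm (inv \<pi> \<circ> \<sigma>) = - Fperm \<pi> + Fperm \<sigma>"
  using assms by (simp add: plus_fperm_def uminus_fperm_def Fperm_inverse permutation_inverse)

lemma ga_mult_to_galg:
  assumes x: "x \<in> GA n" shows "ga_mult n (to_galg x) (to_galg y) = to_galg (x * y)"
proof
  fix \<sigma>
  have P: "permutation \<pi>" if "\<pi> permutes {1..n}" for \<pi> using that permutes_imp_permutation by blast
  show "ga_mult n (to_galg x) (to_galg y) \<sigma> = to_galg (x * y) \<sigma>"
  proof (cases "permutation \<sigma>")
    case True
    have "ga_mult n (to_galg x) (to_galg y) \<sigma> =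
        (\<Sum>\<pi> | \<pi> permutes {1..n}. coef x (Fperm \<pi>) * coef y (- Fperm \<pi> + Fperm \<sigma>))"
      unfolding ga_mult_def
      by (rule sum.cong) (auto simp: to_galg_def P True permutation_inv_comp_iff Fperm_inv_comp)
    also have "\<dots> = (\<Sum>\<rho>\<in>Sym n. coef x (Fperm (app \<rho>)) * coef y (- Fperm (app \<rho>) + Fperm \<sigma>))"
      by (rule sum.reindex_bij_betw[OF bij_betw_app_Sym, symmetric])
    also have "\<dots> = coef (x * y) (Fperm \<sigma>)"
      using x by (subst coef_mult[of "Sym n"]) (auto simp: app_inverse GA_def)
    finally show ?thesis using True by (simp add: to_galg_def)
  next
    case False
    have "ga_mult n (to_galg x) (to_galg y) \<sigma> = 0"
      unfolding ga_mult_def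
      by (rule sum.neutral) (auto simp: to_galg_def P False permutation_inv_comp_iff)
    then show ?thesis using False by (simp add: to_galg_def)
  qed
qed

lemma ga_one_to_galg: "ga_one = to_galg 1"
proof
  fix \<sigma>
  have "Fperm \<sigma> = 0 \<longleftrightarrow> \<sigma> = id" if "permutation \<sigma>"
    using that Fperm_inject[of \<sigma> id] by (simp add: zero_fperm_def permutation_id)
  then show "ga_one \<sigma> = to_galg 1 \<sigma>" by (auto simp: ga_one_def to_galg_def lookup_one when_def permutation_id)
qed

lemma ga_scale_to_galg: "ga_scale c (to_galg x) = to_galg (sc c * x)"
  by (auto simp: ga_scale_def to_galg_def fun_eq_iff)

lemma to_galg_sum: "to_galg (sum f A) \<sigma> = (\<Sum>a\<in>A. to_galg (f a) \<sigma>)"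
  by (simp add: to_galg_def lookup_sum)

lemma to_galg_nonperm: "x \<in> GA n \<Longrightarrow> \<not> \<sigma> permutes {1..n} \<Longrightarrow> to_galg x \<sigma> = 0"
  by (auto simp: to_galg_def intro!: GA_coef[of x n] simp: Sym_def Fperm_inverse)

text \<open>Bridges the two descriptions of row and column groups: rows as sets mapped onto
  themselves, and index functions left invariant. By finiteness, mapping a fibre into itself already
  means onto.\<close>

lemma fibres_stable_iff:
  fixes A :: "nat set"
  assumes p: "\<sigma> permutes A" and fin: "finite A" and I: "f ` A \<subseteq> I"
  shows "(\<forall>i\<in>I. \<sigma> ` {x \<in> A. f x = i} = {x \<in> A. f x = i}) \<longleftrightarrow> (\<forall>x\<in>A. f (\<sigma> x) = f x)"
proof
  assume a: "\<forall>i\<in>I. \<sigma> ` {x \<in> A. f x = i} = {x \<in> A. f x = i}"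
  show "\<forall>x\<in>A. f (\<sigma> x) = f x"
  proof
    fix x assume x: "x \<in> A"
    then have "\<sigma> x \<in> \<sigma> ` {y \<in> A. f y = f x}" by simp
    also have "\<dots> = {y \<in> A. f y = f x}" using a I x by blast
    finally show "f (\<sigma> x) = f x" by simp
  qed
next
  assume a: "\<forall>x\<in>A. f (\<sigma> x) = f x"
  show "\<forall>i\<in>I. \<sigma> ` {x \<in> A. f x = i} = {x \<in> A. f x = i}"
  proof
    fix i
    show "\<sigma> ` {x \<in> A. f x = i} = {x \<in> A. f x = i}"
    proof (rule endo_inj_surj)
      show "\<sigma> ` {x \<in> A. f x = i} \<subseteq> {x \<in> A. f x = i}" using a permutes_in_image[OF p] by auto
      show "inj_on \<sigma> {x \<in> A. f x = i}" using permutes_inj_on[OF p] .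
    qed (use fin in simp)
  qed
qed

lemma stab_Fperm_iff:
  "\<sigma> permutes {1..n} \<Longrightarrow> Fperm \<sigma> \<in> stab n f \<longleftrightarrow> (\<forall>x\<in>{1..n}. f (\<sigma> x) = f x)"
  by (simp add: stab_def Fperm_Sym app_Fperm)

lemma not_permutes_stab: "permutation \<sigma> \<Longrightarrow> \<not> \<sigma> permutes {1..n} \<Longrightarrow> Fperm \<sigma> \<notin> stab n f"
  by (auto simp: stab_def Sym_def Fperm_inverse)

lemma row_sym_rows_of:
  assumes w: "w \<in> Words n" shows "row_sym n (rows_of w) = to_galg (Psym n (wrow w))"
proof
  fix \<sigma>
  have v: "valid w" and l: "length w = n" using w by (auto simp: Words_def)
  show "row_sym n (rows_of w) \<sigma> = to_galg (Psym n (wrow w)) \<sigma>"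
  proof (cases "\<sigma> permutes {1..n}")
    case True
    have I: "wrow w ` {1..n} \<subseteq> {..<card (set w)}"
    proof
      fix i assume "i \<in> wrow w ` {1..n}"
      then obtain x where "x \<in> {1..n}" "i = w ! (x - 1)" by (auto simp: wrow_def)
      then have "i \<in> set w" using l by auto
      then show "i \<in> {..<card (set w)}" using set_valid_iff[OF v] by simp
    qed
    have "(\<forall>row\<in>set (rows_of w). \<sigma> ` set row = set row) \<longleftrightarrow>
        (\<forall>i\<in>{..<card (set w)}. \<sigma> ` {x \<in> {1..n}. wrow w x = i} = {x \<in> {1..n}. wrow w x = i})"
      by (simp add: rows_of_def set_row_list l lessThan_atLeast0)
    also have "\<dots> \<longleftrightarrow> (\<forall>x\<in>{1..n}. wrow w (\<sigma> x) = wrow w x)"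
      by (rule fibres_stable_iff[OF True _ I]) simp
    finally show ?thesis
      using True permutes_imp_permutation[OF True]
      by (simp add: row_sym_def to_galg_def coef_Psym stab_Fperm_iff)
  next
    case False
    then show ?thesis by (auto simp: row_sym_def to_galg_def coef_Psym not_permutes_stab)
  qed
qed

lemma col_antisym_rows_of:
  assumes w: "w \<in> Words n" shows "col_antisym n (rows_of w) = to_galg (Nsym n (wcol w))"
proof
  fix \<sigma>
  have v: "valid w" and l: "length w = n" using w by (auto simp: Words_def)
  let ?T = "List.transpose (rows_of w)"
  show "col_antisym n (rows_of w) \<sigma> = to_galg (Nsym n (wcol w)) \<sigma>"
  proof (cases "\<sigma> permutes {1..n}")
    case True
    have I: "wcol w ` {1..n} \<subseteq> {..<length ?T}" using column_index_less[OF v] l by auto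
    have "(\<forall>col\<in>set ?T. \<sigma> ` set col = set col) \<longleftrightarrow> (\<forall>j\<in>{..<length ?T}. \<sigma> ` set (?T ! j) = set (?T ! j))"
      by (auto simp: all_set_conv_all_nth)
    also have "\<dots> \<longleftrightarrow> (\<forall>j\<in>{..<length ?T}. \<sigma> ` {x \<in> {1..n}. wcol w x = j} = {x \<in> {1..n}. wcol w x = j})"
      by (intro ball_cong refl) (simp only: lessThan_iff set_column[OF v] l)
    also have "\<dots> \<longleftrightarrow> (\<forall>x\<in>{1..n}. wcol w (\<sigma> x) = wcol w x)"
      by (rule fibres_stable_iff[OF True _ I]) simp
    finally show ?thesis
      using True permutes_imp_permutation[OF True]
      by (simp add: col_antisym_def to_galg_def coef_Nsym stab_Fperm_iff fsign_def app_Fperm)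
  next
    case False
    then show ?thesis by (auto simp: col_antisym_def to_galg_def coef_Nsym not_permutes_stab)
  qed
qed

text \<open>The recursions agree up to the normalising scalar, and \<open>h_word_eq\<close>
  identifies the scalars.\<close>

lemma seminormal_rows_of: "w \<in> Words n \<Longrightarrow> seminormal n (rows_of w) = to_galg (su n w)"
proof (induction n arbitrary: w)
  case 0
  then show ?case by (simp add: ga_one_to_galg)
next
  case (Suc m)
  obtain u i where e: "w = u @ [i]" using Suc.prems unfolding Words_Suc by auto
  have u: "u \<in> Words m" using Suc.prems by (simp add: e Words_def valid_snoc)
  have v: "valid w" using Suc.prems by (simp add: Words_def)
  let ?n = "Suc m" and ?e = "su m u"
  have e': "seminormal m (remove_entry ?n (rows_of w)) = to_galg ?e"
    using remove_entry_rows_of[of u i m] Suc.prems Suc.IH[OF u] e by simp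
  have su_e: "?e = su m w" by (rule su_cong) (use u in \<open>simp add: e Words_def\<close>)
  have eGA: "?e \<in> GA ?n" by (rule GA_su_le) simp
  have "ga_prod ?n [to_galg ?e, row_sym ?n (rows_of w), col_antisym ?n (rows_of w), to_galg ?e] =
      to_galg (?e * (Psym ?n (wrow w) * (Nsym ?n (wcol w) * (?e * 1))))"
    unfolding ga_prod_def row_sym_rows_of[OF Suc.prems] col_antisym_rows_of[OF Suc.prems] ga_one_to_galg
    by (simp add: ga_mult_to_galg eGA)
  then have "seminormal ?n (rows_of w) =
      to_galg (sc (of_nat (num_SYT (mset (map length (rows_of w)))) / fact ?n) * (?e * E_word ?n w * ?e))"
    by (simp add: e' Let_def ga_scale_to_galg Esym_def mult.assoc)
  also have "of_nat (num_SYT (mset (map length (rows_of w)))) / fact ?n = 1 / h_word ?n w"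
    unfolding mset_length_rows_of[OF v] num_SYT_part[OF Suc.prems] h_word_eq[OF Suc.prems] by simp
  finally show ?case by (simp add: su_e)
qed

section \<open>The elements \<Gamma>: orthogonality, trace and commutation\<close>

definition Gamma_sum :: "nat \<Rightarrow> nat multiset \<Rightarrow> nat \<Rightarrow> ga" where
  "Gamma_sum n rho l = (\<Sum>w\<in>words_ending n rho l. su n w)"

lemma Gamma_sum_GA: "Gamma_sum n rho l \<in> GA n"
  unfolding Gamma_sum_def by (rule GA_sum) simp

lemma Gam_eq: "rho \<in> partitions (Suc m) \<Longrightarrow> Gam (Suc m) rho l = to_galg (Gamma_sum (Suc m) rho l)"
proof
  fix \<sigma>
  assume r: "rho \<in> partitions (Suc m)"
  have "Gam (Suc m) rho l \<sigma> = (\<Sum>w\<in>words_ending (Suc m) rho l. seminormal (Suc m) (rows_of w) \<sigma>)"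
    unfolding Gam_def by (rule sum.reindex_bij_betw[OF bij_betw_rows_of_words_ending[OF r], symmetric])
  also have "\<dots> = (\<Sum>w\<in>words_ending (Suc m) rho l. to_galg (su (Suc m) w) \<sigma>)"
    by (rule sum.cong) (simp_all only: words_ending_def mem_Collect_eq seminormal_rows_of)
  finally show "Gam (Suc m) rho l \<sigma> = to_galg (Gamma_sum (Suc m) rho l) \<sigma>" unfolding Gamma_sum_def to_galg_sum .
qed

lemma finite_words_ending [simp]: "finite (words_ending n rho l)"
  by (rule finite_subset[of _ "Words n"]) (auto simp: words_ending_def)

lemma Gamma_sum_orth:
  "Gamma_sum n rho l * Gamma_sum n rho' l' = (if (rho, l) = (rho', l') then Gamma_sum n rho l else 0)"
proof -
  have "Gamma_sum n rho l * Gamma_sum n rho' l' = (\<Sum>w\<in>words_ending n rho l. \<Sum>v\<in>words_ending n rho' l'. su n w * su n v)"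
    unfolding Gamma_sum_def by (rule sum_product)
  also have "\<dots> = (\<Sum>w\<in>words_ending n rho l. \<Sum>v\<in>words_ending n rho' l'. if w = v then su n w else 0)"
    by (intro sum.cong refl) (auto simp: words_ending_def su_orth)
  also have "\<dots> = (\<Sum>w\<in>words_ending n rho l. if w \<in> words_ending n rho' l' then su n w else 0)"
    by (intro sum.cong refl) simp
  also have "\<dots> = (if (rho, l) = (rho', l') then Gamma_sum n rho l else 0)"
    by (auto simp: Gamma_sum_def words_ending_def intro!: sum.neutral sum.cong)
  finally show ?thesis .
qed

text \<open>Each unit of shape \<rho> has trace d / n!, and branching counts the tableaux with the
  prescribed position of n.\<close>

lemma tr_Gamma_sum:
  assumes "rho \<in> partitions (Suc m)" "l \<in># rho"
  shows "tr (Gamma_sum (Suc m) rho l) = of_nat (num_SYT (lower_part l rho)) * of_nat (num_SYT rho) / fact (Suc m)"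
proof -
  have "tr (Gamma_sum (Suc m) rho l) = (\<Sum>w\<in>words_ending (Suc m) rho l. tr (su (Suc m) w))"
    by (simp add: Gamma_sum_def tr_def lookup_sum del: su.simps)
  also have "\<dots> = (\<Sum>w\<in>words_ending (Suc m) rho l. of_nat (num_SYT rho) / fact (Suc m))"
  proof (rule sum.cong)
    fix w assume "w \<in> words_ending (Suc m) rho l"
    then have w: "w \<in> Words (Suc m)" "part w = rho" by (auto simp: words_ending_def)
    have "tr (su (Suc m) w) = 1 / h_word (Suc m) w" by (rule tr_su) (use w in \<open>auto simp: Words_def\<close>)
    then show "tr (su (Suc m) w) = of_nat (num_SYT rho) / fact (Suc m)"
      using num_SYT_part[OF w(1)] w(2) h_word_eq[OF w(1)] by simp
  qed simp
  also have "\<dots> = of_nat (card (words_ending (Suc m) rho l)) * (of_nat (num_SYT rho) / fact (Suc m))" by simp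
  finally show ?thesis by (simp add: card_words_ending[OF assms])
qed

text \<open>A unit ends with the unit of its shortened tableau as a factor, so multiplying on the
  right by units of level m keeps or kills it according to that tableau. What remains are the
  tableaux with prescribed shape before and after removing n, equivalently prescribed \<rho> and l.
  A member w0 supplies these shapes as count functions.\<close>

lemma Gamma_sum_eq_shape_idem_mult:
  assumes w0: "w0 \<in> words_ending (Suc m) rho l"
  shows "Gamma_sum (Suc m) rho l = shape_idem (Suc m) (count_list w0) * shape_idem m (count_list (butlast w0))"
proof -
  let ?n = "Suc m" and ?s = "count_list w0" and ?s' = "count_list (butlast w0)"
  let ?A = "{w. w \<in> Words ?n \<and> count_list w = ?s}" and ?B = "{u. u \<in> Words m \<and> count_list u = ?s'}"
  have mult: "su ?n w * su m u = (if butlast w = u then su ?n w else 0)" if "w \<in> Words ?n" "u \<in> Words m" for w u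
  proof -
    have "su m w * su m u = (if take m w = take m u then su m w else 0)"
      by (rule su_mult_su) (use that in \<open>auto simp: Words_def\<close>)
    moreover have "take m w = butlast w" using that by (simp add: Words_def butlast_conv_take)
    moreover have "take m u = u" using that by (simp add: Words_def)
    ultimately have "su m w * su m u = (if butlast w = u then su m w else 0)" by simp
    then show ?thesis by (simp add: mult.assoc)
  qed
  have "shape_idem ?n ?s * shape_idem m ?s' = (\<Sum>w\<in>?A. \<Sum>u\<in>?B. su ?n w * su m u)"
    unfolding shape_idem_def by (rule sum_product)
  also have "\<dots> = (\<Sum>w\<in>?A. \<Sum>u\<in>?B. if butlast w = u then su ?n w else 0)"
    by (intro sum.cong refl) (simp add: mult del: su.simps)
  also have "\<dots> = (\<Sum>w\<in>?A. if butlast w \<in> ?B then su ?n w else 0)"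
    by (intro sum.cong refl) (simp del: su.simps)
  also have "\<dots> = (\<Sum>w\<in>{w \<in> ?A. butlast w \<in> ?B}. su ?n w)"
    by (rule sum.inter_filter[symmetric]) simp
  also have "{w \<in> ?A. butlast w \<in> ?B} = words_ending ?n rho l"
  proof (intro equalityI subsetI)
    obtain u0 i0 where e0: "w0 = u0 @ [i0]" using words_ending_snocE[OF w0] .
    fix w assume "w \<in> {w \<in> ?A. butlast w \<in> ?B}"
    then have w: "w \<in> Words ?n" "count_list w = ?s" "count_list (butlast w) = ?s'" by auto
    obtain u i where e: "w = u @ [i]" using w(1) unfolding Words_Suc by auto
    have "count_list u = count_list u0" using w(3) e e0 by simp
    then have "up (count_list u) i = up (count_list u) i0"
      using w(2) unfolding e e0 count_list_snoc by metis
    then have "i = i0" by (metis fun_upd_apply n_not_Suc_n)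
    moreover have "part w = part w0"
      using w w0 part_eq_iff[of w w0] by (auto simp: words_ending_def Words_def)
    ultimately show "w \<in> words_ending ?n rho l" using w w0 e e0 by (auto simp: words_ending_def)
  next
    fix w assume w: "w \<in> words_ending ?n rho l"
    obtain u i where e: "w = u @ [i]" using words_ending_snocE[OF w] .
    obtain u0 i0 where e0: "w0 = u0 @ [i0]" using words_ending_snocE[OF w0] .
    have "part u = lower_part l rho" "part u0 = lower_part l rho"
      using w w0 lower_part_snoc[of u i] lower_part_snoc[of u0 i0] unfolding e e0 words_ending_Suc_iff by metis+
    moreover have "u \<in> Words m" "u0 \<in> Words m" using w w0 unfolding e e0 words_ending_Suc_iff by auto
    ultimately have "count_list u = count_list u0" using part_eq_iff[of u u0] by (simp add: Words_def)
    moreover have "count_list w = count_list w0"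
      using w w0 part_eq_iff[of w w0] by (simp add: words_ending_def Words_def)
    ultimately show "w \<in> {w \<in> ?A. butlast w \<in> ?B}"
      using w \<open>u \<in> Words m\<close> e e0 by (simp add: words_ending_def)
  qed
  finally show ?thesis by (simp add: Gamma_sum_def del: su.simps)
qed

text \<open>An element of the smaller algebra commutes with both central idempotents, lying in both
  algebras.\<close>

lemma Gamma_sum_commute:
  assumes x: "x \<in> GA m" shows "x * Gamma_sum (Suc m) rho l = Gamma_sum (Suc m) rho l * x"
proof (cases "words_ending (Suc m) rho l = {}")
  case True then show ?thesis by (simp add: Gamma_sum_def)
next
  case False
  then obtain w0 where w0: "w0 \<in> words_ending (Suc m) rho l" by blast
  have x': "x \<in> GA (Suc m)" using x GA_mono[of m "Suc m"] by auto
  show ?thesis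
    unfolding Gamma_sum_eq_shape_idem_mult[OF w0]
    by (metis mult.assoc shape_idem_central[OF x] shape_idem_central[OF x'])
qed

text \<open>By \<open>near_class_conj\<close> the two permutations are conjugate under the subgroup
  fixing n, with which \<Gamma> commutes.\<close>

lemma Gamma_sum_near_class:
  assumes s: "\<sigma> \<in> near_class (Suc m) lam i" and t: "\<tau> \<in> near_class (Suc m) lam i"
  shows "to_galg (Gamma_sum (Suc m) rho l) \<sigma> = to_galg (Gamma_sum (Suc m) rho l) \<tau>"
proof -
  let ?n = "Suc m" and ?g = "Gamma_sum (Suc m) rho l"
  obtain \<pi> where \<pi>: "\<pi> permutes {1..?n}" "\<pi> ?n = ?n" "\<And>x. \<tau> (\<pi> x) = \<pi> (\<sigma> x)"
    using near_class_conj[OF s t] by auto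
  have P: "\<sigma> permutes {1..?n}" "\<tau> permutes {1..?n}" using s t by (auto simp: near_class_def)
  note app = app_Fperm[OF P(1)] app_Fperm[OF P(2)] app_Fperm[OF \<pi>(1)]
  have "Fperm \<pi> \<in> Sym m" using Sym_Suc_iff[of "Fperm \<pi>" m] Fperm_Sym[OF \<pi>(1)] \<pi>(2) app by simp
  then have c: "gr (Fperm \<pi>) * ?g = ?g * gr (Fperm \<pi>)" by (intro Gamma_sum_commute GA_gr)
  have "Fperm \<tau> + Fperm \<pi> = Fperm \<pi> + Fperm \<sigma>"
    by (rule fperm_eqI) (simp add: app \<pi>(3))
  then have "Fperm \<tau> = Fperm \<pi> + Fperm \<sigma> + - Fperm \<pi>"
    by (metis add.assoc add.right_neutral right_minus)
  moreover have "coef ?g (Fperm \<sigma>) = coef (gr (Fperm \<pi>) * ?g) (Fperm \<pi> + Fperm \<sigma>)"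
    by (simp flip: add.assoc)
  moreover have "coef (?g * gr (Fperm \<pi>)) (Fperm \<pi> + Fperm \<sigma>) = coef ?g (Fperm \<pi> + Fperm \<sigma> + - Fperm \<pi>)"
    by simp
  ultimately show ?thesis
    using c permutes_imp_permutation[OF P(1)] permutes_imp_permutation[OF P(2)] by (simp add: to_galg_def)
qed

section \<open>Expansion in near classes\<close>

definition index_set :: "nat \<Rightarrow> (nat multiset \<times> nat) set" where
  "index_set n = (SIGMA rho:partitions n. set_mset rho)"

lemma finite_index_set [simp]: "finite (index_set n)"
  unfolding index_set_def by (rule finite_SigmaI) (auto simp: finite_partitions)

lemma sum_index_set: "(\<Sum>rho\<in>partitions n. \<Sum>l\<in>set_mset rho. f rho l) = (\<Sum>(rho, l)\<in>index_set n. f rho l)"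
  unfolding index_set_def by (rule sum.Sigma) (auto simp: finite_partitions)

lemma near_class_index_set:
  assumes "1 \<le> n" "\<sigma> permutes {1..n}"
  shows "(cycle_type n \<sigma>, card (orbit \<sigma> n)) \<in> index_set n"
  using cycle_type_partition[OF assms(2)] card_orbit_in_cycle_type[OF assms(1)] by (simp add: index_set_def)

lemma K_sum:
  assumes n: "1 \<le> n"
  shows "(\<Sum>lam\<in>partitions n. \<Sum>i\<in>set_mset lam. a lam i * K n lam i \<sigma>) =
    (if \<sigma> permutes {1..n} then a (cycle_type n \<sigma>) (card (orbit \<sigma> n)) else 0)"
proof -
  have "(\<Sum>lam\<in>partitions n. \<Sum>i\<in>set_mset lam. a lam i * K n lam i \<sigma>) =
      (\<Sum>b\<in>index_set n. if b = (cycle_type n \<sigma>, card (orbit \<sigma> n)) then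
         (if \<sigma> permutes {1..n} then a (cycle_type n \<sigma>) (card (orbit \<sigma> n)) else 0) else 0)"
    unfolding sum_index_set by (rule sum.cong) (auto simp: K_def near_class_def split: if_splits)
  also have "\<dots> = (if \<sigma> permutes {1..n} then a (cycle_type n \<sigma>) (card (orbit \<sigma> n)) else 0)"
    using near_class_index_set[OF n, of \<sigma>] by simp
  finally show ?thesis .
qed

text \<open>Non-emptiness of the near classes gives the uniqueness that the definite description
  demands: a coefficient is the value at any member of its class.\<close>

lemma K_coeff_eq:
  assumes n: "1 \<le> n"
    and ne: "\<And>lam i. (lam, i) \<in> index_set n \<Longrightarrow> near_class n lam i \<noteq> {}"
    and supp: "\<And>\<sigma>. \<not> \<sigma> permutes {1..n} \<Longrightarrow> g \<sigma> = 0"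
    and const: "\<And>lam i \<sigma>. (lam, i) \<in> index_set n \<Longrightarrow> \<sigma> \<in> near_class n lam i \<Longrightarrow> g \<sigma> = h lam i"
    and mu: "(mu, j) \<in> index_set n"
  shows "K_coeff n mu j g = h mu j"
proof -
  \<comment> \<open>The description prescribes 0 outside the index set, so h is cut off
    there.\<close>
  define a where "a lam i = (if (lam, i) \<in> index_set n then h lam i else 0)" for lam i
  have "K_coeff n mu j g = a mu j"
    unfolding K_coeff_def
  proof (rule arg_cong[where f = "\<lambda>a. a mu j"], rule the_equality)
    show "(\<forall>lam i. \<not> (lam \<in> partitions n \<and> i \<in># lam) \<longrightarrow> a lam i = 0) \<and>
        g = (\<lambda>\<sigma>. \<Sum>lam\<in>partitions n. \<Sum>i\<in>set_mset lam. a lam i * K n lam i \<sigma>)"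
    proof (intro conjI allI impI ext)
      fix \<sigma>
      show "g \<sigma> = (\<Sum>lam\<in>partitions n. \<Sum>i\<in>set_mset lam. a lam i * K n lam i \<sigma>)"
        unfolding K_sum[OF n]
        using supp[of \<sigma>] const[OF near_class_index_set[OF n], of \<sigma> \<sigma>] near_class_index_set[OF n, of \<sigma>]
        by (auto simp: a_def near_class_def)
    qed (auto simp: a_def index_set_def)
  next
    fix a' assume a': "(\<forall>lam i. \<not> (lam \<in> partitions n \<and> i \<in># lam) \<longrightarrow> a' lam i = 0) \<and>
        g = (\<lambda>\<sigma>. \<Sum>lam\<in>partitions n. \<Sum>i\<in>set_mset lam. a' lam i * K n lam i \<sigma>)"
    show "a' = a"
    proof (intro ext)
      fix lam i
      show "a' lam i = a lam i"
      proof (cases "(lam, i) \<in> index_set n")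
        case True
        then obtain \<sigma> where s: "\<sigma> \<in> near_class n lam i" using ne by blast
        have "g \<sigma> = a' lam i" using a' s unfolding K_sum[OF n] by (auto simp: near_class_def)
        then show ?thesis using const[OF True s] True by (simp add: a_def)
      next
        case False
        then show ?thesis using a' by (auto simp: a_def index_set_def)
      qed
    qed
  qed
  then show ?thesis using mu by (simp add: a_def)
qed

section \<open>The matrix of values of \<Gamma> on near classes\<close>

text \<open>On an empty class the chosen value would be arbitrary. In the orthogonality relation it
  is harmless, being weighted by the size 0 of the class.\<close>

definition Gamma_val :: "nat \<Rightarrow> nat multiset \<times> nat \<Rightarrow> nat multiset \<times> nat \<Rightarrow> complex" where
  "Gamma_val n a b = to_galg (Gamma_sum n (fst a) (snd a)) (SOME \<sigma>. \<sigma> \<in> near_class n (fst b) (snd b))"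

lemma Gamma_val_eq:
  "\<sigma> \<in> near_class (Suc m) lam i \<Longrightarrow> to_galg (Gamma_sum (Suc m) rho l) \<sigma> = Gamma_val (Suc m) (rho, l) (lam, i)"
proof -
  assume s: "\<sigma> \<in> near_class (Suc m) lam i"
  then have "(SOME \<sigma>. \<sigma> \<in> near_class (Suc m) lam i) \<in> near_class (Suc m) lam i"
    by (metis someI_ex)
  from Gamma_sum_near_class[OF s this] show ?thesis by (simp add: Gamma_val_def)
qed

abbreviation ncard :: "nat \<Rightarrow> nat multiset \<times> nat \<Rightarrow> complex" where
  "ncard n b \<equiv> of_nat (card (near_class n (fst b) (snd b)))"

abbreviation Gamma_tr :: "nat \<Rightarrow> nat multiset \<times> nat \<Rightarrow> complex" where
  "Gamma_tr n a \<equiv> tr (Gamma_sum n (fst a) (snd a))"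

lemma Gamma_tr_nonzero: "a \<in> index_set (Suc m) \<Longrightarrow> Gamma_tr (Suc m) a \<noteq> 0"
proof -
  assume "a \<in> index_set (Suc m)"
  then have a: "fst a \<in> partitions (Suc m)" "snd a \<in># fst a" by (auto simp: index_set_def)
  show ?thesis
    using tr_Gamma_sum[OF a] num_SYT_pos[OF a(1)] num_SYT_pos[OF lower_part_partition[OF a]]
    by (simp del: fact_Suc)
qed

text \<open>The trace of a product of two \<Gamma> is expanded over all permutations and grouped by
  near class; inverses stay in the class.\<close>

lemma Gamma_val_orthogonality:
  assumes n: "n = Suc m"
  shows "(\<Sum>b\<in>index_set n. Gamma_val n a b * (ncard n b * Gamma_val n a' b)) = (if a = a' then Gamma_tr n a else 0)"
proof -
  let ?S = "{p. p permutes {1..n}}" and ?G = "\<lambda>a. Gamma_sum n (fst a) (snd a)"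
  let ?cl = "\<lambda>p. (cycle_type n p, card (orbit p n))"
  have "(if a = a' then Gamma_tr n a else 0) = tr (?G a * ?G a')"
    by (auto simp: Gamma_sum_orth prod_eq_iff)
  also have "\<dots> = (\<Sum>\<sigma>\<in>Sym n. coef (?G a) \<sigma> * coef (?G a') (- \<sigma>))" by (rule tr_mult[OF Gamma_sum_GA])
  also have "\<dots> = (\<Sum>\<sigma>\<in>Sym n. to_galg (?G a) (app \<sigma>) * to_galg (?G a') (inv (app \<sigma>)))"
    by (rule sum.cong) (auto simp: to_galg_def app_inverse permutation_inverse simp flip: app_uminus)
  also have "\<dots> = (\<Sum>p\<in>?S. to_galg (?G a) p * to_galg (?G a') (inv p))"
    by (rule sum.reindex_bij_betw[OF bij_betw_app_Sym])
  also have "\<dots> = (\<Sum>b\<in>index_set n. \<Sum>p\<in>{p \<in> ?S. ?cl p = b}. to_galg (?G a) p * to_galg (?G a') (inv p))"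
  proof (rule sum.group[symmetric])
    show "?cl ` ?S \<subseteq> index_set n" using near_class_index_set[of n] n by auto
  qed (auto simp: finite_permutations)
  also have "\<dots> = (\<Sum>b\<in>index_set n. Gamma_val n a b * (ncard n b * Gamma_val n a' b))"
  proof (rule sum.cong)
    fix b assume "b \<in> index_set n"
    have c: "{p \<in> ?S. ?cl p = b} = near_class n (fst b) (snd b)" by (auto simp: near_class_def)
    have "(\<Sum>p\<in>{p \<in> ?S. ?cl p = b}. to_galg (?G a) p * to_galg (?G a') (inv p)) =
        (\<Sum>p\<in>near_class n (fst b) (snd b). Gamma_val n a b * Gamma_val n a' b)"
      unfolding c
    proof (rule sum.cong)
      fix p assume p: "p \<in> near_class n (fst b) (snd b)"
      have "to_galg (?G a) p = Gamma_val n a b" using Gamma_val_eq[of p m "fst b" "snd b"] p n by simp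
      moreover have "to_galg (?G a') (inv p) = Gamma_val n a' b"
        using Gamma_val_eq[of "inv p" m "fst b" "snd b"] near_class_inv[OF p] n by simp
      ultimately show "to_galg (?G a) p * to_galg (?G a') (inv p) = Gamma_val n a b * Gamma_val n a' b" by simp
    qed simp
    then show "(\<Sum>p\<in>{p \<in> ?S. ?cl p = b}. to_galg (?G a) p * to_galg (?G a') (inv p)) = Gamma_val n a b * (ncard n b * Gamma_val n a' b)"
      by (simp add: mult_ac)
  qed simp
  finally show ?thesis by simp
qed

text \<open>Rows and columns of the value matrix have the same index set, so the orthogonality of
  rows passes to columns.\<close>

lemma Gamma_val_inverse:
  assumes n: "n = Suc m" and b: "b \<in> index_set n" "b' \<in> index_set n"
  shows "(\<Sum>a\<in>index_set n. ncard n b * Gamma_val n a b / Gamma_tr n a * Gamma_val n a b') = (if b = b' then 1 else 0)"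
proof (rule square_inverse_commute[where f = "Gamma_val n" and g = "\<lambda>b a. ncard n b * Gamma_val n a b / Gamma_tr n a"
      and I = "index_set n" and J = "index_set n"])
  fix a a' assume a: "a \<in> index_set n" "a' \<in> index_set n"
  have "(\<Sum>b\<in>index_set n. Gamma_val n a b * (ncard n b * Gamma_val n a' b / Gamma_tr n a')) =
      (\<Sum>b\<in>index_set n. Gamma_val n a b * (ncard n b * Gamma_val n a' b)) / Gamma_tr n a'"
    by (simp add: sum_divide_distrib)
  also have "\<dots> = (if a = a' then 1 else 0)"
    unfolding Gamma_val_orthogonality[OF n] using Gamma_tr_nonzero a n by auto
  finally show "(\<Sum>b\<in>index_set n. Gamma_val n a b * (ncard n b * Gamma_val n a' b / Gamma_tr n a')) = (if a = a' then 1 else 0)" .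
qed (use b in auto)

text \<open>An empty class has weight 0, which would make its diagonal entry in the inverse relation
  0 instead of 1. No permutation of the given type has to be constructed.\<close>

lemma near_class_nonempty: "(lam, i) \<in> index_set (Suc m) \<Longrightarrow> near_class (Suc m) lam i \<noteq> {}"
proof
  assume b: "(lam, i) \<in> index_set (Suc m)" and e: "near_class (Suc m) lam i = {}"
  show False using Gamma_val_inverse[OF refl b b] e by simp
qed

section \<open>Multiplication in the idempotent basis\<close>

definition Gamma_comb :: "nat \<Rightarrow> (nat multiset \<times> nat \<Rightarrow> complex) \<Rightarrow> ga" where
  "Gamma_comb n c = (\<Sum>a\<in>index_set n. sc (c a) * Gamma_sum n (fst a) (snd a))"

lemma Gamma_comb_GA: "Gamma_comb n c \<in> GA n"
  unfolding Gamma_comb_def by (intro GA_sum GA_mult GA_sc Gamma_sum_GA)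

lemma Gamma_comb_mult: "Gamma_comb n c * Gamma_comb n c' = Gamma_comb n (\<lambda>a. c a * c' a)"
proof -
  let ?G = "\<lambda>a. Gamma_sum n (fst a) (snd a)"
  have "Gamma_comb n c * Gamma_comb n c' = (\<Sum>a\<in>index_set n. \<Sum>a'\<in>index_set n. sc (c a) * ?G a * (sc (c' a') * ?G a'))"
    unfolding Gamma_comb_def by (rule sum_product)
  also have "\<dots> = (\<Sum>a\<in>index_set n. \<Sum>a'\<in>index_set n. if a = a' then sc (c a * c' a) * ?G a else 0)"
  proof (intro sum.cong refl)
    fix a a'
    have "sc (c a) * ?G a * (sc (c' a') * ?G a') = sc (c a) * (sc (c' a') * (?G a * ?G a'))"
      by (simp add: mult.assoc sc_left_commute[of "Gamma_sum _ _ _"])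
    also have "?G a * ?G a' = (if a = a' then ?G a else 0)" by (auto simp: Gamma_sum_orth prod_eq_iff)
    finally show "sc (c a) * ?G a * (sc (c' a') * ?G a') = (if a = a' then sc (c a * c' a) * ?G a else 0)"
      by (simp add: sc_mult mult.assoc)
  qed
  also have "\<dots> = Gamma_comb n (\<lambda>a. c a * c' a)" unfolding Gamma_comb_def by (intro sum.cong refl) simp
  finally show ?thesis .
qed

lemma to_galg_Gamma_comb:
  "\<sigma> \<in> near_class (Suc m) lam i \<Longrightarrow> to_galg (Gamma_comb (Suc m) c) \<sigma> = (\<Sum>a\<in>index_set (Suc m). c a * Gamma_val (Suc m) a (lam, i))"
proof -
  assume s: "\<sigma> \<in> near_class (Suc m) lam i"
  have "to_galg (Gamma_comb (Suc m) c) \<sigma> = (\<Sum>a\<in>index_set (Suc m). c a * to_galg (Gamma_sum (Suc m) (fst a) (snd a)) \<sigma>)"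
    unfolding Gamma_comb_def to_galg_sum by (intro sum.cong refl) (simp add: to_galg_def)
  then show ?thesis using Gamma_val_eq[OF s] by simp
qed

text \<open>This is tr (K \<Gamma>) / tr \<Gamma>, the coordinate of K at the idempotent
  \<Gamma>.\<close>

definition K_in_Gamma :: "nat \<Rightarrow> nat multiset \<times> nat \<Rightarrow> nat multiset \<times> nat \<Rightarrow> complex" where
  "K_in_Gamma n b a = ncard n b * Gamma_val n a b / Gamma_tr n a"

lemma K_eq_Gamma_comb:
  assumes b: "(lam, i) \<in> index_set (Suc m)"
  shows "K (Suc m) lam i = to_galg (Gamma_comb (Suc m) (K_in_Gamma (Suc m) (lam, i)))"
proof
  fix \<sigma>
  let ?n = "Suc m"
  show "K ?n lam i \<sigma> = to_galg (Gamma_comb ?n (K_in_Gamma ?n (lam, i))) \<sigma>"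
  proof (cases "\<sigma> permutes {1..?n}")
    case False
    then show ?thesis using to_galg_nonperm[OF Gamma_comb_GA False] by (simp add: K_def near_class_def)
  next
    case True
    let ?b = "(cycle_type ?n \<sigma>, card (orbit \<sigma> ?n))"
    have bJ: "?b \<in> index_set ?n" using near_class_index_set[OF _ True] by simp
    have s: "\<sigma> \<in> near_class ?n (cycle_type ?n \<sigma>) (card (orbit \<sigma> ?n))" using True by (simp add: near_class_def)
    have "to_galg (Gamma_comb ?n (K_in_Gamma ?n (lam, i))) \<sigma> = (if (lam, i) = ?b then 1 else 0)"
      unfolding to_galg_Gamma_comb[OF s] K_in_Gamma_def by (rule Gamma_val_inverse[OF refl b bJ])
    then show ?thesis using True by (auto simp: K_def near_class_def)
  qed
qed

lemma ga_prod_Gamma_comb: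
  "ks \<noteq> [] \<Longrightarrow> ga_prod n (map (\<lambda>k. to_galg (Gamma_comb n (c k))) ks) = to_galg (Gamma_comb n (\<lambda>a. prod_list (map (\<lambda>k. c k a) ks)))"
proof (induction ks rule: list_nonempty_induct)
  case (single k)
  then show ?case by (simp add: ga_prod_def ga_one_to_galg ga_mult_to_galg Gamma_comb_GA)
next
  case (cons k ks)
  then show ?case
    using ga_mult_to_galg[OF Gamma_comb_GA] by (simp add: ga_prod_def Gamma_comb_mult)
qed

theorem theorem3p8:
  fixes n r j :: nat
    and lam :: "nat \<Rightarrow> nat multiset" and i :: "nat \<Rightarrow> nat"
    and mu :: "nat multiset"
  assumes "r \<ge> 1"
    and "\<And>k. k \<in> {1..r} \<Longrightarrow> lam k \<in> partitions n"
    and "\<And>k. k \<in> {1..r} \<Longrightarrow> i k \<in># lam k"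
    and "mu \<in> partitions n"
    and "j \<in># mu"
  shows "K_coeff n mu j (ga_prod n (map (\<lambda>k. K n (lam k) (i k)) [1..<Suc r])) =
    1 / fact n *
      (\<Sum>rho\<in>partitions n. \<Sum>l\<in>set_mset rho.
         gen_char n rho l mu j * of_nat (num_SYT rho) / of_nat (num_SYT (lower_part l rho)) ^ r *
         (\<Prod>k\<in>{1..r}. of_nat (card (near_class n (lam k) (i k))) * gen_char n rho l (lam k) (i k)))"
proof -
  \<comment> \<open>Having a part, the partition is of a positive number, so n is a
    successor.\<close>
  obtain R where "mu = add_mset j R" using assms(5) by (metis mset_add)
  then have "n \<noteq> 0" using assms(4) by (auto simp: partitions_def)
  then obtain m where n: "n = Suc m" using not0_implies_Suc by blast
  have muJ: "(mu, j) \<in> index_set n" using assms by (simp add: index_set_def)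
  have kJ: "(lam k, i k) \<in> index_set n" if "k \<in> {1..r}" for k using assms(2,3)[OF that] by (simp add: index_set_def)
  define c where "c k = K_in_Gamma n (lam k, i k)" for k
  have prod: "ga_prod n (map (\<lambda>k. K n (lam k) (i k)) [1..<Suc r]) = to_galg (Gamma_comb n (\<lambda>a. \<Prod>k\<in>{1..r}. c k a))"
  proof -
    have mp: "map (\<lambda>k. K n (lam k) (i k)) [1..<Suc r] = map (\<lambda>k. to_galg (Gamma_comb n (c k))) [1..<Suc r]"
      using kJ K_eq_Gamma_comb[of _ _ m] n by (intro map_cong refl) (auto simp: c_def)
    have ne: "[1..<Suc r] \<noteq> []" using assms(1) by simp
    have "prod_list (map (\<lambda>k. c k a) [1..<Suc r]) = (\<Prod>k\<in>{1..r}. c k a)" for a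
      by (simp add: prod.distinct_set_conv_list[symmetric] atLeastLessThanSuc_atLeastAtMost del: upt_Suc)
    then show ?thesis unfolding mp ga_prod_Gamma_comb[OF ne] by (simp only:)
  qed
  have coeff: "K_coeff n lam' i' g = h lam' i'"
    if "(lam', i') \<in> index_set n" "\<And>\<sigma>. \<not> \<sigma> permutes {1..n} \<Longrightarrow> g \<sigma> = 0"
      "\<And>lam i \<sigma>. (lam, i) \<in> index_set n \<Longrightarrow> \<sigma> \<in> near_class n lam i \<Longrightarrow> g \<sigma> = h lam i" for g h lam' i'
    using that near_class_nonempty n by (intro K_coeff_eq) auto
  have lhs: "K_coeff n mu j (ga_prod n (map (\<lambda>k. K n (lam k) (i k)) [1..<Suc r])) =
      (\<Sum>a\<in>index_set n. (\<Prod>k\<in>{1..r}. c k a) * Gamma_val n a (mu, j))"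
    unfolding prod
    by (rule coeff[OF muJ, of _ "\<lambda>lam i. \<Sum>a\<in>index_set n. (\<Prod>k\<in>{1..r}. c k a) * Gamma_val n a (lam, i)"])
       (use to_galg_nonperm[OF Gamma_comb_GA] to_galg_Gamma_comb[of _ m] n in auto)
  have gen: "gen_char n rho l lam' i' = fact n / of_nat (num_SYT rho) * Gamma_val n (rho, l) (lam', i')"
    if "rho \<in> partitions n" "(lam', i') \<in> index_set n" for rho l lam' i'
  proof -
    have "K_coeff n lam' i' (to_galg (Gamma_sum n rho l)) = Gamma_val n (rho, l) (lam', i')"
      by (rule coeff[OF that(2), of _ "\<lambda>lam i. Gamma_val n (rho, l) (lam, i)"])
         (use to_galg_nonperm[OF Gamma_sum_GA] Gamma_val_eq[of _ m] n in auto)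
    then show ?thesis using Gam_eq[of rho m l] that n by (simp add: gen_char_def)
  qed
  have summand: "1 / fact n * (gen_char n rho l mu j * of_nat (num_SYT rho) / of_nat (num_SYT (lower_part l rho)) ^ r *
         (\<Prod>k\<in>{1..r}. of_nat (card (near_class n (lam k) (i k))) * gen_char n rho l (lam k) (i k))) =
      (\<Prod>k\<in>{1..r}. c k (rho, l)) * Gamma_val n (rho, l) (mu, j)" if a: "(rho, l) \<in> index_set n" for rho l
  proof -
    have rho: "rho \<in> partitions (Suc m)" "l \<in># rho" using a n by (auto simp: index_set_def)
    let ?d = "of_nat (num_SYT rho) :: complex" and ?d' = "of_nat (num_SYT (lower_part l rho)) :: complex"
    have d: "?d \<noteq> 0" "?d' \<noteq> 0"
      using num_SYT_pos[OF rho(1)] num_SYT_pos[OF lower_part_partition[OF rho]] by auto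
    \<comment> \<open>Here \<gamma> = (n! / d) \<Gamma>(C) and tr \<Gamma> = d' d / n!, so n! / d
      equals d' / tr \<Gamma>. The r copies of d' cancel the denominator of the summand.\<close>
    have ck: "of_nat (card (near_class n (lam k) (i k))) * gen_char n rho l (lam k) (i k) = ?d' * c k (rho, l)"
      if k: "k \<in> {1..r}" for k
      unfolding c_def K_in_Gamma_def fst_conv snd_conv gen[OF rho(1)[folded n] kJ[OF k]] tr_Gamma_sum[OF rho, folded n]
      using d by (simp add: field_simps)
    have "(\<Prod>k\<in>{1..r}. of_nat (card (near_class n (lam k) (i k))) * gen_char n rho l (lam k) (i k)) =
        (\<Prod>k\<in>{1..r}. ?d' * c k (rho, l))"
      by (rule prod.cong) (use ck in auto)
    also have "\<dots> = ?d' ^ r * (\<Prod>k\<in>{1..r}. c k (rho, l))" by (simp add: prod.distrib)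
    finally show ?thesis
      using gen[OF _ muJ, of rho l] rho n d by (simp add: field_simps del: fact_Suc)
  qed
  have "(\<Sum>a\<in>index_set n. (\<Prod>k\<in>{1..r}. c k a) * Gamma_val n a (mu, j)) =
      (\<Sum>(rho, l)\<in>index_set n. 1 / fact n * (gen_char n rho l mu j * of_nat (num_SYT rho) / of_nat (num_SYT (lower_part l rho)) ^ r *
         (\<Prod>k\<in>{1..r}. of_nat (card (near_class n (lam k) (i k))) * gen_char n rho l (lam k) (i k))))"
  proof (rule sum.cong[OF refl], clarify)
    fix rho l assume a: "(rho, l) \<in> index_set n"
    show "(\<Prod>k\<in>{1..r}. c k (rho, l)) * Gamma_val n (rho, l) (mu, j) = 1 / fact n * (gen_char n rho l mu j *
        of_nat (num_SYT rho) / of_nat (num_SYT (lower_part l rho)) ^ r *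
        (\<Prod>k\<in>{1..r}. of_nat (card (near_class n (lam k) (i k))) * gen_char n rho l (lam k) (i k)))"
      by (rule summand[OF a, symmetric])
  qed
  also have "\<dots> = 1 / fact n *
      (\<Sum>rho\<in>partitions n. \<Sum>l\<in>set_mset rho.
         gen_char n rho l mu j * of_nat (num_SYT rho) / of_nat (num_SYT (lower_part l rho)) ^ r *
         (\<Prod>k\<in>{1..r}. of_nat (card (near_class n (lam k) (i k))) * gen_char n rho l (lam k) (i k)))"
    unfolding sum_index_set sum_distrib_left by (rule sum.cong) auto
  finally show ?thesis unfolding lhs .
qed

end
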